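(* Let $\tilde\gamma=\gamma\otimes\mu$ with $\gamma\in V_{\mathbb C}^*$, $\mu\in T^\vee$, and let $i$, $\sigma$ be attached to $\mu$ as in the context. Then $$\mathcal L_{\mathbb H_B(\mu)}(E_1(\tilde\gamma))\cong\mathcal L_{\mathbb H_{gr}(\mu_i)}(M_i({}^\sigma\gamma)),\qquad \operatorname{lg}_{\mathbb H_B(\mu)}E_1(\tilde\gamma)=\operatorname{lg}_{\mathbb H_{gr}(\mu_i)}M_i({}^\sigma\gamma).$$ In particular, $E_1(\tilde\gamma)$ is a simple $\mathbb H_B(\mu)$-module if and only if $M_i({}^\sigma\gamma)$ is a simple $\mathbb H_{gr}(\mu_i)$-module.
   Context: Let $n\ge 2$ and let $V$ be a real Euclidean space with orthonormal basis $\epsilon_1,\dots,\epsilon_n$; $V_{\mathbb C}$ is its complexification, $V_{\mathbb C}^*$ the dual of $V_{\mathbb C}$, $S(V_{\mathbb C})$ the symmetric algebra. Let $R_B=\{\pm\epsilon_i\pm\epsilon_j\ (i<j),\ \pm\epsilon_l\}$ be the root system of type $B_n$, with Weyl group $W_B\subset GL(V)$. For a root $\alpha$, $s_\alpha$ is the reflection and $\alpha^\vee\in V^*$ the coroot, so $s_\alpha(v)=v-\langle\alpha^\vee,v\rangle\alpha$. Put $\alpha_{i,j}=\epsilon_i-\epsilon_j$, $R_A=\{\alpha_{i,j}:i\ne j\}$, $S_A=\{\alpha_i=\epsilon_i-\epsilon_{i+1}:1\le i\le n-1\}$; $W_A\cong\mathfrak S_n$ is the Weyl group of $R_A$ (permuting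 the $\epsilon_i$), and $T\cong\{\pm1\}^n$ is the subgroup of $W_B$ generated by the $s_{\epsilon_i}$; $W_B=T\rtimes W_A$. Let $t_w$ ($w\in W_B$) be the standard basis of $\mathbb C W_B$, $t_i=t_{s_{\epsilon_i}}$. Fix $k\in\mathbb C$, $k\neq0$, and put $\tilde k_{\alpha_{i,j}}=k(1+t_it_j)\in\mathbb C T$ for $i\neq j$. $\mathbb H_B$ is the unital associative $\mathbb C$-algebra generated by $S(V_{\mathbb C})$ and $\mathbb C W_B$ (each with its own multiplication) subject to: $t_x\zeta=\zeta t_x$ for $x\in T$, $\zeta\in V$; and $t_{s_\alpha}\zeta=s_\alpha(\zeta)t_{s_\alpha}+\langle\alpha^\vee,s_\alpha(\zeta)\rangle\tilde k_\alpha$ for $\alpha\in S_A$, $\zeta\in V$. $T^\vee$ is the group of characters of $T$. For $w\in W_A$: ${}^w\mu(x)=\mu(w^{-1}xw)$ and ${}^w\gamma(\zeta)=\gamma(w^{-1}(\zeta))$. For $\tilde\gamma=\gamma\otimes\mu$, a character of the commutative subalgebra $S(V_{\mathbb C})\otimes\mathbb C T$ with one-dimensional module $\mathbb C v_{\tilde\gamma}$, put $M(\tilde\gamma)=\mathbb H_B\otimes_{S(V_{\mathbb C})\otimes\mathbb C T}\mathbb C v_{\tilde\gamma}$, with basis $t_w\otimes v_{\tilde\gamma}$, $w\in W_A$. $W_A(\mu)$ is the stabilizer of $\mu$ in $W_A$, $\mathbb H_B(\mu)$ is the subalgebra of $\mathbb H_B$ generated by $V$, $W_A(\mu)$ and $T$,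 and $E_1(\tilde\gamma)=\bigoplus_{w\in W_A(\mu)}\mathbb C\,t_w\otimes v_{\tilde\gamma}\subset M(\tilde\gamma)$, which is stable under $\mathbb H_B(\mu)$. Given $\mu$, let $i$ be the number of $j$ with $\mu(t_j)=1$; write $j_1<\dots<j_i$ for the indices with $\mu(t_j)=1$ and $j_{i+1}<\dots<j_n$ for those with $\mu(t_j)=-1$. Let $\sigma\in W_A$ be the element with $\sigma(\epsilon_{j_p})=\epsilon_p$ for all $p$, and $\mu_i={}^\sigma\mu$. Let $R_i=\{\pm\alpha_{p,q}: 1\le p<q\le i \text{ or } i<p<q\le n\}$, with simple roots $S_i=\{\alpha_p:p\ne i, 1\le p\le n-1\}$ and Weyl group $W(R_i)=W_A(\mu_i)$. $\mathbb H_{gr}(\mu_i)$ is the graded Hecke algebra generated by $S(V_{\mathbb C})$ and $\mathbb C W(R_i)$ with relations $t_{s_\alpha}\zeta=s_\alpha(\zeta)t_{s_\alpha}+2k\langle\alpha^\vee,s_\alpha(\zeta)\rangle$ ($\alpha\in S_i$, $\zeta\in V$). For $\nu\in V_{\mathbb C}^*$, $M_i(\nu)=\mathbb H_{gr}(\mu_i)\otimes_{S(V_{\mathbb C})}\mathbb C v_\nu$, where $S(V_{\mathbb C})$ acts on $\mathbb C v_\nu$ by $\nu$. For an algebra $R$ and an $R$-module $M$, $\mathcal L_R(M)$ is the inclusion-ordered lattice of submodules and $\operatorname{lg}_R(M)$ the length. $\mathcal L_R(M)\cong\mathcal L_S(N)$ means there is a $\mathbb C$-linear isomorphism $f:M\to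 N$ such that $X\mapsto f(X)$ induces an isomorphism of ordered lattices from $\mathcal L_R(M)$ onto $\mathcal L_S(N)$. *)

theory Defs
  imports "HOL-Algebra.Algebra" "HOL-Analysis.Analysis" "HOL-Library.Poly_Mapping"
    "HOL-Library.Extended_Nat"
begin

section \<open>Free and presented algebras\<close>

text \<open>
  The free unital \<open>\<complex>\<close>-algebra on a set of symbols is the monoid algebra of the free monoid. The
  free monoid is written additively, because the convolution product of the library type of finitely
  supported functions uses the additive monoid of the keys.
\<close>

datatype 'x word = Word (letters: "'x list")

instantiation word :: (type) monoid_add
begin

definition zero_word :: "'a word"
  where "0 = Word []"

definition plus_word :: "'a word \<Rightarrow> 'a word \<Rightarrow> 'a word"
  where "u + v = Word (letters u @ letters v)"

instance
  by intro_classes (auto simp: zero_word_def plus_word_def)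

end

type_synonym 'x ncpoly = "'x word \<Rightarrow>\<^sub>0 complex"

definition symb :: "'x \<Rightarrow> 'x ncpoly"
  where "symb x = Poly_Mapping.single (Word [x]) 1"

definition const :: "complex \<Rightarrow> 'x ncpoly"
  where "const c = Poly_Mapping.single 0 c"

text \<open>
  A \<open>\<complex>\<close>-algebra is a record of type \<open>(complex, 'a) module\<close>: a ring together with
  scalar multiplication by complex numbers.
\<close>

definition free_algebra :: "'x set \<Rightarrow> (complex, 'x ncpoly) module"
  where "free_algebra A =
    \<lparr>carrier = {p. \<forall>w \<in> Poly_Mapping.keys p. set (letters w) \<subseteq> A},
     monoid.mult = (*), one = 1, ring.zero = 0, ring.add = (+), module.smult = (\<lambda>c p. const c * p)\<rparr>"

text \<open>A presentation is a pair (generators, relators).\<close>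

type_synonym 'x presentation = "'x set \<times> 'x ncpoly set"

definition relation_ideal :: "'x presentation \<Rightarrow> 'x ncpoly set"
  where "relation_ideal P = Idl\<^bsub>free_algebra (fst P)\<^esub> (snd P)"

definition residue_class :: "'x presentation \<Rightarrow> 'x ncpoly \<Rightarrow> 'x ncpoly set"
  where "residue_class P p = relation_ideal P +>\<^bsub>free_algebra (fst P)\<^esub> p"

definition presented_algebra :: "'x presentation \<Rightarrow> (complex, 'x ncpoly set) module"
  where "presented_algebra P =
    (let Q = free_algebra (fst P) Quot relation_ideal P
     in ring.extend Q (module.fields (\<lambda>c Y. residue_class P (const c) \<otimes>\<^bsub>Q\<^esub> Y)))"


section \<open>Modules over a possibly noncommutative algebra\<close>

text \<open>
  A left module over \<open>R\<close> is again a record of type \<open>('r, 'm) module\<close>; its ring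
  multiplication and unit carry no meaning. The library predicate \<open>submodule\<close> does not assume
  that \<open>R\<close> is commutative, whereas the library locale \<open>module\<close> does.
\<close>

definition generated_subalgebra :: "(complex, 'r) module \<Rightarrow> 'r set \<Rightarrow> 'r set"
  where "generated_subalgebra H G =
    generate_ring H ({c \<odot>\<^bsub>H\<^esub> \<one>\<^bsub>H\<^esub> | c. True} \<union> G)"

definition scalar_act :: "(complex, 'r) module \<Rightarrow> ('r, 'm) module \<Rightarrow> complex \<Rightarrow> 'm \<Rightarrow> 'm"
  where "scalar_act H M c x = (c \<odot>\<^bsub>H\<^esub> \<one>\<^bsub>H\<^esub>) \<odot>\<^bsub>M\<^esub> x"

definition complex_span :: "(complex, 'r) module \<Rightarrow> ('r, 'm) module \<Rightarrow> 'm set \<Rightarrow> 'm set"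
  where "complex_span H M S =
    \<Inter>{N. submodule N (H\<lparr>carrier := {c \<odot>\<^bsub>H\<^esub> \<one>\<^bsub>H\<^esub> | c. True}\<rparr>) M \<and> S \<subseteq> N}"

definition submodules :: "(complex, 'r) module \<Rightarrow> ('r, 'm) module \<Rightarrow> 'm set set"
  where "submodules R M = {N. submodule N R M}"

definition module_length :: "(complex, 'r) module \<Rightarrow> ('r, 'm) module \<Rightarrow> enat"
  where "module_length R M =
    Sup {enat l | l. \<exists>N. (\<forall>p \<le> l. N p \<in> submodules R M) \<and> (\<forall>p < l. N p \<subset> N (Suc p))}"

definition simple_module :: "(complex, 'r) module \<Rightarrow> ('r, 'm) module \<Rightarrow> bool"
  where "simple_module R M \<longleftrightarrow>
    carrier M \<noteq> {\<zero>\<^bsub>M\<^esub>} \<and> (\<forall>N \<in> submodules R M. N = {\<zero>\<^bsub>M\<^esub>} \<or> N = carrier M)"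

definition submodule_lattices_iso ::
    "(complex, 'r) module \<Rightarrow> ('r, 'm) module \<Rightarrow> (complex, 's) module \<Rightarrow> ('s, 'k) module \<Rightarrow> bool"
  where "submodule_lattices_iso R M S N \<longleftrightarrow>
    (\<exists>f. bij_betw f (carrier M) (carrier N) \<and>
      (\<forall>x \<in> carrier M. \<forall>y \<in> carrier M. f (x \<oplus>\<^bsub>M\<^esub> y) = f x \<oplus>\<^bsub>N\<^esub> f y) \<and>
      (\<forall>c. \<forall>x \<in> carrier M. f (scalar_act R M c x) = scalar_act S N c (f x)) \<and>
      bij_betw (\<lambda>Y. f ` Y) (submodules R M) (submodules S N) \<and>
      (\<forall>Y \<in> submodules R M. \<forall>Z \<in> submodules R M. Y \<subseteq> Z \<longleftrightarrow> f ` Y \<subseteq> f ` Z))"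

text \<open>
  The tensor product \<open>R \<otimes>\<^sub>A N\<close> of \<open>R\<close>, as a right module over its subring \<open>A\<close>, with a left
  \<open>A\<close>-module \<open>N\<close>: the free abelian group on pairs modulo the biadditive and \<open>A\<close>-balanced relations,
  with \<open>R\<close> acting on the left factor.
\<close>

definition tensor_relators ::
    "(complex, 'r) module \<Rightarrow> 'r set \<Rightarrow> ('r, 'm) module \<Rightarrow> ('r \<times> 'm \<Rightarrow>\<^sub>0 int) set"
  where "tensor_relators R A N =
    {frag_of (r \<oplus>\<^bsub>R\<^esub> s, x) - frag_of (r, x) - frag_of (s, x) | r s x.
       r \<in> carrier R \<and> s \<in> carrier R \<and> x \<in> carrier N} \<union>
    {frag_of (r, x \<oplus>\<^bsub>N\<^esub> y) - frag_of (r, x) - frag_of (r, y) | r x y.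
       r \<in> carrier R \<and> x \<in> carrier N \<and> y \<in> carrier N} \<union>
    {frag_of (r \<otimes>\<^bsub>R\<^esub> a, x) - frag_of (r, a \<odot>\<^bsub>N\<^esub> x) | r a x.
       r \<in> carrier R \<and> a \<in> A \<and> x \<in> carrier N}"

definition tensor_group :: "(complex, 'r) module \<Rightarrow> ('r, 'm) module \<Rightarrow> ('r \<times> 'm \<Rightarrow>\<^sub>0 int) monoid"
  where "tensor_group R N = free_Abelian_group (carrier R \<times> carrier N)"

definition tensor_kernel ::
    "(complex, 'r) module \<Rightarrow> 'r set \<Rightarrow> ('r, 'm) module \<Rightarrow> ('r \<times> 'm \<Rightarrow>\<^sub>0 int) set"
  where "tensor_kernel R A N = generate (tensor_group R N) (tensor_relators R A N)"

definition tensor_module ::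
    "(complex, 'r) module \<Rightarrow> 'r set \<Rightarrow> ('r, 'm) module \<Rightarrow> ('r, ('r \<times> 'm \<Rightarrow>\<^sub>0 int) set) module"
  where "tensor_module R A N =
    (let G = tensor_group R N; K = tensor_kernel R A N in
     \<lparr>carrier = carrier (G Mod K), monoid.mult = undefined, one = undefined,
      ring.zero = \<one>\<^bsub>G Mod K\<^esub>, ring.add = monoid.mult (G Mod K),
      module.smult = (\<lambda>r Y. \<Union>p \<in> Y. K #>\<^bsub>G\<^esub> frag_extend (\<lambda>(s, x). frag_of (r \<otimes>\<^bsub>R\<^esub> s, x)) p)\<rparr>)"

definition pure_tensor ::
    "(complex, 'r) module \<Rightarrow> 'r set \<Rightarrow> ('r, 'm) module \<Rightarrow> 'r \<Rightarrow> 'm \<Rightarrow> ('r \<times> 'm \<Rightarrow>\<^sub>0 int) set"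
  where "pure_tensor R A N r x = tensor_kernel R A N #>\<^bsub>tensor_group R N\<^esub> frag_of (r, x)"

definition algebra_character :: "(complex, 'r) module \<Rightarrow> 'r set \<Rightarrow> ('r \<Rightarrow> complex) \<Rightarrow> bool"
  where "algebra_character H A \<theta> \<longleftrightarrow>
    (\<forall>a \<in> A. \<forall>b \<in> A. \<theta> (a \<oplus>\<^bsub>H\<^esub> b) = \<theta> a + \<theta> b \<and> \<theta> (a \<otimes>\<^bsub>H\<^esub> b) = \<theta> a * \<theta> b) \<and>
    (\<forall>c. \<theta> (c \<odot>\<^bsub>H\<^esub> \<one>\<^bsub>H\<^esub>) = c)"

text \<open>The one-dimensional module \<open>\<complex> v\<close> of a character, with \<open>v = 1\<close>.\<close>

definition character_module :: "('r \<Rightarrow> complex) \<Rightarrow> ('r, complex) module"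
  where "character_module \<theta> =
    \<lparr>carrier = UNIV, monoid.mult = undefined, one = undefined, ring.zero = 0, ring.add = (+),
     module.smult = (\<lambda>a z. \<theta> a * z)\<rparr>"


section \<open>The root system of type B and its Weyl group\<close>

definition orthonormal_basis :: "nat \<Rightarrow> (nat \<Rightarrow> 'v::euclidean_space) \<Rightarrow> bool"
  where "orthonormal_basis n \<epsilon> \<longleftrightarrow>
    (\<forall>p \<in> {1..n}. \<forall>q \<in> {1..n}. \<epsilon> p \<bullet> \<epsilon> q = (if p = q then 1 else 0)) \<and> span (\<epsilon> ` {1..n}) = UNIV"

definition coroot :: "'v::euclidean_space \<Rightarrow> 'v \<Rightarrow> real"
  where "coroot \<alpha> v = 2 * (\<alpha> \<bullet> v) / (\<alpha> \<bullet> \<alpha>)"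

definition root_reflection :: "'v::euclidean_space \<Rightarrow> 'v \<Rightarrow> 'v"
  where "root_reflection \<alpha> v = v - coroot \<alpha> v *\<^sub>R \<alpha>"

definition reflection_group :: "'v::euclidean_space set \<Rightarrow> ('v \<Rightarrow> 'v) set"
  where "reflection_group R = generate (BijGroup UNIV) (root_reflection ` R)"

definition roots_B :: "nat \<Rightarrow> (nat \<Rightarrow> 'v::euclidean_space) \<Rightarrow> 'v set"
  where "roots_B n \<epsilon> =
    {a *\<^sub>R \<epsilon> p + b *\<^sub>R \<epsilon> q | a b p q. a \<in> {1, -1} \<and> b \<in> {1, -1} \<and> 1 \<le> p \<and> p < q \<and> q \<le> n} \<union>
    {a *\<^sub>R \<epsilon> l | a l. a \<in> {1, -1} \<and> l \<in> {1..n}}"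

definition roots_A :: "nat \<Rightarrow> (nat \<Rightarrow> 'v::euclidean_space) \<Rightarrow> 'v set"
  where "roots_A n \<epsilon> = {\<epsilon> p - \<epsilon> q | p q. p \<in> {1..n} \<and> q \<in> {1..n} \<and> p \<noteq> q}"

definition simple_root :: "(nat \<Rightarrow> 'v::euclidean_space) \<Rightarrow> nat \<Rightarrow> 'v"
  where "simple_root \<epsilon> p = \<epsilon> p - \<epsilon> (p + 1)"

definition weyl_B :: "nat \<Rightarrow> (nat \<Rightarrow> 'v::euclidean_space) \<Rightarrow> ('v \<Rightarrow> 'v) set"
  where "weyl_B n \<epsilon> = reflection_group (roots_B n \<epsilon>)"

definition weyl_A :: "nat \<Rightarrow> (nat \<Rightarrow> 'v::euclidean_space) \<Rightarrow> ('v \<Rightarrow> 'v) set"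
  where "weyl_A n \<epsilon> = reflection_group (roots_A n \<epsilon>)"

definition sign_group :: "nat \<Rightarrow> (nat \<Rightarrow> 'v::euclidean_space) \<Rightarrow> ('v \<Rightarrow> 'v) set"
  where "sign_group n \<epsilon> = reflection_group (\<epsilon> ` {1..n})"

definition sign_character ::
    "nat \<Rightarrow> (nat \<Rightarrow> 'v::euclidean_space) \<Rightarrow> (('v \<Rightarrow> 'v) \<Rightarrow> complex) \<Rightarrow> bool"
  where "sign_character n \<epsilon> \<mu> \<longleftrightarrow>
    \<mu> id = 1 \<and> (\<forall>x \<in> sign_group n \<epsilon>. \<forall>y \<in> sign_group n \<epsilon>. \<mu> (x \<circ> y) = \<mu> x * \<mu> y)"

definition twist_sign_character ::
    "('v \<Rightarrow> 'v) \<Rightarrow> (('v \<Rightarrow> 'v) \<Rightarrow> complex) \<Rightarrow> ('v \<Rightarrow> 'v) \<Rightarrow> complex"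
  where "twist_sign_character w \<mu> x = \<mu> (inv_into UNIV w \<circ> x \<circ> w)"

definition stabilizer_A ::
    "nat \<Rightarrow> (nat \<Rightarrow> 'v::euclidean_space) \<Rightarrow> (('v \<Rightarrow> 'v) \<Rightarrow> complex) \<Rightarrow> ('v \<Rightarrow> 'v) set"
  where "stabilizer_A n \<epsilon> \<mu> =
    {w \<in> weyl_A n \<epsilon>. \<forall>x \<in> sign_group n \<epsilon>. twist_sign_character w \<mu> x = \<mu> x}"

definition roots_split :: "nat \<Rightarrow> nat \<Rightarrow> (nat \<Rightarrow> 'v::euclidean_space) \<Rightarrow> 'v set"
  where "roots_split n i \<epsilon> =
    {a *\<^sub>R (\<epsilon> p - \<epsilon> q) | a p q.
       a \<in> {1, -1} \<and> (1 \<le> p \<and> p < q \<and> q \<le> i \<or> i < p \<and> p < q \<and> q \<le> n)}"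


section \<open>The complexification\<close>

text \<open>\<open>V\<^sub>\<complex> = V \<oplus> \<i>V\<close>, the pair \<open>(x, y)\<close> standing for \<open>x + \<i>y\<close>.\<close>

type_synonym 'v cpx = "'v \<times> 'v"

definition cscale :: "complex \<Rightarrow> ('v::real_vector) cpx \<Rightarrow> 'v cpx"
  where "cscale c z =
    (Re c *\<^sub>R fst z - Im c *\<^sub>R snd z, Re c *\<^sub>R snd z + Im c *\<^sub>R fst z)"

definition real_vec :: "'v::real_vector \<Rightarrow> 'v cpx"
  where "real_vec v = (v, 0)"

definition complex_functional :: "(('v::real_vector) cpx \<Rightarrow> complex) \<Rightarrow> bool"
  where "complex_functional \<gamma> \<longleftrightarrow>
    (\<forall>x y. \<gamma> (x + y) = \<gamma> x + \<gamma> y) \<and> (\<forall>c x. \<gamma> (cscale c x) = c * \<gamma> x)"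

definition twist_functional :: "('v \<Rightarrow> 'v) \<Rightarrow> ('v cpx \<Rightarrow> complex) \<Rightarrow> 'v cpx \<Rightarrow> complex"
  where "twist_functional w \<gamma> z = \<gamma> (map_prod (inv_into UNIV w) (inv_into UNIV w) z)"


section \<open>The Hecke algebras\<close>

datatype 'v hecke_gen = Vec "'v cpx" | Grp "'v \<Rightarrow> 'v"

abbreviation vec_symb :: "'v cpx \<Rightarrow> 'v hecke_gen ncpoly"
  where "vec_symb \<zeta> \<equiv> symb (Vec \<zeta>)"

abbreviation grp_symb :: "('v \<Rightarrow> 'v) \<Rightarrow> 'v hecke_gen ncpoly"
  where "grp_symb w \<equiv> symb (Grp w)"

definition sym_relators :: "('v::euclidean_space) hecke_gen ncpoly set"
  where "sym_relators =
    {vec_symb (\<zeta> + \<eta>) - (vec_symb \<zeta> + vec_symb \<eta>) | \<zeta> \<eta>. True} \<union>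
    {vec_symb (cscale c \<zeta>) - const c * vec_symb \<zeta> | c \<zeta>. True} \<union>
    {vec_symb \<zeta> * vec_symb \<eta> - vec_symb \<eta> * vec_symb \<zeta> | \<zeta> \<eta>. True}"

definition group_relators :: "('v \<Rightarrow> 'v) set \<Rightarrow> ('v::euclidean_space) hecke_gen ncpoly set"
  where "group_relators W =
    {grp_symb id - 1} \<union>
    {grp_symb u * grp_symb w - grp_symb (u \<circ> w) | u w. u \<in> W \<and> w \<in> W}"

text \<open>The relator of \<open>t\<^bsub>s\<^sub>\<alpha>\<^esub> \<zeta> = s\<^sub>\<alpha>(\<zeta>) t\<^bsub>s\<^sub>\<alpha>\<^esub> + \<langle>\<alpha>\<^sup>\<vee>, s\<^sub>\<alpha>(\<zeta>)\<rangle> m\<close>.\<close>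

definition cross_relator ::
    "'v::euclidean_space \<Rightarrow> 'v hecke_gen ncpoly \<Rightarrow> 'v \<Rightarrow> 'v hecke_gen ncpoly"
  where "cross_relator \<alpha> m \<zeta> =
    grp_symb (root_reflection \<alpha>) * vec_symb (real_vec \<zeta>)
    - (vec_symb (real_vec (root_reflection \<alpha> \<zeta>)) * grp_symb (root_reflection \<alpha>)
       + const (complex_of_real (coroot \<alpha> (root_reflection \<alpha> \<zeta>))) * m)"

definition k_tilde ::
    "(nat \<Rightarrow> 'v::euclidean_space) \<Rightarrow> complex \<Rightarrow> nat \<Rightarrow> nat \<Rightarrow> 'v hecke_gen ncpoly"
  where "k_tilde \<epsilon> k p q =
    const k * (1 + grp_symb (root_reflection (\<epsilon> p)) * grp_symb (root_reflection (\<epsilon> q)))"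

definition H_B_pres ::
    "nat \<Rightarrow> (nat \<Rightarrow> 'v::euclidean_space) \<Rightarrow> complex \<Rightarrow> 'v hecke_gen presentation"
  where "H_B_pres n \<epsilon> k =
    (range Vec \<union> Grp ` weyl_B n \<epsilon>,
     sym_relators \<union> group_relators (weyl_B n \<epsilon>) \<union>
     {grp_symb x * vec_symb (real_vec \<zeta>) - vec_symb (real_vec \<zeta>) * grp_symb x | x \<zeta>.
        x \<in> sign_group n \<epsilon>} \<union>
     {cross_relator (simple_root \<epsilon> p) (k_tilde \<epsilon> k p (p + 1)) \<zeta> | p \<zeta>. p \<in> {1..n - 1}})"

definition H_gr_pres ::
    "nat \<Rightarrow> nat \<Rightarrow> (nat \<Rightarrow> 'v::euclidean_space) \<Rightarrow> complex \<Rightarrow> 'v hecke_gen presentation"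
  where "H_gr_pres n i \<epsilon> k =
    (range Vec \<union> Grp ` reflection_group (roots_split n i \<epsilon>),
     sym_relators \<union> group_relators (reflection_group (roots_split n i \<epsilon>)) \<union>
     {cross_relator (simple_root \<epsilon> p) (const (2 * k)) \<zeta> | p \<zeta>. p \<in> {1..n - 1} \<and> p \<noteq> i})"

abbreviation H_B ::
    "nat \<Rightarrow> (nat \<Rightarrow> 'v::euclidean_space) \<Rightarrow> complex \<Rightarrow> (complex, 'v hecke_gen ncpoly set) module"
  where "H_B n \<epsilon> k \<equiv> presented_algebra (H_B_pres n \<epsilon> k)"

abbreviation H_gr ::
    "nat \<Rightarrow> nat \<Rightarrow> (nat \<Rightarrow> 'v::euclidean_space) \<Rightarrow> complex \<Rightarrow>
      (complex, 'v hecke_gen ncpoly set) module"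
  where "H_gr n i \<epsilon> k \<equiv> presented_algebra (H_gr_pres n i \<epsilon> k)"

definition vec_elems :: "'v hecke_gen presentation \<Rightarrow> 'v hecke_gen ncpoly set set"
  where "vec_elems P = {residue_class P (vec_symb \<zeta>) | \<zeta>. True}"

definition grp_elems ::
    "'v hecke_gen presentation \<Rightarrow> ('v \<Rightarrow> 'v) set \<Rightarrow> 'v hecke_gen ncpoly set set"
  where "grp_elems P W = (\<lambda>w. residue_class P (grp_symb w)) ` W"


section \<open>The induced modules\<close>

text \<open>
  The subalgebra \<open>S(V\<^sub>\<complex>) \<otimes> \<complex>T\<close> of \<open>H_B\<close>, and its character \<open>\<gamma> \<otimes> \<mu>\<close>. A character of this subalgebra
  is determined by its values on \<open>V\<^sub>\<complex>\<close> and \<open>T\<close>, so the choice is immaterial.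
\<close>

definition commutative_part ::
    "nat \<Rightarrow> (nat \<Rightarrow> 'v::euclidean_space) \<Rightarrow> complex \<Rightarrow> 'v hecke_gen ncpoly set set"
  where "commutative_part n \<epsilon> k =
    generated_subalgebra (H_B n \<epsilon> k)
      (vec_elems (H_B_pres n \<epsilon> k) \<union> grp_elems (H_B_pres n \<epsilon> k) (sign_group n \<epsilon>))"

definition tensor_character ::
    "nat \<Rightarrow> (nat \<Rightarrow> 'v::euclidean_space) \<Rightarrow> complex \<Rightarrow> ('v cpx \<Rightarrow> complex) \<Rightarrow>
      (('v \<Rightarrow> 'v) \<Rightarrow> complex) \<Rightarrow> 'v hecke_gen ncpoly set \<Rightarrow> complex"
  where "tensor_character n \<epsilon> k \<gamma> \<mu> =
    (SOME \<theta>. algebra_character (H_B n \<epsilon> k) (commutative_part n \<epsilon> k) \<theta> \<and>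
      (\<forall>\<zeta>. \<theta> (residue_class (H_B_pres n \<epsilon> k) (vec_symb \<zeta>)) = \<gamma> \<zeta>) \<and>
      (\<forall>x \<in> sign_group n \<epsilon>. \<theta> (residue_class (H_B_pres n \<epsilon> k) (grp_symb x)) = \<mu> x))"

definition principal_B ::
    "nat \<Rightarrow> (nat \<Rightarrow> 'v::euclidean_space) \<Rightarrow> complex \<Rightarrow> ('v cpx \<Rightarrow> complex) \<Rightarrow>
      (('v \<Rightarrow> 'v) \<Rightarrow> complex) \<Rightarrow>
      ('v hecke_gen ncpoly set, ('v hecke_gen ncpoly set \<times> complex \<Rightarrow>\<^sub>0 int) set) module"
  where "principal_B n \<epsilon> k \<gamma> \<mu> =
    tensor_module (H_B n \<epsilon> k) (commutative_part n \<epsilon> k)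
      (character_module (tensor_character n \<epsilon> k \<gamma> \<mu>))"

definition H_B_sub ::
    "nat \<Rightarrow> (nat \<Rightarrow> 'v::euclidean_space) \<Rightarrow> complex \<Rightarrow> (('v \<Rightarrow> 'v) \<Rightarrow> complex) \<Rightarrow>
      (complex, 'v hecke_gen ncpoly set) module"
  where "H_B_sub n \<epsilon> k \<mu> =
    (H_B n \<epsilon> k)\<lparr>carrier := generated_subalgebra (H_B n \<epsilon> k)
      ({residue_class (H_B_pres n \<epsilon> k) (vec_symb (real_vec \<zeta>)) | \<zeta>. True} \<union>
       grp_elems (H_B_pres n \<epsilon> k) (stabilizer_A n \<epsilon> \<mu>) \<union>
       grp_elems (H_B_pres n \<epsilon> k) (sign_group n \<epsilon>))\<rparr>"

definition E_one ::
    "nat \<Rightarrow> (nat \<Rightarrow> 'v::euclidean_space) \<Rightarrow> complex \<Rightarrow> ('v cpx \<Rightarrow> complex) \<Rightarrow>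
      (('v \<Rightarrow> 'v) \<Rightarrow> complex) \<Rightarrow>
      ('v hecke_gen ncpoly set, ('v hecke_gen ncpoly set \<times> complex \<Rightarrow>\<^sub>0 int) set) module"
  where "E_one n \<epsilon> k \<gamma> \<mu> =
    (principal_B n \<epsilon> k \<gamma> \<mu>)\<lparr>carrier :=
      complex_span (H_B n \<epsilon> k) (principal_B n \<epsilon> k \<gamma> \<mu>)
        ((\<lambda>w. pure_tensor (H_B n \<epsilon> k) (commutative_part n \<epsilon> k)
                (character_module (tensor_character n \<epsilon> k \<gamma> \<mu>))
                (residue_class (H_B_pres n \<epsilon> k) (grp_symb w)) 1) ` stabilizer_A n \<epsilon> \<mu>)\<rparr>"

definition symmetric_part ::
    "nat \<Rightarrow> nat \<Rightarrow> (nat \<Rightarrow> 'v::euclidean_space) \<Rightarrow> complex \<Rightarrow> 'v hecke_gen ncpoly set set"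
  where "symmetric_part n i \<epsilon> k =
    generated_subalgebra (H_gr n i \<epsilon> k) (vec_elems (H_gr_pres n i \<epsilon> k))"

definition symmetric_character ::
    "nat \<Rightarrow> nat \<Rightarrow> (nat \<Rightarrow> 'v::euclidean_space) \<Rightarrow> complex \<Rightarrow> ('v cpx \<Rightarrow> complex) \<Rightarrow>
      'v hecke_gen ncpoly set \<Rightarrow> complex"
  where "symmetric_character n i \<epsilon> k \<nu> =
    (SOME \<theta>. algebra_character (H_gr n i \<epsilon> k) (symmetric_part n i \<epsilon> k) \<theta> \<and>
      (\<forall>\<zeta>. \<theta> (residue_class (H_gr_pres n i \<epsilon> k) (vec_symb \<zeta>)) = \<nu> \<zeta>))"

definition principal_gr ::
    "nat \<Rightarrow> nat \<Rightarrow> (nat \<Rightarrow> 'v::euclidean_space) \<Rightarrow> complex \<Rightarrow> ('v cpx \<Rightarrow> complex) \<Rightarrow>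
      ('v hecke_gen ncpoly set, ('v hecke_gen ncpoly set \<times> complex \<Rightarrow>\<^sub>0 int) set) module"
  where "principal_gr n i \<epsilon> k \<nu> =
    tensor_module (H_gr n i \<epsilon> k) (symmetric_part n i \<epsilon> k)
      (character_module (symmetric_character n i \<epsilon> k \<nu>))"


section \<open>The combinatorial data attached to a character\<close>

text \<open>These conditions determine \<open>i\<close>, \<open>\<sigma>\<close> and the values of \<open>j\<close> on \<open>{1..n}\<close> uniquely.\<close>

definition attached_data ::
    "nat \<Rightarrow> (nat \<Rightarrow> 'v::euclidean_space) \<Rightarrow> (('v \<Rightarrow> 'v) \<Rightarrow> complex) \<Rightarrow>
      nat \<Rightarrow> (nat \<Rightarrow> nat) \<Rightarrow> ('v \<Rightarrow> 'v) \<Rightarrow> bool"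
  where "attached_data n \<epsilon> \<mu> i j \<sigma> \<longleftrightarrow>
    i = card {q \<in> {1..n}. \<mu> (root_reflection (\<epsilon> q)) = 1} \<and>
    strict_mono_on {1..i} j \<and>
    j ` {1..i} = {q \<in> {1..n}. \<mu> (root_reflection (\<epsilon> q)) = 1} \<and>
    strict_mono_on {i+1..n} j \<and>
    j ` {i+1..n} = {q \<in> {1..n}. \<mu> (root_reflection (\<epsilon> q)) = -1} \<and>
    \<sigma> \<in> weyl_A n \<epsilon> \<and>
    (\<forall>p \<in> {1..n}. \<sigma> (\<epsilon> (j p)) = \<epsilon> p)"

end

theory Submission
  imports Defs "HOL-Library.Function_Algebras"
begin

text \<open>
  Both modules are induced from characters, and both become concrete on spaces of functions on a
  finite group: \<open>M\<^sub>i(\<^sup>\<sigma>\<gamma>)\<close> on all functions on \<open>W(R\<^sub>i)\<close>, and \<open>E\<^sub>1\<close> on the functions on \<open>W\<^sub>A\<close> that are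
  supported on the stabilizer \<open>W\<^sub>A(\<mu>)\<close>. A group element acts by left translation, and \<open>\<zeta> \<in> V\<close> acts by
  an operator of Dunkl type
  \<open>(Y\<^sub>\<zeta> f)(w) = \<nu>(w\<inverse>\<zeta>) f(w) - \<Sum> \<kappa>(w\<inverse>\<alpha>) \<langle>\<alpha>\<^sup>\<vee>, \<zeta>\<rangle> f(s\<^sub>\<alpha> w)\<close>,
  the sum running over the positive roots \<open>\<alpha>\<close> for which \<open>w\<inverse>\<alpha>\<close> is positive too (\<open>hecke_data\<close>).

  The comparison is then immediate. For \<open>H\<^sub>B\<close> the weight \<open>\<kappa>(\<epsilon>\<^sub>a - \<epsilon>\<^sub>b) = k (1 + \<mu>(t\<^sub>a) \<mu>(t\<^sub>b))\<close> is \<open>2k\<close> if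
  \<open>\<mu>\<close> has the same sign at \<open>a\<close> and \<open>b\<close>, and \<open>0\<close> otherwise. So on functions supported on \<open>W\<^sub>A(\<mu>)\<close> only the
  roots that join indices of equal sign contribute. Conjugation by \<open>\<sigma>\<close> carries these roots to \<open>R\<^sub>i\<close>, and
  it preserves positivity because \<open>\<sigma>\<close> keeps the order of the indices within each of the two blocks. Hence
  the substitution \<open>w \<mapsto> \<sigma>w\<sigma>\<inverse>\<close> turns \<open>Y\<^sub>\<zeta>\<close> into the operator \<open>Y\<^sub>\<sigma>\<^sub>\<zeta>\<close> of the graded Hecke algebra (\<open>Phi_Y\<close>)
  and translation by \<open>w\<close> into translation by \<open>\<sigma>w\<sigma>\<inverse>\<close> (\<open>Phi_T\<close>), while \<open>T\<close> acts by the scalars \<open>\<mu>\<close>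
  (\<open>sign_stab\<close>). A submodule is a subspace stable under the generators, so the submodules on the two sides
  correspond (\<open>stable_transfer\<close>); lengths and simplicity follow.

  What remains is to identify the induced modules with the function spaces. The operators have to satisfy
  the defining relations. The cross relations hold because a simple reflection permutes the positive roots
  other than its own root (\<open>T_Y\<close>). They imply that the commutators of the operators \<open>Y\<^sub>\<zeta>\<close> are permuted by
  translation with simple reflections; as these commutators annihilate the function \<open>\<delta>\<^sub>1\<close>, an eigenvector
  of all \<open>Y\<^sub>\<zeta>\<close>, they vanish (\<open>Y_commute\<close>). The eigenvector shows that the required characters exist
  (\<open>character_exists\<close>), and it yields a homomorphism \<open>\<psi>\<close> from the induced module to the functions.
  Since the vectors \<open>t\<^sub>w \<otimes> v\<close> span the induced module (\<open>spanned\<close>) and \<open>\<psi>\<close> sends them to the functions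
  \<open>\<delta>\<^sub>w\<close>, which are linearly independent, \<open>\<psi>\<close> is bijective (\<open>psi_bij\<close>).
\<close>

section \<open>Presented algebras\<close>

lemma carrier_free_algebra:
  "p \<in> carrier (free_algebra A) \<longleftrightarrow> (\<forall>w \<in> Poly_Mapping.keys p. set (letters w) \<subseteq> A)"
  by (simp add: free_algebra_def)

lemma free_algebra_ops [simp]:
  "monoid.mult (free_algebra A) = (*)" "one (free_algebra A) = 1"
  "ring.zero (free_algebra A) = 0" "ring.add (free_algebra A) = (+)"
  "module.smult (free_algebra A) = (\<lambda>c p. const c * p)"
  by (simp_all add: free_algebra_def)

lemma free_algebra_closed [simp]:
  "0 \<in> carrier (free_algebra A)" "1 \<in> carrier (free_algebra A)" "const c \<in> carrier (free_algebra A)"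
  "x \<in> A \<Longrightarrow> symb x \<in> carrier (free_algebra A)"
  "\<lbrakk>p \<in> carrier (free_algebra A); q \<in> carrier (free_algebra A)\<rbrakk> \<Longrightarrow> p + q \<in> carrier (free_algebra A)"
  "\<lbrakk>p \<in> carrier (free_algebra A); q \<in> carrier (free_algebra A)\<rbrakk> \<Longrightarrow> p - q \<in> carrier (free_algebra A)"
  "\<lbrakk>p \<in> carrier (free_algebra A); q \<in> carrier (free_algebra A)\<rbrakk> \<Longrightarrow> p * q \<in> carrier (free_algebra A)"
  "p \<in> carrier (free_algebra A) \<Longrightarrow> - p \<in> carrier (free_algebra A)"
proof -
  show "0 \<in> carrier (free_algebra A)" "1 \<in> carrier (free_algebra A)"
    "const c \<in> carrier (free_algebra A)" "x \<in> A \<Longrightarrow> symb x \<in> carrier (free_algebra A)"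
    by (auto simp: carrier_free_algebra const_def symb_def zero_word_def)
  assume p: "p \<in> carrier (free_algebra A)"
  then show "- p \<in> carrier (free_algebra A)"
    by (auto simp: carrier_free_algebra in_keys_iff)
  assume q: "q \<in> carrier (free_algebra A)"
  show "p + q \<in> carrier (free_algebra A)"
    using p q Poly_Mapping.keys_add[of p q] by (auto simp: carrier_free_algebra)
  show "p - q \<in> carrier (free_algebra A)"
    using p q Poly_Mapping.keys_diff[of p q] by (auto simp: carrier_free_algebra)
  show "p * q \<in> carrier (free_algebra A)"
    using p q set_mp[OF Poly_Mapping.keys_mult[of p q]]
    by (fastforce simp: carrier_free_algebra plus_word_def)
qed

lemma ring_free_algebra: "ring (free_algebra A)"
proof (rule ringI)
  show "abelian_group (free_algebra A)"
    by (rule abelian_groupI) (auto simp: algebra_simps intro!: bexI[of _ "- _"])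
  show "monoid (free_algebra A)"
    by (rule monoidI) (auto simp: algebra_simps)
qed (auto simp: algebra_simps)

lemma free_algebra_minus [simp]:
  assumes "p \<in> carrier (free_algebra A)"
  shows "\<ominus>\<^bsub>free_algebra A\<^esub> p = - p"
proof -
  interpret ring "free_algebra A" by (rule ring_free_algebra)
  show ?thesis
    using assms by (intro minus_equality) auto
qed

locale presentation =
  fixes P :: "'x presentation"
  assumes relators: "snd P \<subseteq> carrier (free_algebra (fst P))"
begin

abbreviation "\<F> \<equiv> free_algebra (fst P)"
abbreviation "\<H> \<equiv> presented_algebra P"
abbreviation "cl \<equiv> residue_class P"

sublocale free: ring \<F>
  by (rule ring_free_algebra)

lemma ideal_relation_ideal: "ideal (relation_ideal P) \<F>"
  unfolding relation_ideal_def by (rule free.genideal_ideal) (rule relators)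

sublocale rel: ideal "relation_ideal P" \<F>
  by (rule ideal_relation_ideal)

lemma quotient_ops:
  "carrier \<H> = cl ` carrier \<F>" "monoid.mult \<H> = rcoset_mult \<F> (relation_ideal P)"
  "one \<H> = cl 1" "ring.zero \<H> = relation_ideal P" "ring.add \<H> = set_add \<F>"
  "module.smult \<H> c Y = cl (const c) \<otimes>\<^bsub>\<H>\<^esub> Y"
  by (auto simp: presented_algebra_def Let_def ring.defs module.defs FactRing_def
      A_RCOSETS_def' residue_class_def a_r_coset_def' rcoset_mult_def)

lemma cl_add [simp]:
  "\<lbrakk>p \<in> carrier \<F>; q \<in> carrier \<F>\<rbrakk> \<Longrightarrow> cl p \<oplus>\<^bsub>\<H>\<^esub> cl q = cl (p + q)"
  by (simp add: quotient_ops residue_class_def rel.a_rcos_sum)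

lemma cl_mult [simp]:
  "\<lbrakk>p \<in> carrier \<F>; q \<in> carrier \<F>\<rbrakk> \<Longrightarrow> cl p \<otimes>\<^bsub>\<H>\<^esub> cl q = cl (p * q)"
  by (simp add: quotient_ops residue_class_def rel.rcoset_mult_add)

lemma cl_zero: "\<zero>\<^bsub>\<H>\<^esub> = cl 0"
  using free.a_coset_add_zero[OF rel.a_subset]
  by (simp add: quotient_ops residue_class_def)

lemma cl_smult [simp]: "p \<in> carrier \<F> \<Longrightarrow> c \<odot>\<^bsub>\<H>\<^esub> cl p = cl (const c * p)"
  by (simp add: quotient_ops(6))

lemma cl_scalar: "c \<odot>\<^bsub>\<H>\<^esub> \<one>\<^bsub>\<H>\<^esub> = cl (const c)"
  by (simp add: quotient_ops(3))

lemma cl_closed [simp]: "p \<in> carrier \<F> \<Longrightarrow> cl p \<in> carrier \<H>"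
  by (simp add: quotient_ops)

lemma ring_presented_algebra: "ring \<H>"
proof (rule ringI)
  show "abelian_group \<H>"
  proof (rule abelian_groupI)
    fix x assume "x \<in> carrier \<H>"
    then obtain p where p: "p \<in> carrier \<F>" "x = cl p" by (auto simp: quotient_ops(1))
    then show "\<exists>y\<in>carrier \<H>. y \<oplus>\<^bsub>\<H>\<^esub> x = \<zero>\<^bsub>\<H>\<^esub>"
      by (intro bexI[of _ "cl (- p)"]) (auto simp: cl_zero)
  qed (auto simp: quotient_ops(1) cl_zero algebra_simps)
  show "monoid \<H>"
    by (rule monoidI) (auto simp: quotient_ops(1,3) algebra_simps)
qed (auto simp: quotient_ops(1) algebra_simps)

sublocale alg: ring \<H>
  by (rule ring_presented_algebra)

lemma cl_minus: "p \<in> carrier \<F> \<Longrightarrow> \<ominus>\<^bsub>\<H>\<^esub> cl p = cl (- p)"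
  by (intro alg.minus_equality) (auto simp: cl_zero)

lemma cl_eqI:
  assumes "p - q \<in> snd P" "p \<in> carrier \<F>" "q \<in> carrier \<F>"
  shows "cl p = cl q"
proof -
  have "p - q \<in> relation_ideal P"
    using free.genideal_self[OF relators] assms(1) by (auto simp: relation_ideal_def)
  then have "cl (p - q) = cl 0"
    using free.a_coset_join2[OF _ rel.is_additive_subgroup[THEN additive_subgroup.a_subgroup]] assms cl_zero
    by (simp add: residue_class_def quotient_ops)
  then have "cl (p - q) \<oplus>\<^bsub>\<H>\<^esub> cl q = cl 0 \<oplus>\<^bsub>\<H>\<^esub> cl q" by simp
  then show ?thesis using assms by simp
qed

text \<open>
  A noncommutative polynomial is a sum of scalar multiples of words. Statements about all elements of a
  presented algebra can therefore be proved by induction over the subring generated by the scalars and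
  the generators, in the same way as for its subalgebras.
\<close>

lemma generators_generate: "carrier \<H> = generated_subalgebra \<H> (cl ` symb ` fst P)"
proof
  let ?S = "{c \<odot>\<^bsub>\<H>\<^esub> \<one>\<^bsub>\<H>\<^esub> |c. True} \<union> cl ` symb ` fst P"
  have S: "?S \<subseteq> carrier \<H>" by (auto simp: cl_scalar)
  show "generated_subalgebra \<H> (cl ` symb ` fst P) \<subseteq> carrier \<H>"
    unfolding generated_subalgebra_def by (blast intro: alg.generate_ring_in_carrier[OF S])
  have word: "cl (Poly_Mapping.single (Word xs) 1) \<in> generate_ring \<H> ?S" if "set xs \<subseteq> fst P" for xs
    using that
  proof (induction xs)
    case Nil
    have "cl (Poly_Mapping.single (Word []) 1) = \<one>\<^bsub>\<H>\<^esub>"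
      by (simp add: quotient_ops(3) flip: zero_word_def)
    then show ?case by (simp add: generate_ring.one)
  next
    case (Cons x xs)
    have "Poly_Mapping.single (Word (x # xs)) 1 = symb x * Poly_Mapping.single (Word xs) (1::complex)"
      by (simp add: symb_def mult_single plus_word_def)
    moreover have "Poly_Mapping.single (Word xs) 1 \<in> carrier \<F>"
      using Cons.prems by (auto simp: carrier_free_algebra)
    ultimately have "cl (Poly_Mapping.single (Word (x # xs)) 1) =
        cl (symb x) \<otimes>\<^bsub>\<H>\<^esub> cl (Poly_Mapping.single (Word xs) 1)"
      using Cons.prems by simp
    moreover have "cl (symb x) \<in> generate_ring \<H> ?S"
      using Cons.prems by (intro generate_ring.incl) auto
    ultimately show ?case
      using Cons by (auto intro: generate_ring.eng_mult)
  qed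
  have "cl p \<in> generate_ring \<H> ?S" if "p \<in> carrier \<F>" for p
    using that
  proof (induction p rule: update_induct)
    case const
    have "cl 0 = cl (const 0)" by (simp add: const_def)
    then show ?case
      by (auto simp: cl_scalar intro!: generate_ring.incl)
  next
    case (update p w c)
    have eq: "Poly_Mapping.update w c p = p + const c * Poly_Mapping.single w 1"
      using update.hyps
      by (intro poly_mapping_eqI)
        (auto simp: lookup_update lookup_add const_def mult_single lookup_single in_keys_iff)
    have w: "set (letters w) \<subseteq> fst P" and p: "p \<in> carrier \<F>"
      using update.prems update.hyps
      by (auto simp: carrier_free_algebra keys_update)
    have sw: "Poly_Mapping.single w 1 \<in> carrier \<F>"
      using w by (auto simp: carrier_free_algebra)
    have "cl (const c) \<in> generate_ring \<H> ?S"
      by (auto simp: cl_scalar intro!: generate_ring.incl)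
    moreover have "cl (Poly_Mapping.single w 1) \<in> generate_ring \<H> ?S"
      using word[of "letters w"] w by simp
    ultimately have "cl p \<oplus>\<^bsub>\<H>\<^esub> (cl (const c) \<otimes>\<^bsub>\<H>\<^esub> cl (Poly_Mapping.single w 1)) \<in> generate_ring \<H> ?S"
      using update.IH p by (intro generate_ring.eng_add generate_ring.eng_mult)
    then show ?case
      using p sw by (simp add: eq)
  qed
  then show "carrier \<H> \<subseteq> generated_subalgebra \<H> (cl ` symb ` fst P)"
    by (auto simp: generated_subalgebra_def quotient_ops(1))
qed

end

section \<open>Representations on function spaces\<close>

text \<open>
  Every vector space below is a space of complex functions, so that linear independence of the point
  masses is a matter of evaluation.
\<close>

definition fscale :: "complex \<Rightarrow> ('b \<Rightarrow> complex) \<Rightarrow> 'b \<Rightarrow> complex" (infixr "\<bullet>\<^sub>C" 75)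
  where "c \<bullet>\<^sub>C f = (\<lambda>b. c * f b)"

definition linear_op :: "(('b \<Rightarrow> complex) \<Rightarrow> 'b \<Rightarrow> complex) \<Rightarrow> bool"
  where "linear_op F \<longleftrightarrow> (\<forall>f g. F (f + g) = F f + F g) \<and> (\<forall>c f. F (c \<bullet>\<^sub>C f) = c \<bullet>\<^sub>C F f)"

definition csubspace :: "('b \<Rightarrow> complex) set \<Rightarrow> bool"
  where "csubspace U \<longleftrightarrow> 0 \<in> U \<and> (\<forall>f \<in> U. \<forall>g \<in> U. f + g \<in> U) \<and> (\<forall>c. \<forall>f \<in> U. c \<bullet>\<^sub>C f \<in> U)"

lemma fscale_apply: "(c \<bullet>\<^sub>C f) b = c * f b"
  by (simp add: fscale_def)

lemma fscale_simps [simp]: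
  "1 \<bullet>\<^sub>C f = f" "0 \<bullet>\<^sub>C f = 0" "c \<bullet>\<^sub>C 0 = 0" "c \<bullet>\<^sub>C d \<bullet>\<^sub>C f = (c * d) \<bullet>\<^sub>C f"
  by (auto simp: fun_eq_iff fscale_apply)

lemma fscale_add: "c \<bullet>\<^sub>C (f + g) = c \<bullet>\<^sub>C f + c \<bullet>\<^sub>C g" "(c + d) \<bullet>\<^sub>C f = c \<bullet>\<^sub>C f + d \<bullet>\<^sub>C f"
  by (auto simp: fun_eq_iff fscale_apply algebra_simps)

lemma fscale_minus_one: "(-1) \<bullet>\<^sub>C f = - f"
  by (auto simp: fun_eq_iff fscale_apply)

lemma csubspaceD:
  assumes "csubspace U"
  shows "0 \<in> U" "\<lbrakk>f \<in> U; g \<in> U\<rbrakk> \<Longrightarrow> f + g \<in> U" "f \<in> U \<Longrightarrow> c \<bullet>\<^sub>C f \<in> U"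
    "f \<in> U \<Longrightarrow> - f \<in> U" "\<lbrakk>f \<in> U; g \<in> U\<rbrakk> \<Longrightarrow> f - g \<in> U"
proof -
  show a: "0 \<in> U" "\<And>f g. \<lbrakk>f \<in> U; g \<in> U\<rbrakk> \<Longrightarrow> f + g \<in> U" "\<And>f c. f \<in> U \<Longrightarrow> c \<bullet>\<^sub>C f \<in> U"
    using assms by (auto simp: csubspace_def)
  show m: "- f \<in> U" if "f \<in> U" for f
    using a(3)[OF that, of "-1"] by (simp add: fscale_minus_one)
  show "f - g \<in> U" if "f \<in> U" "g \<in> U"
    using a(2)[OF that(1) m[OF that(2)]] by simp
qed

lemma csubspace_sum:
  assumes "csubspace U" "\<And>x. x \<in> A \<Longrightarrow> f x \<in> U"
  shows "sum f A \<in> U"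
  using assms(2)
  by (induction A rule: infinite_finite_induct) (auto intro: csubspaceD[OF assms(1)])

lemma linear_opD:
  assumes "linear_op F"
  shows "F (f + g) = F f + F g" "F (c \<bullet>\<^sub>C f) = c \<bullet>\<^sub>C F f" "F 0 = 0" "F (f - g) = F f - F g"
proof -
  show a: "F (f + g) = F f + F g" and s: "F (c \<bullet>\<^sub>C f) = c \<bullet>\<^sub>C F f" for f g c
    using assms by (auto simp: linear_op_def)
  show "F 0 = 0" using s[of 0 0] by simp
  show "F (f - g) = F f - F g"
    using a[of f "(-1) \<bullet>\<^sub>C g"] s[of "-1" g] by (simp add: fscale_minus_one)
qed

lemma linear_op_sum:
  assumes "linear_op F"
  shows "F (sum f A) = (\<Sum>x\<in>A. F (f x))"
proof (induction A rule: infinite_finite_induct)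
  case (insert x A)
  then show ?case
    using linear_opD(1)[OF assms, of "f x" "sum f A"] by (simp only: sum.insert[OF insert.hyps])
next
  case (infinite A)
  then show ?case by (simp only: sum.infinite[OF infinite.hyps] linear_opD(3)[OF assms])
qed (simp only: sum.empty linear_opD(3)[OF assms])

lemma sum_fun_apply [simp]: "sum f A x = (\<Sum>a\<in>A. f a x)"
  by (induction A rule: infinite_finite_induct) auto

definition word_act :: "('x \<Rightarrow> ('b \<Rightarrow> complex) \<Rightarrow> 'b \<Rightarrow> complex) \<Rightarrow> 'x word \<Rightarrow> ('b \<Rightarrow> complex) \<Rightarrow> 'b \<Rightarrow> complex"
  where "word_act \<rho> w = foldr \<rho> (letters w)"

definition poly_act :: "('x \<Rightarrow> ('b \<Rightarrow> complex) \<Rightarrow> 'b \<Rightarrow> complex) \<Rightarrow> 'x ncpoly \<Rightarrow> ('b \<Rightarrow> complex) \<Rightarrow> 'b \<Rightarrow> complex"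
  where "poly_act \<rho> p f = (\<Sum>w \<in> Poly_Mapping.keys p. Poly_Mapping.lookup p w \<bullet>\<^sub>C word_act \<rho> w f)"

lemma poly_act_superset:
  assumes "finite S" "Poly_Mapping.keys p \<subseteq> S"
  shows "poly_act \<rho> p f = (\<Sum>w \<in> S. Poly_Mapping.lookup p w \<bullet>\<^sub>C word_act \<rho> w f)"
  unfolding poly_act_def
  by (rule sum.mono_neutral_left) (use assms in \<open>auto simp: in_keys_iff\<close>)

lemma poly_act_add: "poly_act \<rho> (p + q) f = poly_act \<rho> p f + poly_act \<rho> q f"
proof -
  let ?S = "Poly_Mapping.keys p \<union> Poly_Mapping.keys q"
  have "Poly_Mapping.keys (p + q) \<subseteq> ?S" by (rule Poly_Mapping.keys_add)
  then show ?thesis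
    by (simp add: poly_act_superset[of ?S] lookup_add fscale_add sum.distrib)
qed

lemma poly_act_zero [simp]: "poly_act \<rho> 0 f = 0"
  by (simp add: poly_act_def)

lemma poly_act_uminus: "poly_act \<rho> (- p) f = - poly_act \<rho> p f"
  using poly_act_add[of \<rho> p "- p" f] by (simp add: add_eq_0_iff)

lemma poly_act_diff: "poly_act \<rho> (p - q) f = poly_act \<rho> p f - poly_act \<rho> q f"
  using poly_act_add[of \<rho> p "- q" f] by (simp add: poly_act_uminus)

lemma poly_act_single: "poly_act \<rho> (Poly_Mapping.single w c) f = c \<bullet>\<^sub>C word_act \<rho> w f"
  by (cases "c = 0") (auto simp: poly_act_def)

lemma poly_act_basic [simp]:
  "poly_act \<rho> (symb x) f = \<rho> x f" "poly_act \<rho> (const c) f = c \<bullet>\<^sub>C f" "poly_act \<rho> 1 f = f"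
  by (simp_all add: symb_def const_def poly_act_single word_act_def zero_word_def flip: single_one)

lemma poly_decomposition:
  fixes p :: "'a \<Rightarrow>\<^sub>0 'b::comm_monoid_add"
  shows "p = (\<Sum>w \<in> Poly_Mapping.keys p. Poly_Mapping.single w (Poly_Mapping.lookup p w))"
  by (rule poly_mapping_eqI)
    (auto simp: lookup_sum lookup_single when_def in_keys_iff sum.delta')

lemma poly_act_sum: "poly_act \<rho> (sum p A) f = (\<Sum>x\<in>A. poly_act \<rho> (p x) f)"
  by (induction A rule: infinite_finite_induct) (auto simp: poly_act_add)

lemma linear_op_word_act:
  assumes "\<And>x. linear_op (\<rho> x)"
  shows "linear_op (word_act \<rho> w)"
proof -
  have "linear_op (foldr \<rho> xs)" for xs
    by (induction xs) (auto simp: linear_op_def linear_opD[OF assms])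
  then show ?thesis by (simp add: word_act_def)
qed

lemma linear_op_poly_act:
  assumes "\<And>x. linear_op (\<rho> x)"
  shows "linear_op (poly_act \<rho> p)"
  by (auto simp: linear_op_def poly_act_def linear_opD[OF linear_op_word_act[OF assms]]
      fscale_add sum.distrib fun_eq_iff fscale_apply sum_distrib_left mult_ac sum_fun_apply)

lemma poly_act_mult:
  assumes "\<And>x. linear_op (\<rho> x)"
  shows "poly_act \<rho> (p * q) f = poly_act \<rho> p (poly_act \<rho> q f)"
proof -
  have single: "poly_act \<rho> (Poly_Mapping.single u c * Poly_Mapping.single v d) f =
      poly_act \<rho> (Poly_Mapping.single u c) (poly_act \<rho> (Poly_Mapping.single v d) f)" for u v c d
    by (simp add: mult_single poly_act_single linear_opD[OF linear_op_word_act[OF assms]])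
      (simp add: word_act_def plus_word_def)
  have *: "poly_act \<rho> (Poly_Mapping.single u c * q) f = poly_act \<rho> (Poly_Mapping.single u c) (poly_act \<rho> q f)" for u c
    by (subst (1 2) poly_decomposition[of q])
      (simp only: sum_distrib_left poly_act_sum single linear_op_sum[OF linear_op_poly_act[OF assms]])
  show ?thesis
    by (subst (1 2) poly_decomposition[of p]) (simp only: sum_distrib_right poly_act_sum *)
qed

text \<open>
  The relations are only required on \<open>U\<close>: the operators used later are defined on all functions, but
  satisfy the relations only on the functions supported on the group.
\<close>

locale representation = presentation P for P :: "'x presentation" +
  fixes \<rho> :: "'x \<Rightarrow> ('b \<Rightarrow> complex) \<Rightarrow> 'b \<Rightarrow> complex" and U :: "('b \<Rightarrow> complex) set"
  assumes linear: "linear_op (\<rho> x)"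
    and subspace: "csubspace U"
    and stable: "\<lbrakk>x \<in> fst P; f \<in> U\<rbrakk> \<Longrightarrow> \<rho> x f \<in> U"
    and relations: "\<lbrakk>r \<in> snd P; f \<in> U\<rbrakk> \<Longrightarrow> poly_act \<rho> r f = 0"
begin

lemma poly_act_closed:
  assumes "p \<in> carrier \<F>" "f \<in> U"
  shows "poly_act \<rho> p f \<in> U"
proof -
  have "foldr \<rho> xs f \<in> U" if "set xs \<subseteq> fst P" for xs
    using that by (induction xs) (auto intro: stable assms)
  then show ?thesis
    using assms(1) unfolding poly_act_def word_act_def
    by (intro csubspace_sum subspace csubspaceD(3)) (auto simp: carrier_free_algebra)
qed

text \<open>
  The polynomials annihilating \<open>U\<close> form a left ideal, and a right ideal because \<open>U\<close> is stable.
\<close>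

lemma relation_ideal_acts_trivially:
  assumes "p \<in> relation_ideal P" "f \<in> U"
  shows "poly_act \<rho> p f = 0"
proof -
  let ?I = "{p \<in> carrier \<F>. \<forall>f \<in> U. poly_act \<rho> p f = 0}"
  have "ideal ?I \<F>"
  proof (rule idealI)
    show "ring \<F>" by (rule ring_free_algebra)
    show "subgroup ?I (add_monoid \<F>)"
    proof (rule free.add.subgroupI)
      show "?I \<noteq> {}" by (auto intro: exI[of _ 0])
    next
      fix a assume a: "a \<in> ?I"
      then show "\<ominus>\<^bsub>\<F>\<^esub> a \<in> ?I" by (auto simp: poly_act_uminus)
    next
      fix a b assume "a \<in> ?I" "b \<in> ?I"
      then show "a \<oplus>\<^bsub>\<F>\<^esub> b \<in> ?I" by (auto simp: poly_act_add)
    qed auto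
  qed (auto simp: poly_act_mult linear linear_opD[OF linear_op_poly_act[OF linear]] poly_act_closed)
  then have "relation_ideal P \<subseteq> ?I"
    unfolding relation_ideal_def
    by (rule free.genideal_minimal) (use relators relations in auto)
  then show ?thesis using assms by auto
qed

text \<open>
  By the preceding lemma the choice of the representative does not matter on \<open>U\<close>.
\<close>

definition act :: "'x ncpoly set \<Rightarrow> ('b \<Rightarrow> complex) \<Rightarrow> 'b \<Rightarrow> complex"
  where "act Y = poly_act \<rho> (SOME p. p \<in> Y)"

lemma act_cl:
  assumes "p \<in> carrier \<F>" "f \<in> U"
  shows "act (cl p) f = poly_act \<rho> p f"
proof -
  define q where "q = (SOME q. q \<in> cl p)"
  have "p \<in> cl p"
    using assms rel.a_rcos_self by (simp add: residue_class_def)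
  then have "q \<in> cl p" unfolding q_def by (rule someI)
  then obtain h where "h \<in> relation_ideal P" "q = h + p"
    by (auto simp: residue_class_def a_r_coset_def')
  then show ?thesis
    using relation_ideal_acts_trivially[OF _ assms(2)]
    by (simp add: act_def poly_act_add flip: q_def)
qed

lemma act_closed: "\<lbrakk>a \<in> carrier \<H>; f \<in> U\<rbrakk> \<Longrightarrow> act a f \<in> U"
  by (auto simp: quotient_ops(1) act_cl poly_act_closed)

lemma act_add: "\<lbrakk>a \<in> carrier \<H>; b \<in> carrier \<H>; f \<in> U\<rbrakk> \<Longrightarrow> act (a \<oplus>\<^bsub>\<H>\<^esub> b) f = act a f + act b f"
  by (auto simp: quotient_ops(1) act_cl poly_act_add)

lemma act_mult: "\<lbrakk>a \<in> carrier \<H>; b \<in> carrier \<H>; f \<in> U\<rbrakk> \<Longrightarrow> act (a \<otimes>\<^bsub>\<H>\<^esub> b) f = act a (act b f)"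
  by (auto simp: quotient_ops(1) act_cl poly_act_closed poly_act_mult[OF linear])

lemma act_minus: "\<lbrakk>a \<in> carrier \<H>; f \<in> U\<rbrakk> \<Longrightarrow> act (\<ominus>\<^bsub>\<H>\<^esub> a) f = - act a f"
  by (auto simp: quotient_ops(1) act_cl cl_minus poly_act_uminus)

lemma act_scalar: "f \<in> U \<Longrightarrow> act (c \<odot>\<^bsub>\<H>\<^esub> \<one>\<^bsub>\<H>\<^esub>) f = c \<bullet>\<^sub>C f"
  by (simp add: cl_scalar act_cl)

lemma act_one: "f \<in> U \<Longrightarrow> act \<one>\<^bsub>\<H>\<^esub> f = f"
  by (simp add: quotient_ops(3) act_cl)

lemma act_symb: "\<lbrakk>x \<in> fst P; f \<in> U\<rbrakk> \<Longrightarrow> act (cl (symb x)) f = \<rho> x f"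
  by (simp add: act_cl)

lemma linear_op_act: "linear_op (act a)"
  unfolding act_def by (rule linear_op_poly_act[OF linear])

end

section \<open>Modules induced from a character\<close>

definition additive_group :: "('b \<Rightarrow> complex) monoid"
  where "additive_group = \<lparr>carrier = UNIV, monoid.mult = (+), one = 0\<rparr>"

lemma comm_group_additive_group: "comm_group additive_group"
  by (rule comm_groupI) (auto simp: additive_group_def algebra_simps intro: exI[of _ "- _"])

text \<open>
  In the tensor product of \<open>H\<close> with the one-dimensional module of a character of \<open>A\<close> one has
  \<open>r \<otimes> z = r (z 1) \<otimes> 1\<close>, because \<open>A\<close> contains the scalars. So every element is of the form \<open>r \<otimes> 1\<close>; this
  element is called \<open>cyc r\<close> below, and \<open>cyc\<close> is a surjective homomorphism from \<open>H\<close> to the induced module.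
\<close>

locale character_induction =
  fixes H :: "(complex, 'r) module" and A :: "'r set" and \<theta> :: "'r \<Rightarrow> complex"
  assumes ring: "ring H" and A_subset: "A \<subseteq> carrier H"
    and scalars: "\<And>c. c \<odot>\<^bsub>H\<^esub> \<one>\<^bsub>H\<^esub> \<in> A"
    and char: "algebra_character H A \<theta>"
begin

abbreviation "N \<equiv> character_module \<theta>"
abbreviation "M \<equiv> tensor_module H A N"
abbreviation "G \<equiv> tensor_group H N"
abbreviation "K \<equiv> tensor_kernel H A N"
abbreviation "coset \<equiv> r_coset G K"

text \<open>
  Left multiplication before passing to the quotient by the relators.
\<close>

definition L :: "'r \<Rightarrow> ('r \<times> complex \<Rightarrow>\<^sub>0 int) \<Rightarrow> 'r \<times> complex \<Rightarrow>\<^sub>0 int"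
  where "L r = frag_extend (\<lambda>(s, x). frag_of (r \<otimes>\<^bsub>H\<^esub> s, x))"

definition cyc :: "'r \<Rightarrow> ('r \<times> complex \<Rightarrow>\<^sub>0 int) set"
  where "cyc r = pure_tensor H A N r 1"

sublocale ring H by (rule ring)

lemma N_ops: "x \<oplus>\<^bsub>N\<^esub> y = x + y" "a \<odot>\<^bsub>N\<^esub> x = \<theta> a * x"
  by (simp_all add: character_module_def)

lemma carrier_G: "p \<in> carrier G \<longleftrightarrow> Poly_Mapping.keys p \<subseteq> carrier H \<times> UNIV"
  by (simp add: tensor_group_def character_module_def)

lemma G_ops [simp]: "p \<otimes>\<^bsub>G\<^esub> q = p + q" "\<one>\<^bsub>G\<^esub> = 0"
  by (simp_all add: tensor_group_def)

sublocale G: comm_group G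
  by (simp add: tensor_group_def abelian_free_Abelian_group)

lemma inv_G [simp]: "p \<in> carrier G \<Longrightarrow> inv\<^bsub>G\<^esub> p = - p"
  by (simp add: tensor_group_def)

lemma frag_of_G [simp]: "frag_of (r, z) \<in> carrier G \<longleftrightarrow> r \<in> carrier H"
  by (simp add: carrier_G)

lemma diff_G: "\<lbrakk>p \<in> carrier G; q \<in> carrier G\<rbrakk> \<Longrightarrow> p - q \<in> carrier G"
  using G.m_closed[of p "inv\<^bsub>G\<^esub> q"] G.inv_closed[of q] by simp

lemma add_G: "\<lbrakk>p \<in> carrier G; q \<in> carrier G\<rbrakk> \<Longrightarrow> p + q \<in> carrier G"
  using G.m_closed[of p q] by simp

lemma relators_subset: "tensor_relators H A N \<subseteq> carrier G"
  using A_subset by (auto simp: tensor_relators_def intro!: diff_G)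

lemma subgroup_K: "subgroup K G"
  unfolding tensor_kernel_def by (rule G.generate_is_subgroup[OF relators_subset])

lemma relators_K: "tensor_relators H A N \<subseteq> K"
  by (auto simp: tensor_kernel_def intro: generate.incl)

sublocale K: normal K G
  by (rule G.subgroup_imp_normal[OF subgroup_K])

sublocale Q: comm_group "G Mod K"
  by (rule G.abelian_FactGroup[OF subgroup_K])

lemma coset_add: "\<lbrakk>p \<in> carrier G; q \<in> carrier G\<rbrakk> \<Longrightarrow> coset p \<otimes>\<^bsub>G Mod K\<^esub> coset q = coset (p + q)"
  by (simp add: FactGroup_def K.rcos_sum)

lemma coset_eqI:
  assumes "p \<in> carrier G" "q \<in> carrier G" "p - q \<in> K"
  shows "coset p = coset q"
proof -
  have "p \<in> coset q"
    using assms(3) by (auto simp: r_coset_def intro!: bexI[of _ "p - q"])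
  then show ?thesis
    using G.repr_independence[OF _ assms(2) subgroup_K] by simp
qed

lemma M_quotient:
  "carrier M = carrier (G Mod K)" "add M = monoid.mult (G Mod K)" "\<zero>\<^bsub>M\<^esub> = \<one>\<^bsub>G Mod K\<^esub>"
  by (simp_all add: tensor_module_def Let_def)

lemma M_ops:
  "carrier M = coset ` carrier G" "r \<odot>\<^bsub>M\<^esub> Y = (\<Union>p \<in> Y. coset (L r p))"
  by (auto simp: tensor_module_def Let_def FactGroup_def RCOSETS_def L_def)

lemma abelian_group_M: "abelian_group M"
proof (rule abelian_groupI)
  fix x assume x: "x \<in> carrier M"
  then show "\<exists>y\<in>carrier M. y \<oplus>\<^bsub>M\<^esub> x = \<zero>\<^bsub>M\<^esub>"
    unfolding M_quotient using Q.l_inv Q.inv_closed by blast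
qed (unfold M_quotient, (rule Q.m_closed Q.one_closed Q.m_assoc Q.m_comm Q.l_one; assumption)+)

sublocale M: abelian_group M by (rule abelian_group_M)

lemma L_G: "\<lbrakk>r \<in> carrier H; p \<in> carrier G\<rbrakk> \<Longrightarrow> L r p \<in> carrier G"
  unfolding carrier_G L_def
  by (rule order_trans[OF keys_frag_extend]) (auto simp: keys_frag_of)

lemma L_relators:
  assumes r: "r \<in> carrier H" and p: "p \<in> tensor_relators H A N"
  shows "L r p \<in> tensor_relators H A N"
proof -
  have simps: "L r (p - q) = L r p - L r q" "L r (frag_of (s, z)) = frag_of (r \<otimes>\<^bsub>H\<^esub> s, z)" for p q s z
    by (simp_all add: L_def frag_extend_diff)
  from p show ?thesis
    unfolding tensor_relators_def
  proof (elim UnE, goal_cases)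
    case 1
    then obtain s t x where "p = frag_of (s \<oplus>\<^bsub>H\<^esub> t, x) - frag_of (s, x) - frag_of (t, x)"
      "s \<in> carrier H" "t \<in> carrier H" "x \<in> carrier N" by blast
    then show ?case
      using r by (intro UnI1 CollectI exI[of _ "r \<otimes>\<^bsub>H\<^esub> s"] exI[of _ "r \<otimes>\<^bsub>H\<^esub> t"] exI[of _ x])
        (simp add: simps r_distr)
  next
    case 2
    then obtain s x y where "p = frag_of (s, x \<oplus>\<^bsub>N\<^esub> y) - frag_of (s, x) - frag_of (s, y)"
      "s \<in> carrier H" "x \<in> carrier N" "y \<in> carrier N" by blast
    then show ?case
      using r by (intro UnI1 UnI2 CollectI exI[of _ "r \<otimes>\<^bsub>H\<^esub> s"] exI[of _ x] exI[of _ y])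
        (simp add: simps)
  next
    case 3
    then obtain s a x where "p = frag_of (s \<otimes>\<^bsub>H\<^esub> a, x) - frag_of (s, a \<odot>\<^bsub>N\<^esub> x)"
      "s \<in> carrier H" "a \<in> A" "x \<in> carrier N" by blast
    then show ?case
      using r subsetD[OF A_subset]
      by (intro UnI2 CollectI exI[of _ "r \<otimes>\<^bsub>H\<^esub> s"] exI[of _ a] exI[of _ x]) (simp add: simps m_assoc)
  qed
qed

text \<open>
  Left multiplication takes relators to relators, hence preserves the subgroup that they generate; this
  makes the action on cosets well defined.
\<close>

lemma L_K:
  assumes "r \<in> carrier H" "p \<in> K"
  shows "L r p \<in> K"
  using assms(2) unfolding tensor_kernel_def
proof (induction rule: generate.induct)
  case (inv h)
  then have "h \<in> carrier G" using relators_subset by auto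
  moreover have "L r (- h) = inv\<^bsub>G\<^esub> (L r h)"
    using L_G[OF assms(1)] \<open>h \<in> carrier G\<close> by (simp add: L_def frag_extend_minus)
  ultimately show ?case
    using generate.inv[OF L_relators[OF assms(1) inv]] by simp
next
  case (eng h1 h2)
  then show ?case
    using generate.eng[OF eng.IH] by (simp add: L_def frag_extend_add)
next
  case one
  have "L r \<one>\<^bsub>G\<^esub> = \<one>\<^bsub>G\<^esub>" by (simp add: L_def)
  then show ?case by (simp only: generate.one)
qed (rule generate.incl[OF L_relators[OF assms(1)]])

lemma smult_coset:
  assumes r: "r \<in> carrier H" and p: "p \<in> carrier G"
  shows "r \<odot>\<^bsub>M\<^esub> coset p = coset (L r p)"
proof -
  have "coset (L r q) = coset (L r p)" if "q \<in> coset p" for q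
  proof -
    from that obtain k where k: "k \<in> K" "q = k + p" by (auto simp: r_coset_def)
    then have "k \<in> carrier G" using K.subset by auto
    then have "q \<in> carrier G" using k p by (simp add: add_G)
    moreover have "L r q - L r p \<in> K"
      using L_K[OF r k(1)] by (simp only: k(2) L_def frag_extend_add add_diff_cancel_right')
    ultimately show ?thesis
      by (intro coset_eqI L_G r p)
  qed
  moreover have "p \<in> coset p" using G.rcos_self[OF p subgroup_K] .
  ultimately show ?thesis unfolding M_ops(2) by blast
qed

lemma cyc_coset: "cyc r = coset (frag_of (r, 1))"
  by (simp add: cyc_def pure_tensor_def)

lemma cyc_closed [simp]: "r \<in> carrier H \<Longrightarrow> cyc r \<in> carrier M"
  by (auto simp: cyc_coset M_ops(1))

lemma cyc_add: 
  assumes "r \<in> carrier H" "s \<in> carrier H"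
  shows "cyc (r \<oplus>\<^bsub>H\<^esub> s) = cyc r \<oplus>\<^bsub>M\<^esub> cyc s"
proof -
  have "frag_of (r \<oplus>\<^bsub>H\<^esub> s, 1) - frag_of (r, 1) - frag_of (s, 1) \<in> K"
    by (intro subsetD[OF relators_K]) (use assms in \<open>auto simp: tensor_relators_def character_module_def\<close>)
  then have "coset (frag_of (r \<oplus>\<^bsub>H\<^esub> s, 1)) = coset (frag_of (r, 1) + frag_of (s, 1))"
    using assms by (intro coset_eqI add_G) (simp_all add: diff_diff_eq)
  then show ?thesis
    using assms by (simp add: cyc_coset M_quotient(2) coset_add del: mult_FactGroup)
qed

lemma smult_cyc:
  assumes "r \<in> carrier H" "s \<in> carrier H"
  shows "r \<odot>\<^bsub>M\<^esub> cyc s = cyc (r \<otimes>\<^bsub>H\<^esub> s)"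
  using assms by (simp add: cyc_coset smult_coset) (simp add: L_def)

lemma coset_frag_of:
  assumes "r \<in> carrier H" "a \<in> A"
  shows "coset (frag_of (r \<otimes>\<^bsub>H\<^esub> a, z)) = coset (frag_of (r, \<theta> a * z))"
proof (rule coset_eqI)
  show "frag_of (r \<otimes>\<^bsub>H\<^esub> a, z) - frag_of (r, \<theta> a * z) \<in> K"
  proof (rule subsetD[OF relators_K])
    have "\<theta> a * z = a \<odot>\<^bsub>N\<^esub> z" by (simp add: character_module_def)
    then show "frag_of (r \<otimes>\<^bsub>H\<^esub> a, z) - frag_of (r, \<theta> a * z) \<in> tensor_relators H A N"
      using assms by (auto simp: tensor_relators_def character_module_def)
  qed
qed (use assms A_subset in auto)

lemma theta_scalar: "\<theta> (c \<odot>\<^bsub>H\<^esub> \<one>\<^bsub>H\<^esub>) = c"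
  using char by (simp add: algebra_character_def)

lemma cyc_character:
  assumes "r \<in> carrier H" "a \<in> A"
  shows "cyc (r \<otimes>\<^bsub>H\<^esub> a) = cyc (r \<otimes>\<^bsub>H\<^esub> (\<theta> a \<odot>\<^bsub>H\<^esub> \<one>\<^bsub>H\<^esub>))"
  using assms by (simp add: cyc_coset coset_frag_of scalars theta_scalar)

lemma carrier_M: "carrier M = cyc ` carrier H"
proof
  have sc: "coset (frag_of (r, z)) = cyc (r \<otimes>\<^bsub>H\<^esub> (z \<odot>\<^bsub>H\<^esub> \<one>\<^bsub>H\<^esub>))" if "r \<in> carrier H" for r z
    using that by (simp add: cyc_coset coset_frag_of scalars theta_scalar)
  have zero: "cyc \<zero>\<^bsub>H\<^esub> = \<zero>\<^bsub>M\<^esub>"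
    using cyc_add[of "\<zero>\<^bsub>H\<^esub>" "\<zero>\<^bsub>H\<^esub>"] M.add.r_cancel_one'[of "cyc \<zero>\<^bsub>H\<^esub>" "cyc \<zero>\<^bsub>H\<^esub>"] by simp
  have "coset p \<in> cyc ` carrier H" if "Poly_Mapping.keys p \<subseteq> carrier H \<times> UNIV" for p
    using that
  proof (induction p rule: free_Abelian_group_induct[consumes 1, case_names zero diff one])
    case zero
    have "coset 0 = \<zero>\<^bsub>M\<^esub>"
      using G.coset_mult_one[OF K.subset] by (simp add: M_quotient(3) FactGroup_def)
    then show ?case using \<open>cyc \<zero>\<^bsub>H\<^esub> = \<zero>\<^bsub>M\<^esub>\<close> by (metis image_eqI zero_closed)
  next
    case (one x)
    then show ?case
      using sc[of "fst x" "snd x"] subsetD[OF A_subset scalars] by (cases x) auto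
  next
    case (diff a b)
    then have ab: "a \<in> carrier G" "b \<in> carrier G" by (auto simp: carrier_G)
    from diff obtain r s where rs: "r \<in> carrier H" "s \<in> carrier H" "coset a = cyc r" "coset b = cyc s"
      by auto
    have "coset (a - b) \<oplus>\<^bsub>M\<^esub> coset b = coset a"
      using coset_add[OF diff_G[OF ab] ab(2)] by (simp add: M_quotient(2) del: mult_FactGroup)
    also have "\<dots> = cyc (r \<ominus>\<^bsub>H\<^esub> s) \<oplus>\<^bsub>M\<^esub> coset b"
      using rs cyc_add[of "r \<ominus>\<^bsub>H\<^esub> s" s] by (simp add: minus_eq a_assoc l_neg)
    finally have "coset (a - b) \<oplus>\<^bsub>M\<^esub> coset b = cyc (r \<ominus>\<^bsub>H\<^esub> s) \<oplus>\<^bsub>M\<^esub> coset b" .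
    moreover have "coset (a - b) \<in> carrier M" "coset b \<in> carrier M"
      using diff_G[OF ab] ab by (auto simp only: M_ops(1))
    moreover have "cyc (r \<ominus>\<^bsub>H\<^esub> s) \<in> carrier M" using rs by simp
    ultimately have "coset (a - b) = cyc (r \<ominus>\<^bsub>H\<^esub> s)"
      by (metis M.add.r_cancel)
    then show ?case using rs by auto
  qed
  then show "carrier M \<subseteq> cyc ` carrier H" by (auto simp: M_ops(1) carrier_G)
qed auto

text \<open>
  A linear map out of the induced module amounts to an additive map on \<open>H\<close> on which \<open>A\<close> acts from the
  right through the character.
\<close>

lemma universal:
  fixes \<Phi> :: "'r \<Rightarrow> 'b \<Rightarrow> complex"
  assumes add: "\<And>r s. \<lbrakk>r \<in> carrier H; s \<in> carrier H\<rbrakk> \<Longrightarrow> \<Phi> (r \<oplus>\<^bsub>H\<^esub> s) = \<Phi> r + \<Phi> s"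
    and char: "\<And>r a. \<lbrakk>r \<in> carrier H; a \<in> A\<rbrakk> \<Longrightarrow> \<Phi> (r \<otimes>\<^bsub>H\<^esub> a) = \<theta> a \<bullet>\<^sub>C \<Phi> r"
  obtains \<psi> where "\<And>r. r \<in> carrier H \<Longrightarrow> \<psi> (cyc r) = \<Phi> r"
proof -
  interpret vecgrp: comm_group "additive_group :: ('b \<Rightarrow> complex) monoid"
    by (rule comm_group_additive_group)
  \<comment> \<open>The value on a pair is forced by \<open>r \<otimes> z = z (r \<otimes> 1)\<close>.\<close>
  obtain h where h: "h \<in> hom (free_Abelian_group (carrier H \<times> (UNIV :: complex set))) additive_group"
    and h_of: "\<And>x. x \<in> carrier H \<times> UNIV \<Longrightarrow> h (frag_of x) = snd x \<bullet>\<^sub>C \<Phi> (fst x)"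
    by (rule vecgrp.free_Abelian_group_universal[of "\<lambda>x. snd x \<bullet>\<^sub>C \<Phi> (fst x)" "carrier H \<times> UNIV"])
      (auto simp: additive_group_def)
  have GF: "G = free_Abelian_group (carrier H \<times> UNIV)"
    by (simp add: tensor_group_def character_module_def)
  have h_add: "h (p + q) = h p + h q" if "p \<in> carrier G" "q \<in> carrier G" for p q
    using hom_mult[OF h, of p q] that by (simp add: GF additive_group_def)
  have h_diff: "h (p - q) = h p - h q" if "p \<in> carrier G" "q \<in> carrier G" for p q
    using h_add[OF diff_G[OF that] that(2)] by (simp add: algebra_simps)
  have h_zero: "h 0 = 0" using h_diff[of 0 0] by (simp add: carrier_G)
  have of: "h (frag_of (r, z)) = z \<bullet>\<^sub>C \<Phi> r" if "r \<in> carrier H" for r z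
    using h_of[of "(r, z)"] that by simp
  have rel: "h p = 0" if "p \<in> tensor_relators H A N" for p
  proof -
    have aH: "\<And>a. a \<in> A \<Longrightarrow> a \<in> carrier H" using A_subset by auto
    show ?thesis
      using that unfolding tensor_relators_def
      by (auto simp: h_diff of diff_G add char aH fscale_add N_ops mult.commute)
  qed
  have K0: "h k = 0" if "k \<in> K" for k
    using that unfolding tensor_kernel_def
  proof (induction rule: generate.induct)
    case (inv p)
    then have "p \<in> carrier G" using relators_subset by auto
    then show ?case using h_diff[of 0 p] rel[OF inv] h_zero by (simp add: carrier_G)
  next
    case (eng p q)
    then show ?case using h_add[of p q] K.subset by (auto simp: tensor_kernel_def)
  qed (auto simp: h_zero rel)
  have "h (SOME p. p \<in> cyc r) = \<Phi> r" if r: "r \<in> carrier H" for r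
  proof -
    have "frag_of (r, 1) \<in> cyc r"
      using G.rcos_self[OF _ subgroup_K] r by (simp add: cyc_coset)
    then have "(SOME p. p \<in> cyc r) \<in> cyc r" by (rule someI)
    then obtain k where k: "k \<in> K" "(SOME p. p \<in> cyc r) = k + frag_of (r, 1)"
      by (auto simp: cyc_coset r_coset_def)
    then show ?thesis
      using h_add[of k "frag_of (r, 1)"] K.subset K0[OF k(1)] of[OF r, of 1] r by auto
  qed
  then show thesis by (rule that[of "\<lambda>Y. h (SOME p. p \<in> Y)"])
qed

end

section \<open>Realizing an induced module on functions\<close>

definition delta :: "'b \<Rightarrow> 'b \<Rightarrow> complex"
  where "delta w = (\<lambda>u. if u = w then 1 else 0)"

definition supported :: "'b set \<Rightarrow> ('b \<Rightarrow> complex) set"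
  where "supported W = {f. \<forall>w. w \<notin> W \<longrightarrow> f w = 0}"

lemma csubspace_supported: "csubspace (supported W)"
  by (auto simp: csubspace_def supported_def fscale_apply)

lemma delta_supported: "w \<in> W \<Longrightarrow> delta w \<in> supported W"
  by (auto simp: supported_def delta_def)

lemma supported_expansion:
  assumes "finite W" "f \<in> supported W"
  shows "f = (\<Sum>w\<in>W. f w \<bullet>\<^sub>C delta w)"
  using assms by (auto simp: fun_eq_iff fscale_apply supported_def delta_def if_distrib[of "\<lambda>x. _ * x"] sum.delta cong: if_cong)

lemma supported_subset_csubspace:
  assumes "finite W" "csubspace S" "\<And>w. w \<in> W \<Longrightarrow> delta w \<in> S"
  shows "supported W \<subseteq> S"
proof
  fix f assume "f \<in> supported W"
  then have "f = (\<Sum>w\<in>W. f w \<bullet>\<^sub>C delta w)" by (rule supported_expansion[OF assms(1)])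
  also have "\<dots> \<in> S" by (intro csubspace_sum csubspaceD(3) assms)
  finally show "f \<in> S" .
qed

lemma const_mult: "const (c * d) = const c * const d"
  by (simp add: const_def mult_single)

text \<open>
  The situation in which a one-dimensional module of the subalgebra generated by \<open>E\<close> is visible inside a
  function space.
\<close>

locale eigenvector = representation P \<rho> U
  for P :: "'x presentation" and \<rho> :: "'x \<Rightarrow> ('b \<Rightarrow> complex) \<Rightarrow> 'b \<Rightarrow> complex" and U +
  fixes E :: "'x set" and \<omega> :: "'x \<Rightarrow> complex" and b0 :: 'b
  assumes E_subset: "E \<subseteq> fst P" and origin: "delta b0 \<in> U"
    and eigen: "x \<in> E \<Longrightarrow> \<rho> x (delta b0) = \<omega> x \<bullet>\<^sub>C delta b0"
begin

abbreviation "A \<equiv> generated_subalgebra \<H> (cl ` symb ` E)"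

lemma A_subset: "A \<subseteq> carrier \<H>"
proof -
  have "{c \<odot>\<^bsub>\<H>\<^esub> \<one>\<^bsub>\<H>\<^esub> |c. True} \<union> cl ` symb ` E \<subseteq> carrier \<H>"
    using E_subset by (auto simp: cl_scalar)
  from alg.generate_ring_in_carrier[OF this] show ?thesis
    by (auto simp: generated_subalgebra_def)
qed

text \<open>
  This holds for every character with the prescribed values on the generators. It therefore applies to a
  character that is only known through a choice operator.
\<close>

lemma character_eigen:
  assumes "algebra_character \<H> A \<theta>" "\<And>x. x \<in> E \<Longrightarrow> \<theta> (cl (symb x)) = \<omega> x" "a \<in> A"
  shows "act a (delta b0) = \<theta> a \<bullet>\<^sub>C delta b0"
proof -
  let ?S = "{c \<odot>\<^bsub>\<H>\<^esub> \<one>\<^bsub>\<H>\<^esub> |c. True} \<union> cl ` symb ` E"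
  have A: "A = generate_ring \<H> ?S" by (simp add: generated_subalgebra_def)
  have th: "\<theta> (a \<oplus>\<^bsub>\<H>\<^esub> b) = \<theta> a + \<theta> b" "\<theta> (a \<otimes>\<^bsub>\<H>\<^esub> b) = \<theta> a * \<theta> b" if "a \<in> A" "b \<in> A" for a b
    using assms(1) that by (auto simp: algebra_character_def)
  have sc: "\<theta> (c \<odot>\<^bsub>\<H>\<^esub> \<one>\<^bsub>\<H>\<^esub>) = c" for c
    using assms(1) by (auto simp: algebra_character_def)
  from assms(3)[unfolded A] show ?thesis
  proof (induction rule: generate_ring.induct)
    case one
    have "\<one>\<^bsub>\<H>\<^esub> = 1 \<odot>\<^bsub>\<H>\<^esub> \<one>\<^bsub>\<H>\<^esub>"
      by (simp add: cl_scalar) (simp add: quotient_ops const_def)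
    then show ?case using sc[of 1] act_one[OF origin] by simp
  next
    case (incl h)
    then show ?case
      using E_subset by (auto simp: act_scalar origin sc act_symb eigen assms(2))
  next
    case (a_inv h)
    then have h: "h \<in> A" "h \<in> carrier \<H>" using A A_subset by auto
    have "\<ominus>\<^bsub>\<H>\<^esub> h \<in> A" unfolding A by (rule generate_ring.a_inv[OF a_inv.hyps])
    then have "\<theta> (h \<oplus>\<^bsub>\<H>\<^esub> (\<ominus>\<^bsub>\<H>\<^esub> h)) = \<theta> h + \<theta> (\<ominus>\<^bsub>\<H>\<^esub> h)"
      by (rule th(1)[OF h(1)])
    moreover have "\<theta> (h \<oplus>\<^bsub>\<H>\<^esub> (\<ominus>\<^bsub>\<H>\<^esub> h)) = 0"
      using sc[of 0] h by (simp add: alg.r_neg cl_scalar) (simp add: cl_zero const_def)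
    ultimately have "\<theta> (\<ominus>\<^bsub>\<H>\<^esub> h) = - \<theta> h" by (simp add: add_eq_0_iff)
    then show ?case
      using a_inv.IH h by (simp add: act_minus origin fun_eq_iff fscale_apply)
  next
    case (eng_add h1 h2)
    then have "h1 \<in> A" "h2 \<in> A" using A by auto
    then show ?case
      using eng_add.IH A_subset by (simp add: th act_add origin subset_iff fscale_add)
  next
    case (eng_mult h1 h2)
    then have "h1 \<in> A" "h2 \<in> A" using A by auto
    then show ?case
      using eng_mult.IH A_subset
      by (simp add: th act_mult origin subset_iff linear_opD[OF linear_op_act] mult.commute)
  qed
qed

text \<open>
  The eigenvalue of an element of \<open>A\<close> on the point mass at \<open>b0\<close> is the value of the image at \<open>b0\<close>.
\<close>

lemma character_exists:
  "\<exists>\<theta>. algebra_character \<H> A \<theta> \<and> (\<forall>x \<in> E. \<theta> (cl (symb x)) = \<omega> x)"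
proof -
  define \<theta> where "\<theta> a = act a (delta b0) b0" for a
  let ?S = "{c \<odot>\<^bsub>\<H>\<^esub> \<one>\<^bsub>\<H>\<^esub> |c. True} \<union> cl ` symb ` E"
  have A: "A = generate_ring \<H> ?S" by (simp add: generated_subalgebra_def)
  have "\<exists>c. act a (delta b0) = c \<bullet>\<^sub>C delta b0" if "a \<in> A" for a
    using that unfolding A
  proof (induction rule: generate_ring.induct)
    case one
    then show ?case using act_one[OF origin] by (intro exI[of _ 1]) simp
  next
    case (incl h)
    then show ?case
      using subsetD[OF E_subset] by (auto simp: act_scalar origin act_symb eigen)
  next
    case (a_inv h)
    then obtain c where "act h (delta b0) = c \<bullet>\<^sub>C delta b0" "h \<in> carrier \<H>" using A A_subset by auto
    then show ?case by (intro exI[of _ "- c"]) (simp add: act_minus origin fun_eq_iff fscale_apply)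
  next
    case (eng_add h1 h2)
    then have "h1 \<in> A" "h2 \<in> A" using A by auto
    then have "act (h1 \<oplus>\<^bsub>\<H>\<^esub> h2) (delta b0) = act h1 (delta b0) + act h2 (delta b0)"
      using A_subset by (intro act_add) (auto simp: origin)
    then show ?case using eng_add.IH by (metis fscale_add(2))
  next
    case (eng_mult h1 h2)
    then have "h1 \<in> A" "h2 \<in> A" using A by auto
    then show ?case using eng_mult.IH A_subset
      by (auto simp: act_mult origin subset_iff linear_opD[OF linear_op_act])
  qed
  then have e: "act a (delta b0) = \<theta> a \<bullet>\<^sub>C delta b0" if "a \<in> A" for a
    using that unfolding \<theta>_def by (metis (no_types) delta_def fscale_apply mult.right_neutral)
  have "\<theta> (a \<oplus>\<^bsub>\<H>\<^esub> b) = \<theta> a + \<theta> b" "\<theta> (a \<otimes>\<^bsub>\<H>\<^esub> b) = \<theta> a * \<theta> b" if "a \<in> A" "b \<in> A" for a b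
  proof -
    have ab: "a \<in> carrier \<H>" "b \<in> carrier \<H>" using that A_subset by auto
    show "\<theta> (a \<oplus>\<^bsub>\<H>\<^esub> b) = \<theta> a + \<theta> b" using ab by (simp add: \<theta>_def act_add origin)
    have "\<theta> (a \<otimes>\<^bsub>\<H>\<^esub> b) = act a (\<theta> b \<bullet>\<^sub>C delta b0) b0"
      using ab e[OF that(2)] by (simp add: act_mult origin \<theta>_def)
    then show "\<theta> (a \<otimes>\<^bsub>\<H>\<^esub> b) = \<theta> a * \<theta> b"
      by (simp add: linear_opD[OF linear_op_act] \<theta>_def fscale_apply)
  qed
  moreover have "\<theta> (c \<odot>\<^bsub>\<H>\<^esub> \<one>\<^bsub>\<H>\<^esub>) = c" for c
    by (simp add: \<theta>_def act_scalar origin fscale_apply) (simp add: delta_def)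
  moreover have "\<theta> (cl (symb x)) = \<omega> x" if "x \<in> E" for x
    using that E_subset by (simp add: \<theta>_def act_symb origin subset_iff eigen) (simp add: delta_def fscale_apply)
  ultimately show ?thesis
    unfolding algebra_character_def by (intro exI[of _ \<theta>]) blast
qed

end

text \<open>
  The generator \<open>s w\<close> sends the eigenvector, the point mass at \<open>b0\<close>, to the point mass at \<open>w\<close>; in the
  applications \<open>s w\<close> is the symbol of the group element \<open>w\<close>, and \<open>b0\<close> is the identity.
\<close>

locale induced_realization = eigenvector P \<rho> "supported W" E \<omega> b0
  for P :: "'x presentation" and \<rho> :: "'x \<Rightarrow> ('b \<Rightarrow> complex) \<Rightarrow> 'b \<Rightarrow> complex" and W E \<omega> b0 +
  fixes s :: "'b \<Rightarrow> 'x" and \<theta> :: "'x ncpoly set \<Rightarrow> complex"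
  assumes finite_W: "finite W" and o_W: "b0 \<in> W"
    and s_W: "w \<in> W \<Longrightarrow> s w \<in> fst P"
    and s_delta: "w \<in> W \<Longrightarrow> \<rho> (s w) (delta b0) = delta w"
    and s_one: "cl (symb (s b0)) = cl 1"
    and character: "algebra_character \<H> A \<theta>" "x \<in> E \<Longrightarrow> \<theta> (cl (symb x)) = \<omega> x"
begin

sublocale induction: character_induction \<H> A \<theta>
  by unfold_locales
    (use A_subset character in \<open>auto simp: generated_subalgebra_def intro!: generate_ring.incl\<close>)

abbreviation "M \<equiv> tensor_module \<H> A (character_module \<theta>)"
abbreviation "cyc \<equiv> induction.cyc"

text \<open>
  The homomorphism from the induced module that sends \<open>r \<otimes> 1\<close> to the image of the eigenvector under \<open>r\<close>.
\<close>

definition \<psi> :: "('x ncpoly set \<times> complex \<Rightarrow>\<^sub>0 int) set \<Rightarrow> 'b \<Rightarrow> complex"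
  where "\<psi> = (SOME \<psi>. \<forall>r \<in> carrier \<H>. \<psi> (cyc r) = act r (delta b0))"

lemma psi_cyc: "r \<in> carrier \<H> \<Longrightarrow> \<psi> (cyc r) = act r (delta b0)"
proof -
  have "\<exists>\<psi>. \<forall>r \<in> carrier \<H>. \<psi> (cyc r) = act r (delta b0)"
  proof (rule induction.universal[of "\<lambda>r. act r (delta b0)"])
    fix r a assume "r \<in> carrier \<H>" "a \<in> A"
    then show "act (r \<otimes>\<^bsub>\<H>\<^esub> a) (delta b0) = \<theta> a \<bullet>\<^sub>C act r (delta b0)"
      using A_subset character_eigen[OF character, of a]
      by (simp add: act_mult origin subset_iff linear_opD[OF linear_op_act])
  qed (auto simp: act_add origin)
  then have "\<forall>r \<in> carrier \<H>. \<psi> (cyc r) = act r (delta b0)"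
    unfolding \<psi>_def by (rule someI_ex)
  then show "r \<in> carrier \<H> \<Longrightarrow> \<psi> (cyc r) = act r (delta b0)" by simp
qed

lemma psi_add: "\<lbrakk>x \<in> carrier M; y \<in> carrier M\<rbrakk> \<Longrightarrow> \<psi> (x \<oplus>\<^bsub>M\<^esub> y) = \<psi> x + \<psi> y"
  by (auto simp: induction.carrier_M psi_cyc act_add origin simp flip: induction.cyc_add)

lemma psi_smult: "\<lbrakk>r \<in> carrier \<H>; x \<in> carrier M\<rbrakk> \<Longrightarrow> \<psi> (r \<odot>\<^bsub>M\<^esub> x) = act r (\<psi> x)"
  by (auto simp: induction.carrier_M psi_cyc act_mult origin induction.smult_cyc)

lemma psi_closed: "x \<in> carrier M \<Longrightarrow> \<psi> x \<in> supported W"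
  by (auto simp: induction.carrier_M psi_cyc act_closed origin)

lemma psi_zero: "\<psi> \<zero>\<^bsub>M\<^esub> = 0"
  using psi_add[of "\<zero>\<^bsub>M\<^esub>" "\<zero>\<^bsub>M\<^esub>"] by simp

lemma smult_closed: "\<lbrakk>r \<in> carrier \<H>; x \<in> carrier M\<rbrakk> \<Longrightarrow> r \<odot>\<^bsub>M\<^esub> x \<in> carrier M"
  by (auto simp: induction.carrier_M induction.smult_cyc)

text \<open>
  Together with the next definition, this gives the section \<open>f \<mapsto> \<Sum> f(w) t\<^sub>w \<otimes> 1\<close> of \<open>\<psi>\<close>.
\<close>

definition poly_of :: "('b \<Rightarrow> complex) \<Rightarrow> 'x ncpoly"
  where "poly_of f = (\<Sum>w\<in>W. const (f w) * symb (s w))"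

definition comb :: "('b \<Rightarrow> complex) \<Rightarrow> ('x ncpoly set \<times> complex \<Rightarrow>\<^sub>0 int) set"
  where "comb f = cyc (cl (poly_of f))"

lemma poly_of_closed: "poly_of f \<in> carrier \<F>"
proof -
  have "(\<Sum>w\<in>W'. const (f w) * symb (s w)) \<in> carrier \<F>" if "W' \<subseteq> W" for W'
    using that s_W by (induction W' rule: infinite_finite_induct) auto
  then show ?thesis by (simp add: poly_of_def)
qed

lemma comb_closed: "comb f \<in> carrier M"
  using poly_of_closed by (simp add: comb_def induction.carrier_M)

lemma psi_comb:
  assumes "f \<in> supported W"
  shows "\<psi> (comb f) = f"
proof -
  have "\<psi> (comb f) = (\<Sum>w\<in>W. f w \<bullet>\<^sub>C delta w)"
    by (simp add: comb_def psi_cyc poly_of_closed act_cl origin)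
      (simp add: poly_of_def poly_act_sum poly_act_mult linear s_delta)
  then show ?thesis using supported_expansion[OF finite_W assms] by simp
qed

lemma comb_add: "comb (f + g) = comb f \<oplus>\<^bsub>M\<^esub> comb g"
proof -
  have "poly_of (f + g) = poly_of f + poly_of g"
    by (simp add: poly_of_def const_def single_add distrib_right sum.distrib)
  then show ?thesis
    using poly_of_closed by (simp add: comb_def flip: induction.cyc_add)
qed

lemma comb_scale: "comb (c \<bullet>\<^sub>C f) = (c \<odot>\<^bsub>\<H>\<^esub> \<one>\<^bsub>\<H>\<^esub>) \<odot>\<^bsub>M\<^esub> comb f"
proof -
  have "poly_of (c \<bullet>\<^sub>C f) = const c * poly_of f"
    by (simp add: poly_of_def fscale_apply const_mult sum_distrib_left mult.assoc)
  then show ?thesis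
    using poly_of_closed by (simp add: comb_def induction.smult_cyc cl_scalar)
qed

lemma comb_delta: "w \<in> W \<Longrightarrow> comb (delta w) = cyc (cl (symb (s w)))"
proof -
  assume w: "w \<in> W"
  have "poly_of (delta w) = (\<Sum>u\<in>W. if u = w then symb (s u) else 0)"
    unfolding poly_of_def by (rule sum.cong) (auto simp: delta_def const_def simp flip: zero_word_def)
  then show ?thesis using w finite_W by (simp add: comb_def)
qed

lemma const_central: "const c * p = p * const c"
proof -
  have *: "const c * Poly_Mapping.single w d = Poly_Mapping.single w d * const c" for w and d :: complex
    by (simp add: const_def mult_single mult.commute)
  show ?thesis
    by (subst (1 2) poly_decomposition[of p]) (simp only: sum_distrib_left sum_distrib_right *)
qed

text \<open>
  As scalars are central, the functions \<open>f\<close> for which the image of \<open>comb f\<close> stays in the span form a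
  subspace, so it suffices to look at the point masses.
\<close>

lemma stable_comb_image:
  assumes x: "x \<in> fst P" and "\<And>w. w \<in> W \<Longrightarrow> cl (symb x) \<odot>\<^bsub>M\<^esub> cyc (cl (symb (s w))) \<in> comb ` supported W"
    and "f \<in> supported W"
  shows "cl (symb x) \<odot>\<^bsub>M\<^esub> comb f \<in> comb ` supported W"
proof -
  let ?D = "{f \<in> supported W. cl (symb x) \<odot>\<^bsub>M\<^esub> comb f \<in> comb ` supported W}"
  have r: "cl (symb x) \<in> carrier \<H>" using x by simp
  have add: "cl (symb x) \<odot>\<^bsub>M\<^esub> comb (f + g) = (cl (symb x) \<odot>\<^bsub>M\<^esub> comb f) \<oplus>\<^bsub>M\<^esub> (cl (symb x) \<odot>\<^bsub>M\<^esub> comb g)" for f g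
    using r cl_closed[OF poly_of_closed]
    by (simp add: comb_add) (simp add: comb_def induction.smult_cyc alg.r_distr flip: induction.cyc_add)
  have scale: "cl (symb x) \<odot>\<^bsub>M\<^esub> comb (c \<bullet>\<^sub>C f) = (c \<odot>\<^bsub>\<H>\<^esub> \<one>\<^bsub>\<H>\<^esub>) \<odot>\<^bsub>M\<^esub> (cl (symb x) \<odot>\<^bsub>M\<^esub> comb f)" for c f
    using x poly_of_closed
    by (simp add: comb_scale) (simp add: comb_def induction.smult_cyc cl_scalar const_central[of c "symb x"]
        flip: mult.assoc)
  have "csubspace ?D"
    unfolding csubspace_def
  proof (intro conjI ballI allI)
    have "poly_of 0 = 0" by (simp add: poly_of_def const_def)
    then have "cl (symb x) \<odot>\<^bsub>M\<^esub> comb 0 = comb 0"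
      using x by (simp add: comb_def induction.smult_cyc)
    then show "0 \<in> ?D" using csubspaceD(1)[OF csubspace_supported] by auto
  next
    fix f g assume "f \<in> ?D" "g \<in> ?D"
    then show "f + g \<in> ?D"
      using csubspaceD(2)[OF csubspace_supported] by (auto simp: add simp flip: comb_add)
  next
    fix c f assume "f \<in> ?D"
    then show "c \<bullet>\<^sub>C f \<in> ?D"
      using csubspaceD(3)[OF csubspace_supported] by (auto simp: scale simp flip: comb_scale)
  qed
  then have "supported W \<subseteq> ?D"
    by (rule supported_subset_csubspace[OF finite_W])
      (use assms(2) in \<open>auto simp: comb_delta delta_supported\<close>)
  then show ?thesis using assms(3) by auto
qed

end

text \<open>
  That the vectors \<open>t\<^sub>w \<otimes> 1\<close> span a submodule depends on the relations of the algebra, and not only on the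
  action on functions; it enters as a hypothesis.
\<close>

locale spanned_realization = induced_realization +
  assumes spanning: "\<lbrakk>x \<in> fst P; w \<in> W\<rbrakk> \<Longrightarrow> cl (symb x) \<odot>\<^bsub>M\<^esub> cyc (cl (symb (s w))) \<in> comb ` supported W"
begin

lemma smult_assoc:
  "\<lbrakk>r \<in> carrier \<H>; t \<in> carrier \<H>; m \<in> carrier M\<rbrakk> \<Longrightarrow> (r \<otimes>\<^bsub>\<H>\<^esub> t) \<odot>\<^bsub>M\<^esub> m = r \<odot>\<^bsub>M\<^esub> (t \<odot>\<^bsub>M\<^esub> m)"
  by (auto simp: induction.carrier_M induction.smult_cyc alg.m_assoc)

lemma smult_add_left:
  "\<lbrakk>r \<in> carrier \<H>; t \<in> carrier \<H>; m \<in> carrier M\<rbrakk> \<Longrightarrow> (r \<oplus>\<^bsub>\<H>\<^esub> t) \<odot>\<^bsub>M\<^esub> m = (r \<odot>\<^bsub>M\<^esub> m) \<oplus>\<^bsub>M\<^esub> (t \<odot>\<^bsub>M\<^esub> m)"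
  by (auto simp: induction.carrier_M induction.smult_cyc alg.l_distr simp flip: induction.cyc_add)

lemma smult_one: "m \<in> carrier M \<Longrightarrow> \<one>\<^bsub>\<H>\<^esub> \<odot>\<^bsub>M\<^esub> m = m"
  by (auto simp: induction.carrier_M induction.smult_cyc)

lemma minus_scalar: "r \<in> carrier \<H> \<Longrightarrow> \<ominus>\<^bsub>\<H>\<^esub> r = ((-1) \<odot>\<^bsub>\<H>\<^esub> \<one>\<^bsub>\<H>\<^esub>) \<otimes>\<^bsub>\<H>\<^esub> r"
proof -
  assume "r \<in> carrier \<H>"
  then obtain p where p: "p \<in> carrier \<F>" "r = cl p" by (auto simp: quotient_ops(1))
  have "const (-1) = - (1 :: 'a ncpoly)"
    by (simp add: const_def single_uminus)
  then show ?thesis using p by (simp add: cl_minus cl_scalar)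
qed

lemma comb_image_stable:
  assumes "r \<in> carrier \<H>" "m \<in> comb ` supported W"
  shows "r \<odot>\<^bsub>M\<^esub> m \<in> comb ` supported W"
  using assms(1)[unfolded generators_generate generated_subalgebra_def] assms(2)
proof (induction arbitrary: m rule: generate_ring.induct)
  case one
  then show ?case using comb_closed smult_one by auto
next
  case (incl h)
  from incl.hyps consider c where "h = c \<odot>\<^bsub>\<H>\<^esub> \<one>\<^bsub>\<H>\<^esub>" | x where "x \<in> fst P" "h = cl (symb x)"
    by auto
  then show ?case
  proof cases
    case 1
    then show ?thesis
      using incl.prems csubspaceD(3)[OF csubspace_supported, of _ W c] by (auto simp flip: comb_scale)
  next
    case 2
    then show ?thesis
      using incl.prems stable_comb_image[OF _ spanning] by auto
  qed
next
  case (a_inv h)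
  have h: "h \<in> carrier \<H>"
    using a_inv.hyps by (simp only: generators_generate generated_subalgebra_def)
  obtain f where f: "f \<in> supported W" "h \<odot>\<^bsub>M\<^esub> m = comb f" using a_inv.IH[OF a_inv.prems] by auto
  have "(\<ominus>\<^bsub>\<H>\<^esub> h) \<odot>\<^bsub>M\<^esub> m = ((-1) \<odot>\<^bsub>\<H>\<^esub> \<one>\<^bsub>\<H>\<^esub>) \<odot>\<^bsub>M\<^esub> (h \<odot>\<^bsub>M\<^esub> m)"
    unfolding minus_scalar[OF h]
    by (rule smult_assoc) (use h a_inv.prems comb_closed in \<open>auto simp: cl_scalar\<close>)
  also have "\<dots> = comb ((-1) \<bullet>\<^sub>C f)" by (simp only: f(2) comb_scale)
  finally show ?case
    using csubspaceD(3)[OF csubspace_supported f(1), of "-1"] by auto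
next
  case (eng_add h1 h2)
  have h: "h1 \<in> carrier \<H>" "h2 \<in> carrier \<H>"
    using eng_add.hyps by (simp_all only: generators_generate generated_subalgebra_def)
  obtain f g where "f \<in> supported W" "h1 \<odot>\<^bsub>M\<^esub> m = comb f" "g \<in> supported W" "h2 \<odot>\<^bsub>M\<^esub> m = comb g"
    using eng_add.IH[OF eng_add.prems] by auto
  then show ?case
    using smult_add_left[OF h, of m] eng_add.prems comb_closed csubspaceD(2)[OF csubspace_supported, of f W g]
    by (auto simp flip: comb_add)
next
  case (eng_mult h1 h2)
  have h: "h1 \<in> carrier \<H>" "h2 \<in> carrier \<H>"
    using eng_mult.hyps by (simp_all only: generators_generate generated_subalgebra_def)
  have "m \<in> carrier M" using eng_mult.prems comb_closed by auto
  then show ?case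
    using smult_assoc[OF h] eng_mult.IH eng_mult.prems by auto
qed

text \<open>
  The span of the vectors \<open>t\<^sub>w \<otimes> 1\<close> is a submodule that contains the cyclic vector \<open>1 \<otimes> 1\<close>.
\<close>

lemma carrier_M_comb: "carrier M = comb ` supported W"
proof
  have "cyc \<one>\<^bsub>\<H>\<^esub> = comb (delta b0)"
    using comb_delta[OF o_W] by (simp add: s_one quotient_ops(3))
  then have *: "cyc \<one>\<^bsub>\<H>\<^esub> \<in> comb ` supported W" using delta_supported[OF o_W] by auto
  show "carrier M \<subseteq> comb ` supported W"
  proof
    fix m assume "m \<in> carrier M"
    then obtain r where r: "r \<in> carrier \<H>" "m = cyc r" by (auto simp: induction.carrier_M)
    then have "m = r \<odot>\<^bsub>M\<^esub> cyc \<one>\<^bsub>\<H>\<^esub>" by (simp add: induction.smult_cyc)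
    then show "m \<in> comb ` supported W" using comb_image_stable[OF r(1) *] by simp
  qed
qed (auto simp: comb_closed)

lemma psi_bij: "bij_betw \<psi> (carrier M) (supported W)"
  unfolding carrier_M_comb
  by (rule bij_betw_byWitness[where f' = comb]) (auto simp: psi_comb)

lemma psi_inj: "\<lbrakk>x \<in> carrier M; y \<in> carrier M; \<psi> x = \<psi> y\<rbrakk> \<Longrightarrow> x = y"
  using psi_bij by (auto simp: bij_betw_def inj_on_def)

lemma psi_surj: "f \<in> supported W \<Longrightarrow> \<exists>x \<in> carrier M. \<psi> x = f"
  unfolding bij_betw_imp_surj_on[OF psi_bij, symmetric] by auto

lemma subgroup_vimage:
  assumes "csubspace V"
  shows "subgroup {x \<in> carrier M. \<psi> x \<in> V} (add_monoid M)"
proof (rule induction.M.add.subgroupI)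
  let ?C = "{x \<in> carrier M. \<psi> x \<in> V}"
  show "?C \<noteq> {}"
    using psi_zero csubspaceD(1)[OF assms] by (auto intro: exI[of _ "\<zero>\<^bsub>M\<^esub>"])
  fix x assume x: "x \<in> ?C"
  have "\<psi> x + \<psi> (\<ominus>\<^bsub>M\<^esub> x) = 0"
    using psi_add[of x "\<ominus>\<^bsub>M\<^esub> x"] x by (simp add: induction.M.r_neg psi_zero)
  then have "\<psi> (\<ominus>\<^bsub>M\<^esub> x) = - \<psi> x" by (simp add: add_eq_0_iff)
  then show "\<ominus>\<^bsub>M\<^esub> x \<in> ?C" using x csubspaceD(4)[OF assms] by auto
  fix y assume "y \<in> ?C"
  then show "x \<oplus>\<^bsub>M\<^esub> y \<in> ?C" using x csubspaceD(2)[OF assms] by (auto simp: psi_add)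
qed auto

text \<open>
  Since \<open>\<psi>\<close> is injective, submodules can be recognized by their images, which are function spaces. The
  set \<open>R\<close> stands for a subalgebra, and \<open>C\<close> for a part of the module that is cut out by a function space,
  such as \<open>E\<^sub>1\<close> inside \<open>M\<close>.
\<close>

lemma submodule_iff:
  assumes R: "R \<subseteq> carrier \<H>" "\<And>c. c \<odot>\<^bsub>\<H>\<^esub> \<one>\<^bsub>\<H>\<^esub> \<in> R"
    and V: "csubspace V" and C: "C = {x \<in> carrier M. \<psi> x \<in> V}"
  shows "submodule N (\<H>\<lparr>carrier := R\<rparr>) (M\<lparr>carrier := C\<rparr>) \<longleftrightarrow>
    N \<subseteq> C \<and> csubspace (\<psi> ` N) \<and> (\<forall>r \<in> R. \<forall>f \<in> \<psi> ` N. act r f \<in> \<psi> ` N)"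
proof
  assume "submodule N (\<H>\<lparr>carrier := R\<rparr>) (M\<lparr>carrier := C\<rparr>)"
  then interpret N: submodule N "\<H>\<lparr>carrier := R\<rparr>" "M\<lparr>carrier := C\<rparr>" .
  have sub: "N \<subseteq> C" using N.subset by simp
  then have NM: "N \<subseteq> carrier M" using C by auto
  have smult: "r \<odot>\<^bsub>M\<^esub> x \<in> N" if "r \<in> R" "x \<in> N" for r x
    using N.smult_closed that by simp
  have act: "act r f \<in> \<psi> ` N" if "r \<in> R" "f \<in> \<psi> ` N" for r f
  proof -
    obtain x where x: "x \<in> N" "f = \<psi> x" using \<open>f \<in> \<psi> ` N\<close> by blast
    then have "act r f = \<psi> (r \<odot>\<^bsub>M\<^esub> x)" 
      using that(1) subsetD[OF NM] subsetD[OF R(1)] by (simp add: psi_smult)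
    then show ?thesis using smult[OF that(1) x(1)] by blast
  qed
  have "csubspace (\<psi> ` N)"
    unfolding csubspace_def
  proof (intro conjI ballI allI)
    show "0 \<in> \<psi> ` N" using N.one_closed psi_zero by (simp add: image_iff) (metis psi_zero)
  next
    fix f g assume "f \<in> \<psi> ` N" "g \<in> \<psi> ` N"
    then show "f + g \<in> \<psi> ` N"
      using N.m_closed NM by (auto simp: subset_iff simp flip: psi_add)
  next
    fix c f assume f: "f \<in> \<psi> ` N"
    then have "f \<in> supported W" using NM psi_closed by auto
    then show "c \<bullet>\<^sub>C f \<in> \<psi> ` N" using act[OF R(2) f] by (simp add: act_scalar)
  qed
  then show "N \<subseteq> C \<and> csubspace (\<psi> ` N) \<and> (\<forall>r \<in> R. \<forall>f \<in> \<psi> ` N. act r f \<in> \<psi> ` N)"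
    using sub act by blast
next
  assume N: "N \<subseteq> C \<and> csubspace (\<psi> ` N) \<and> (\<forall>r \<in> R. \<forall>f \<in> \<psi> ` N. act r f \<in> \<psi> ` N)"
  then have NM: "N \<subseteq> carrier M" using C by auto
  have N_eq: "N = {x \<in> carrier M. \<psi> x \<in> \<psi> ` N}"
  proof (intro equalityI subsetI)
    fix x assume "x \<in> {x \<in> carrier M. \<psi> x \<in> \<psi> ` N}"
    then obtain y where "x \<in> carrier M" "y \<in> N" "\<psi> x = \<psi> y" by blast
    then show "x \<in> N" using psi_inj[of x y] NM by blast
  qed (use NM in blast)
  have "subgroup N (add_monoid M)"
    by (subst N_eq) (rule subgroup_vimage, use N in blast)
  moreover have "subgroup C (add_monoid M)"
    unfolding C by (rule subgroup_vimage[OF V])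
  ultimately have "subgroup N ((add_monoid M)\<lparr>carrier := C\<rparr>)"
    using N induction.M.add.subgroup_incl by blast
  moreover have "r \<odot>\<^bsub>M\<^esub> x \<in> N" if "r \<in> R" "x \<in> N" for r x
  proof -
    have "\<psi> (r \<odot>\<^bsub>M\<^esub> x) \<in> \<psi> ` N"
      using that N NM R(1) by (simp add: psi_smult subset_iff)
    moreover have "r \<odot>\<^bsub>M\<^esub> x \<in> carrier M" using that NM R(1) smult_closed by blast
    ultimately show ?thesis using N_eq by blast
  qed
  ultimately show "submodule N (\<H>\<lparr>carrier := R\<rparr>) (M\<lparr>carrier := C\<rparr>)"
    by (simp add: submodule_def submodule_axioms_def)
qed

lemma act_generated_subalgebra:
  assumes "E' \<subseteq> fst P" "csubspace S" "S \<subseteq> supported W"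
    and "\<And>x f. \<lbrakk>x \<in> E'; f \<in> S\<rbrakk> \<Longrightarrow> \<rho> x f \<in> S"
    and r: "r \<in> generated_subalgebra \<H> (cl ` symb ` E')" and f: "f \<in> S"
  shows "act r f \<in> S"
proof -
  let ?S = "{c \<odot>\<^bsub>\<H>\<^esub> \<one>\<^bsub>\<H>\<^esub> |c. True} \<union> cl ` symb ` E'"
  have "?S \<subseteq> carrier \<H>" using assms(1) by (auto simp: cl_scalar)
  then have car: "h \<in> carrier \<H>" if "h \<in> generate_ring \<H> ?S" for h
    using alg.generate_ring_in_carrier that by blast
  note S = csubspaceD[OF assms(2)] subsetD[OF assms(3)]
  from r[unfolded generated_subalgebra_def] f show ?thesis
  proof (induction arbitrary: f rule: generate_ring.induct)
    case (incl h)
    then show ?case using assms(1,4) by (auto simp: act_scalar S act_symb subset_iff)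
  qed (auto simp: act_one act_minus act_add act_mult S car)
qed

text \<open>
  The condition on the generators is what can be compared between different algebras.
\<close>

lemma submodule_iff_generators:
  assumes E': "E' \<subseteq> fst P"
    and V: "csubspace V" "C = {x \<in> carrier M. \<psi> x \<in> V}"
  shows "submodule N (\<H>\<lparr>carrier := generated_subalgebra \<H> (cl ` symb ` E')\<rparr>) (M\<lparr>carrier := C\<rparr>) \<longleftrightarrow>
    N \<subseteq> C \<and> csubspace (\<psi> ` N) \<and> (\<forall>x \<in> E'. \<forall>f \<in> \<psi> ` N. \<rho> x f \<in> \<psi> ` N)"
proof -
  let ?R = "generated_subalgebra \<H> (cl ` symb ` E')"
  let ?S = "{c \<odot>\<^bsub>\<H>\<^esub> \<one>\<^bsub>\<H>\<^esub> |c. True} \<union> cl ` symb ` E'"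
  have S: "?S \<subseteq> carrier \<H>" using E' by (auto simp: cl_scalar)
  have R: "?R \<subseteq> carrier \<H>"
    using alg.generate_ring_in_carrier[OF S] by (auto simp: generated_subalgebra_def)
  have S_R: "?S \<subseteq> ?R" unfolding generated_subalgebra_def by (auto intro: generate_ring.incl)
  have eq: "(\<forall>r \<in> ?R. \<forall>f \<in> \<psi> ` N. act r f \<in> \<psi> ` N) \<longleftrightarrow> (\<forall>x \<in> E'. \<forall>f \<in> \<psi> ` N. \<rho> x f \<in> \<psi> ` N)"
    if N: "N \<subseteq> C" "csubspace (\<psi> ` N)"
  proof -
    have U: "\<psi> ` N \<subseteq> supported W" using N(1) V(2) psi_closed by auto
    show ?thesis
    proof safe
      fix x n assume "\<forall>r \<in> ?R. \<forall>f \<in> \<psi> ` N. act r f \<in> \<psi> ` N" "x \<in> E'" "n \<in> N"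
      moreover have "cl (symb x) \<in> ?R" using \<open>x \<in> E'\<close> S_R by auto
      ultimately have "act (cl (symb x)) (\<psi> n) \<in> \<psi> ` N" by blast
      moreover have "act (cl (symb x)) (\<psi> n) = \<rho> x (\<psi> n)"
        using U \<open>n \<in> N\<close> \<open>x \<in> E'\<close> E' by (intro act_symb) auto
      ultimately show "\<rho> x (\<psi> n) \<in> \<psi> ` N" by simp
    next
      fix r n assume "\<forall>x \<in> E'. \<forall>f \<in> \<psi> ` N. \<rho> x f \<in> \<psi> ` N" "r \<in> ?R" "n \<in> N"
      then show "act r (\<psi> n) \<in> \<psi> ` N"
        by (intro act_generated_subalgebra[OF E' N(2) U]) auto
    qed
  qed
  have "c \<odot>\<^bsub>\<H>\<^esub> \<one>\<^bsub>\<H>\<^esub> \<in> ?R" for c using S_R by auto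
  from submodule_iff[OF R this V] show ?thesis
    by (simp only: eq cong: conj_cong)
qed

text \<open>
  A complex subspace is determined by its image under \<open>\<psi>\<close>, and a subspace of functions that contains the
  point masses on \<open>W'\<close> contains all functions supported on \<open>W'\<close>.
\<close>

lemma complex_span_eq:
  assumes "W' \<subseteq> W"
  shows "complex_span \<H> M ((\<lambda>w. cyc (cl (symb (s w)))) ` W') = {x \<in> carrier M. \<psi> x \<in> supported W'}"
    (is "_ = ?C")
proof -
  let ?R = "{c \<odot>\<^bsub>\<H>\<^esub> \<one>\<^bsub>\<H>\<^esub> |c. True}"
  have R: "?R \<subseteq> carrier \<H>" by (auto simp: cl_scalar)
  have M_eq: "M\<lparr>carrier := carrier M\<rparr> = M" by simp
  have iff: "submodule N (\<H>\<lparr>carrier := ?R\<rparr>) M \<longleftrightarrow> N \<subseteq> carrier M \<and> csubspace (\<psi> ` N)" for N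
  proof -
    have "submodule N (\<H>\<lparr>carrier := ?R\<rparr>) (M\<lparr>carrier := carrier M\<rparr>) \<longleftrightarrow>
      N \<subseteq> carrier M \<and> csubspace (\<psi> ` N) \<and> (\<forall>r \<in> ?R. \<forall>f \<in> \<psi> ` N. act r f \<in> \<psi> ` N)"
      by (rule submodule_iff[OF R _ csubspace_supported[of W]]) (auto simp: psi_closed)
    moreover have "act r f \<in> \<psi> ` N" if "N \<subseteq> carrier M" "csubspace (\<psi> ` N)" "r \<in> ?R" "f \<in> \<psi> ` N" for r f
    proof -
      have "f \<in> supported W" using that(1,4) psi_closed by blast
      then show ?thesis using that(3) csubspaceD(3)[OF that(2,4)] by (auto simp: act_scalar)
    qed
    ultimately show ?thesis unfolding M_eq by blast
  qed
  have basis: "cyc (cl (symb (s w))) \<in> carrier M" "\<psi> (cyc (cl (symb (s w)))) = delta w" if "w \<in> W'" for w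
    using that assms comb_closed psi_comb[OF delta_supported] by (auto simp: subset_iff simp flip: comb_delta)
  have "supported W' \<subseteq> supported W" using assms by (auto simp: supported_def)
  then have "\<psi> ` ?C = supported W'"
    using psi_surj by blast
  then have "submodule ?C (\<H>\<lparr>carrier := ?R\<rparr>) M"
    unfolding iff using csubspace_supported[of W'] by auto
  moreover have "(\<lambda>w. cyc (cl (symb (s w)))) ` W' \<subseteq> ?C"
    using basis delta_supported by auto
  moreover have "?C \<subseteq> N"
    if "submodule N (\<H>\<lparr>carrier := ?R\<rparr>) M" "(\<lambda>w. cyc (cl (symb (s w)))) ` W' \<subseteq> N" for N
  proof
    have N: "N \<subseteq> carrier M" "csubspace (\<psi> ` N)" using that(1) iff by auto
    have "delta w \<in> \<psi> ` N" if "w \<in> W'" for w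
      using basis(2)[OF that] that \<open>_ ` W' \<subseteq> N\<close> by (metis image_eqI image_subset_iff)
    then have sup: "supported W' \<subseteq> \<psi> ` N"
      using supported_subset_csubspace[OF finite_subset[OF assms finite_W] N(2)] by blast
    fix x assume "x \<in> ?C"
    then obtain y where "y \<in> N" "\<psi> x = \<psi> y" using sup by auto
    then show "x \<in> N" using psi_inj[of x y] N(1) \<open>x \<in> ?C\<close> by auto
  qed
  ultimately show ?thesis
    unfolding complex_span_def by (intro equalityI Inter_lower Inter_greatest CollectI conjI; blast)
qed

end

section \<open>Reflections\<close>

lemma coroot_simps:
  "coroot \<alpha> (u + v) = coroot \<alpha> u + coroot \<alpha> v" "coroot \<alpha> (c *\<^sub>R v) = c * coroot \<alpha> v"
  "coroot \<alpha> (u - v) = coroot \<alpha> u - coroot \<alpha> v"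
  by (simp_all add: coroot_def inner_right_distrib inner_diff_right add_divide_distrib diff_divide_distrib algebra_simps)

lemma root_reflection_uminus: "root_reflection (- \<alpha>) = root_reflection \<alpha>"
  by (auto simp: root_reflection_def coroot_def fun_eq_iff)

lemma coroot_self: "coroot \<alpha> \<alpha> = (if \<alpha> = 0 then 0 else 2)"
  by (simp add: coroot_def)

lemma coroot_reflection: "coroot \<alpha> (root_reflection \<alpha> v) = - coroot \<alpha> v"
  by (cases "\<alpha> = 0") (simp_all add: root_reflection_def coroot_simps coroot_self, simp add: coroot_def)

lemma reflection_involution: "root_reflection \<alpha> (root_reflection \<alpha> v) = v"
  by (subst (1) root_reflection_def) (simp add: coroot_reflection, simp add: root_reflection_def)

lemma reflection_comp_self: "root_reflection \<alpha> \<circ> root_reflection \<alpha> = id"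
  by (auto simp: fun_eq_iff reflection_involution)

lemma bij_reflection: "bij (root_reflection \<alpha>)"
  by (rule o_bij[OF reflection_comp_self reflection_comp_self])

lemma inv_reflection: "inv_into UNIV (root_reflection \<alpha>) = root_reflection \<alpha>"
  by (rule inv_unique_comp[OF reflection_comp_self reflection_comp_self])

lemma linear_reflection: "linear (root_reflection \<alpha>)"
  by (rule linearI) (simp_all add: root_reflection_def coroot_simps algebra_simps)

lemma orthogonal_reflection: "orthogonal_transformation (root_reflection \<alpha>)"
proof (cases "\<alpha> = 0")
  case True
  then show ?thesis
    by (simp add: orthogonal_transformation_def linear_reflection) (simp add: root_reflection_def)
next
  case False
  have "root_reflection \<alpha> v \<bullet> root_reflection \<alpha> w = v \<bullet> w" for v w
    using False
    by (simp add: root_reflection_def coroot_def inner_diff_left inner_diff_right inner_commute field_simps)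
  then show ?thesis by (simp add: orthogonal_transformation_def linear_reflection)
qed

lemma coroot_conjugate:
  "orthogonal_transformation w \<Longrightarrow> coroot (w \<alpha>) (w v) = coroot \<alpha> v"
  by (simp add: coroot_def orthogonal_transformation_def)

lemma reflection_conjugate:
  "orthogonal_transformation w \<Longrightarrow> root_reflection (w \<alpha>) (w v) = w (root_reflection \<alpha> v)"
  unfolding root_reflection_def[of "w \<alpha>"] coroot_conjugate root_reflection_def[of \<alpha>]
  by (simp add: orthogonal_transformation_def linear_diff linear_cmul)

section \<open>Operators of Dunkl type\<close>

text \<open>
  A finite group \<open>W\<close> generated by the reflections in the simple roots \<open>Sp\<close> of a positive system \<open>Rp\<close>,
  a weight \<open>\<kappa>\<close> on the roots and a linear functional \<open>\<nu>\<close>. The weight may vary within a \<open>W\<close>-orbit of roots;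
  \<open>kappa_reflection\<close> only asks that it be preserved by the reflections in roots of nonzero weight, which is
  what makes the operators \<open>K\<close> below commute with the operators \<open>Y\<close>.
\<close>

locale hecke_data =
  fixes W :: "('v::euclidean_space \<Rightarrow> 'v) set" and Rp Sp :: "'v set"
    and \<kappa> :: "'v \<Rightarrow> complex" and \<nu> :: "'v \<Rightarrow> complex"
  assumes finite_W: "finite W" and id_W: "id \<in> W"
    and comp_W: "\<lbrakk>u \<in> W; w \<in> W\<rbrakk> \<Longrightarrow> u \<circ> w \<in> W"
    and inv_W: "w \<in> W \<Longrightarrow> inv_into UNIV w \<in> W"
    and orth_W: "w \<in> W \<Longrightarrow> orthogonal_transformation w"
    and finite_Rp: "finite Rp"
    and Rp_pos: "\<alpha> \<in> Rp \<Longrightarrow> - \<alpha> \<notin> Rp"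
    and W_Rp: "\<lbrakk>w \<in> W; \<alpha> \<in> Rp\<rbrakk> \<Longrightarrow> w \<alpha> \<in> Rp \<or> - w \<alpha> \<in> Rp"
    and refl_W: "\<alpha> \<in> Rp \<Longrightarrow> root_reflection \<alpha> \<in> W"
    and Sp_Rp: "Sp \<subseteq> Rp"
    and simple: "\<lbrakk>\<alpha> \<in> Sp; \<beta> \<in> Rp; \<beta> \<noteq> \<alpha>\<rbrakk> \<Longrightarrow> root_reflection \<alpha> \<beta> \<in> Rp"
    and simple_induct: "\<lbrakk>w \<in> W; Q id; \<And>\<alpha> w. \<lbrakk>\<alpha> \<in> Sp; w \<in> W; Q w\<rbrakk> \<Longrightarrow> Q (root_reflection \<alpha> \<circ> w)\<rbrakk> \<Longrightarrow> Q w"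
    and kappa_uminus: "\<kappa> (- \<alpha>) = \<kappa> \<alpha>"
    and kappa_reflection: "\<lbrakk>\<alpha> \<in> Rp; \<beta> \<in> Rp; \<kappa> \<beta> \<noteq> 0\<rbrakk> \<Longrightarrow> \<kappa> (root_reflection \<beta> \<alpha>) = \<kappa> \<alpha>"
    and linear_nu: "linear \<nu>"
begin

abbreviation "iv \<equiv> inv_into (UNIV :: 'v set)"
abbreviation "s \<equiv> root_reflection"

text \<open>
  In the induced module,
  \<open>\<zeta> t\<^sub>w \<otimes> v = \<nu>(w\<inverse>\<zeta>) t\<^sub>w \<otimes> v - \<Sum> \<kappa>(w\<inverse>\<alpha>) \<langle>\<alpha>\<^sup>\<vee>, \<zeta>\<rangle> t\<^bsub>s\<^sub>\<alpha>w\<^esub> \<otimes> v\<close>, summed over the positive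
  \<open>\<alpha>\<close> with \<open>w\<inverse>\<alpha>\<close> negative. The operator \<open>Y\<close> describes this on coefficient functions. The coefficient at \<open>w\<close>
  comes from \<open>s\<^sub>\<alpha>w\<close>, and \<open>(s\<^sub>\<alpha>w)\<inverse>\<alpha> = -w\<inverse>\<alpha>\<close>, so the condition becomes that \<open>w\<inverse>\<alpha>\<close> be positive.
\<close>

definition Y :: "'v \<Rightarrow> (('v \<Rightarrow> 'v) \<Rightarrow> complex) \<Rightarrow> ('v \<Rightarrow> 'v) \<Rightarrow> complex"
  where "Y v f = (\<lambda>w. if w \<in> W then \<nu> (iv w v) * f w -
    (\<Sum>\<alpha> \<in> {\<alpha> \<in> Rp. iv w \<alpha> \<in> Rp}. \<kappa> (iv w \<alpha>) * of_real (coroot \<alpha> v) * f (s \<alpha> \<circ> w)) else 0)"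

definition T :: "('v \<Rightarrow> 'v) \<Rightarrow> (('v \<Rightarrow> 'v) \<Rightarrow> complex) \<Rightarrow> ('v \<Rightarrow> 'v) \<Rightarrow> complex"
  where "T u f = (\<lambda>w. if w \<in> W then f (iv u \<circ> w) else 0)"

text \<open>
  The operator by which the parameter of the root \<open>\<alpha>\<close> in the cross relation acts.
\<close>

definition K :: "'v \<Rightarrow> (('v \<Rightarrow> 'v) \<Rightarrow> complex) \<Rightarrow> ('v \<Rightarrow> 'v) \<Rightarrow> complex"
  where "K \<alpha> f = (\<lambda>w. \<kappa> (iv w \<alpha>) * f w)"

lemma bij_W: "w \<in> W \<Longrightarrow> bij w"
  using orth_W orthogonal_transformation_bij by blast

lemma linear_W: "w \<in> W \<Longrightarrow> linear w"
  using orth_W orthogonal_transformation_linear by blast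

lemma inv_comp: "\<lbrakk>u \<in> W; w \<in> W\<rbrakk> \<Longrightarrow> iv (u \<circ> w) = iv w \<circ> iv u"
  by (simp add: o_inv_distrib bij_W)

lemma inv_cancel [simp]: "w \<in> W \<Longrightarrow> iv w (w v) = v" "w \<in> W \<Longrightarrow> w (iv w v) = v"
  using bij_W bij_inv_eq_iff by (metis, metis)

lemma linear_nu_inv: "w \<in> W \<Longrightarrow> linear (\<lambda>v. \<nu> (iv w v))"
  using linear_compose[OF linear_W[OF inv_W] linear_nu] by (simp add: o_def)

lemma linear_Y: "linear_op (Y v)"
  by (auto simp: linear_op_def Y_def fun_eq_iff fscale_apply algebra_simps sum.distrib sum_distrib_left)

lemma linear_T: "linear_op (T u)"
  by (auto simp: linear_op_def T_def fun_eq_iff fscale_apply)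

lemma linear_K: "linear_op (K \<alpha>)"
  by (auto simp: linear_op_def K_def fun_eq_iff fscale_apply algebra_simps)

lemma Y_supported: "Y v f \<in> supported W"
  by (auto simp: Y_def supported_def)

lemma T_supported: "T u f \<in> supported W"
  by (auto simp: T_def supported_def)

lemma Y_add: "Y (u + v) f = Y u f + Y v f"
  by (auto simp: Y_def fun_eq_iff linear_add[OF linear_nu_inv] coroot_simps algebra_simps sum.distrib)

lemma Y_scale: "Y (r *\<^sub>R v) f = complex_of_real r \<bullet>\<^sub>C Y v f"
  by (auto simp: Y_def fun_eq_iff fscale_apply linear_cmul[OF linear_nu_inv] coroot_simps scaleR_conv_of_real
      algebra_simps sum_distrib_left)

lemma Y_diff: "Y (u - v) f = Y u f - Y v f"
  using Y_add[of "u - v" v f] by simp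

lemma T_id: "f \<in> supported W \<Longrightarrow> T id f = f"
  by (auto simp: T_def supported_def fun_eq_iff)

lemma T_comp: "\<lbrakk>u \<in> W; w \<in> W\<rbrakk> \<Longrightarrow> T u (T w f) = T (u \<circ> w) f"
  by (auto simp: T_def fun_eq_iff inv_comp comp_W inv_W o_assoc)

lemma T_delta: "\<lbrakk>u \<in> W; w \<in> W\<rbrakk> \<Longrightarrow> T u (delta w) = delta (u \<circ> w)"
proof -
  assume *: "u \<in> W" "w \<in> W"
  have eq: "iv u \<circ> x = w \<longleftrightarrow> x = u \<circ> w" for x
    using inv_cancel[OF *(1)] by (auto simp: fun_eq_iff) (metis inv_cancel(2)[OF *(1)])
  show ?thesis
    by (rule ext) (use comp_W[OF *] in \<open>auto simp: T_def delta_def eq\<close>)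
qed

lemma Rp_nonzero: "\<alpha> \<in> Rp \<Longrightarrow> \<alpha> \<noteq> 0"
  using Rp_pos by force

text \<open>
  The cross relation. For \<open>\<beta> \<noteq> \<alpha>\<close> the reflection \<open>s \<alpha>\<close> matches the \<open>\<beta>\<close>-term of one side with the
  \<open>s \<alpha> \<beta>\<close>-term of the other. The root \<open>\<alpha>\<close> itself contributes to exactly one side, depending on the sign of
  \<open>w\<inverse>\<alpha>\<close>, and in both cases its contribution is the term with \<open>K\<close>.
\<close>

lemma T_Y:
  assumes \<alpha>: "\<alpha> \<in> Sp" and f: "f \<in> supported W"
  shows "T (s \<alpha>) (Y v f) = Y (s \<alpha> v) (T (s \<alpha>) f) + of_real (coroot \<alpha> (s \<alpha> v)) \<bullet>\<^sub>C K \<alpha> f" (is "?l = ?r")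
proof
  fix w
  have \<alpha>R: "\<alpha> \<in> Rp" using \<alpha> Sp_Rp by auto
  then have sW: "s \<alpha> \<in> W" by (rule refl_W)
  show "?l w = ?r w"
  proof (cases "w \<in> W")
    case False
    then show ?thesis using f by (simp add: T_def Y_def K_def supported_def fscale_apply)
  next
    case w: True
    let ?g = "iv w"
    have u: "s \<alpha> \<circ> w \<in> W" using comp_W sW w by blast
    have iv_u: "iv (s \<alpha> \<circ> w) v = ?g (s \<alpha> v)" for v
      using inv_comp[OF sW w] by (simp add: inv_reflection)
    have g_minus: "?g (- v) = - ?g v" for v
      using linear_neg[OF linear_W[OF inv_W[OF w]]] by simp
    have s\<alpha>: "s \<alpha> \<alpha> = - \<alpha>"
      using Rp_nonzero[OF \<alpha>R] by (simp add: root_reflection_def coroot_self scaleR_2)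
    define B where "B = {\<beta> \<in> Rp. ?g (s \<alpha> \<beta>) \<in> Rp}"
    define D where "D = {\<beta> \<in> Rp. ?g \<beta> \<in> Rp}"
    define b where "b \<beta> = \<kappa> (?g (s \<alpha> \<beta>)) * of_real (coroot \<beta> v) * f (s \<beta> \<circ> (s \<alpha> \<circ> w))" for \<beta>
    define d where "d \<beta> = \<kappa> (?g \<beta>) * of_real (coroot \<beta> (s \<alpha> v)) * f (s \<alpha> \<circ> (s \<beta> \<circ> w))" for \<beta>
    \<comment> \<open>The contribution of the root \<open>\<alpha>\<close> itself, up to sign.\<close>
    define c where "c = \<kappa> (?g \<alpha>) * of_real (coroot \<alpha> v) * f w"
    have fin: "finite B" "finite D" using finite_Rp by (auto simp: B_def D_def)
    have l: "?l w = \<nu> (?g (s \<alpha> v)) * f (s \<alpha> \<circ> w) - sum b B"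
      using w u by (simp add: T_def Y_def inv_reflection iv_u B_def b_def)
    have "(\<Sum>\<beta>\<in>D. \<kappa> (?g \<beta>) * of_real (coroot \<beta> (s \<alpha> v)) * T (s \<alpha>) f (s \<beta> \<circ> w)) = sum d D"
      by (rule sum.cong) (use w comp_W refl_W in \<open>auto simp: D_def d_def T_def inv_reflection\<close>)
    then have r: "?r w = \<nu> (?g (s \<alpha> v)) * f (s \<alpha> \<circ> w) - sum d D - c"
      using w u by (simp add: Y_def D_def K_def fscale_apply coroot_reflection c_def)
        (simp add: T_def inv_reflection)
    have "sum b (B - {\<alpha>}) = sum d (D - {\<alpha>})"
    proof (rule sum.reindex_bij_witness[where i = "s \<alpha>" and j = "s \<alpha>"])
      fix \<beta> assume \<beta>: "\<beta> \<in> B - {\<alpha>}"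
      show "s \<alpha> (s \<alpha> \<beta>) = \<beta>" by (rule reflection_involution)
      have "s \<alpha> \<beta> \<in> Rp" using simple[OF \<alpha>] \<beta> by (auto simp: B_def)
      moreover have "s \<alpha> \<beta> \<noteq> \<alpha>"
        using \<beta> Rp_pos[OF \<alpha>R] reflection_involution[of \<alpha> \<beta>] by (auto simp: s\<alpha> B_def)
      ultimately show "s \<alpha> \<beta> \<in> D - {\<alpha>}" using \<beta> by (auto simp: B_def D_def)
      have "s (s \<alpha> \<beta>) (s \<alpha> x) = s \<alpha> (s \<beta> x)" for x
        by (rule reflection_conjugate[OF orthogonal_reflection])
      then have "s \<alpha> \<circ> (s (s \<alpha> \<beta>) \<circ> w) = s \<beta> \<circ> (s \<alpha> \<circ> w)"
        by (auto simp: fun_eq_iff) (metis reflection_involution)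
      moreover have "coroot (s \<alpha> \<beta>) (s \<alpha> v) = coroot \<beta> v"
        by (rule coroot_conjugate[OF orthogonal_reflection])
      ultimately show "d (s \<alpha> \<beta>) = b \<beta>" by (simp add: b_def d_def)
    next
      fix \<beta> assume \<beta>: "\<beta> \<in> D - {\<alpha>}"
      show "s \<alpha> (s \<alpha> \<beta>) = \<beta>" by (rule reflection_involution)
      have "s \<alpha> \<beta> \<in> Rp" using simple[OF \<alpha>] \<beta> by (auto simp: D_def)
      moreover have "s \<alpha> \<beta> \<noteq> \<alpha>"
        using \<beta> Rp_pos[OF \<alpha>R] reflection_involution[of \<alpha> \<beta>] by (auto simp: s\<alpha> D_def)
      ultimately show "s \<alpha> \<beta> \<in> B - {\<alpha>}" using \<beta> by (auto simp: B_def D_def reflection_involution)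
    qed
    moreover have "\<alpha> \<in> B \<longleftrightarrow> - ?g \<alpha> \<in> Rp" "\<alpha> \<in> D \<longleftrightarrow> ?g \<alpha> \<in> Rp"
      using \<alpha>R by (auto simp: B_def D_def s\<alpha> g_minus)
    moreover have "?g \<alpha> \<in> Rp \<longleftrightarrow> \<not> - ?g \<alpha> \<in> Rp"
      using W_Rp[OF inv_W[OF w] \<alpha>R] Rp_pos[of "?g \<alpha>"] by auto
    moreover have "b \<alpha> = c"
      using reflection_comp_self[of \<alpha>]
      by (simp add: b_def c_def s\<alpha> g_minus kappa_uminus o_assoc)
    moreover have "d \<alpha> = - c"
      using reflection_comp_self[of \<alpha>]
      by (simp add: d_def c_def coroot_reflection o_assoc)
    ultimately have "sum b B = sum d D + c"
      using fin by (cases "\<alpha> \<in> B") (auto simp: sum.remove[of B \<alpha>] sum.remove[of D \<alpha>])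
    then show ?thesis by (simp only: l r) simp
  qed
qed

lemma Y_T:
  assumes "\<alpha> \<in> Sp" "f \<in> supported W"
  shows "Y v (T (s \<alpha>) f) = T (s \<alpha>) (Y (s \<alpha> v) f) - of_real (coroot \<alpha> v) \<bullet>\<^sub>C K \<alpha> f"
  using T_Y[OF assms, of "s \<alpha> v"] by (simp add: reflection_involution)

lemma kappa_root:
  assumes "\<beta> \<in> Rp" "\<kappa> \<beta> \<noteq> 0" "\<alpha> \<in> Rp \<or> - \<alpha> \<in> Rp"
  shows "\<kappa> (s \<beta> \<alpha>) = \<kappa> \<alpha>"
  using assms(3)
proof
  assume "- \<alpha> \<in> Rp"
  then have "\<kappa> (s \<beta> (- \<alpha>)) = \<kappa> (- \<alpha>)" using kappa_reflection assms by blast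
  then show ?thesis by (simp add: linear_neg[OF linear_reflection] kappa_uminus)
qed (use kappa_reflection assms in blast)

lemma Y_K:
  assumes \<alpha>: "\<alpha> \<in> Rp"
  shows "Y v (K \<alpha> f) = K \<alpha> (Y v f)"
proof
  fix w
  show "Y v (K \<alpha> f) w = K \<alpha> (Y v f) w"
  proof (cases "w \<in> W")
    case w: True
    let ?g = "iv w"
    have key: "\<kappa> (?g \<beta>) * c * (\<kappa> (iv (s \<beta> \<circ> w) \<alpha>) * F) = \<kappa> (?g \<alpha>) * (\<kappa> (?g \<beta>) * c * F)"
      if \<beta>: "\<beta> \<in> Rp" "?g \<beta> \<in> Rp" for \<beta> c F
    proof (cases "\<kappa> (?g \<beta>) = 0")
      case False
      have "iv (s \<beta> \<circ> w) \<alpha> = ?g (s \<beta> \<alpha>)"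
        using inv_comp[OF refl_W[OF \<beta>(1)] w] by (simp add: inv_reflection)
      also have "\<dots> = s (?g \<beta>) (?g \<alpha>)"
        by (rule reflection_conjugate[symmetric, OF orth_W[OF inv_W[OF w]]])
      finally show ?thesis
        using kappa_root[OF \<beta>(2) False W_Rp[OF inv_W[OF w] \<alpha>]] by simp
    qed simp
    show ?thesis
      using w by (simp add: Y_def K_def right_diff_distrib sum_distrib_left) (rule sum.cong[OF refl], rule key, auto)
  qed (simp add: Y_def K_def)
qed

lemma Y_delta_id: "Y v (delta id) = \<nu> v \<bullet>\<^sub>C delta id"
proof
  fix w
  show "Y v (delta id) w = (\<nu> v \<bullet>\<^sub>C delta id) w"
  proof (cases "w \<in> W")
    case w: True
    have "delta id (s \<alpha> \<circ> w) = 0" if "\<alpha> \<in> Rp" "iv w \<alpha> \<in> Rp" for \<alpha>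
    proof -
      have "s \<alpha> \<circ> w \<noteq> id"
      proof
        assume "s \<alpha> \<circ> w = id"
        then have "s \<alpha> \<circ> (s \<alpha> \<circ> w) = s \<alpha>" by simp
        then have "w = s \<alpha>" by (simp add: o_assoc reflection_comp_self)
        then have "iv w \<alpha> = - \<alpha>"
          using Rp_nonzero[OF that(1)] by (simp add: inv_reflection root_reflection_def coroot_self scaleR_2)
        then show False using that Rp_pos by auto
      qed
      then show ?thesis by (simp add: delta_def)
    qed
    then have "Y v (delta id) w = \<nu> (iv w v) * delta id w" using w by (simp add: Y_def)
    then show ?thesis by (simp add: fscale_apply) (simp add: delta_def)
  qed (use id_W in \<open>auto simp: Y_def fscale_apply delta_def\<close>)
qed

text \<open>
  Write \<open>c(u) = \<langle>\<alpha>\<^sup>\<vee>, u\<rangle>\<close>. Moving \<open>T (s \<alpha>)\<close> to the left through \<open>Y u (Y v _)\<close> with the cross relation leaves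
  \<open>T (s \<alpha>) (Y (s \<alpha> u) (Y (s \<alpha> v) _))\<close> and remainders that are symmetric in \<open>u\<close> and \<open>v\<close>. So if the operators commute
  on the point mass at \<open>w\<close>, they commute on the point mass at \<open>s \<alpha> \<circ> w\<close>. The induction starts at the
  identity, where the point mass is a common eigenvector.
\<close>

lemma Y_commute:
  assumes "f \<in> supported W"
  shows "Y u (Y v f) = Y v (Y u f)"
proof -
  have "\<forall>u v. Y u (Y v (delta w)) = Y v (Y u (delta w))" if "w \<in> W" for w
  proof (rule simple_induct[OF that])
    show "\<forall>u v. Y u (Y v (delta id)) = Y v (Y u (delta id))"
      by (auto simp: Y_delta_id linear_opD[OF linear_Y] mult.commute)
  next
    fix \<alpha> w assume \<alpha>: "\<alpha> \<in> Sp" and w: "w \<in> W"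
      and IH: "\<forall>u v. Y u (Y v (delta w)) = Y v (Y u (delta w))"
    let ?f = "delta w"
    let ?s = "s \<alpha>"
    have f: "?f \<in> supported W" by (rule delta_supported[OF w])
    have \<alpha>R: "\<alpha> \<in> Rp" using \<alpha> Sp_Rp by auto
    have d: "delta (?s \<circ> w) = T ?s ?f" using T_delta[OF refl_W[OF \<alpha>R] w] by simp
    define R where "R = K \<alpha> (Y \<alpha> ?f)"
    have exp: "Y u (Y v (T ?s ?f)) = T ?s (Y (?s u) (Y (?s v) ?f))
       - of_real (coroot \<alpha> u) \<bullet>\<^sub>C K \<alpha> (Y v ?f) - of_real (coroot \<alpha> v) \<bullet>\<^sub>C K \<alpha> (Y u ?f)
       + of_real (coroot \<alpha> u * coroot \<alpha> v) \<bullet>\<^sub>C R" for u v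
    proof -
      have sv: "Y (?s v) ?f = Y v ?f - of_real (coroot \<alpha> v) \<bullet>\<^sub>C Y \<alpha> ?f"
        by (simp add: root_reflection_def Y_diff Y_scale)
      have "Y u (Y v (T ?s ?f)) = Y u (T ?s (Y (?s v) ?f)) - of_real (coroot \<alpha> v) \<bullet>\<^sub>C K \<alpha> (Y u ?f)"
        by (simp add: Y_T[OF \<alpha> f] linear_opD[OF linear_Y] Y_K[OF \<alpha>R])
      also have "Y u (T ?s (Y (?s v) ?f)) = T ?s (Y (?s u) (Y (?s v) ?f)) - of_real (coroot \<alpha> u) \<bullet>\<^sub>C K \<alpha> (Y (?s v) ?f)"
        by (rule Y_T[OF \<alpha> Y_supported])
      also have "K \<alpha> (Y (?s v) ?f) = K \<alpha> (Y v ?f) - of_real (coroot \<alpha> v) \<bullet>\<^sub>C R"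
        by (simp add: sv linear_opD[OF linear_K] R_def)
      finally show ?thesis
        by (simp add: fun_eq_iff fscale_apply algebra_simps)
    qed
    show "\<forall>u v. Y u (Y v (delta (?s \<circ> w))) = Y v (Y u (delta (?s \<circ> w)))"
      using IH by (auto simp: d exp) (simp add: mult.commute)
  qed
  then have *: "Y u (Y v (delta w)) = Y v (Y u (delta w))" if "w \<in> W" for w using that by blast
  have "csubspace {f. Y u (Y v f) = Y v (Y u f)}"
    by (simp add: csubspace_def linear_opD[OF linear_Y])
  then have "supported W \<subseteq> {f. Y u (Y v f) = Y v (Y u f)}"
    by (rule supported_subset_csubspace[OF finite_W]) (use * in blast)
  then show ?thesis using assms by blast
qed

text \<open>
  The complexification \<open>V\<^sub>\<complex>\<close> consists of pairs, \<open>(x, y)\<close> standing for \<open>x + \<i>y\<close>.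
\<close>

definition YC :: "'v cpx \<Rightarrow> (('v \<Rightarrow> 'v) \<Rightarrow> complex) \<Rightarrow> ('v \<Rightarrow> 'v) \<Rightarrow> complex"
  where "YC z f = Y (fst z) f + \<i> \<bullet>\<^sub>C Y (snd z) f"

lemma linear_YC: "linear_op (YC z)"
  by (auto simp: linear_op_def YC_def linear_opD[OF linear_Y] fscale_add mult.commute)

lemma YC_supported: "YC z f \<in> supported W"
  by (auto simp: YC_def supported_def Y_def fscale_apply)

lemma YC_add: "YC (z + z') f = YC z f + YC z' f"
  by (simp add: YC_def Y_add fscale_add)

lemma YC_cscale: "YC (cscale c z) f = c \<bullet>\<^sub>C YC z f"
proof -
  have *: "of_real (Re c) * a - of_real (Im c) * b + \<i> * (of_real (Re c) * b + of_real (Im c) * a) =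
      c * (a + \<i> * b)" for a b
    by (simp add: complex_eq_iff algebra_simps)
  show ?thesis
    by (rule ext) (simp add: YC_def cscale_def Y_add Y_diff Y_scale fscale_apply *)
qed

lemma YC_real_vec: "YC (real_vec v) f = Y v f"
  using Y_scale[of 0 0 f] by (simp add: YC_def real_vec_def)

lemma YC_commute: "f \<in> supported W \<Longrightarrow> YC z (YC z' f) = YC z' (YC z f)"
  by (simp add: YC_def linear_opD[OF linear_Y] fscale_add Y_commute algebra_simps mult.commute)

lemma YC_delta_id: "YC z (delta id) = (\<nu> (fst z) + \<i> * \<nu> (snd z)) \<bullet>\<^sub>C delta id"
  by (simp add: YC_def Y_delta_id fscale_add)

end

section \<open>Hecke algebras acting by operators of Dunkl type\<close>

lemma sym_relators_mem:
  "vec_symb (\<zeta> + \<eta>) - (vec_symb \<zeta> + vec_symb \<eta>) \<in> sym_relators"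
  "vec_symb (cscale c \<zeta>) - const c * vec_symb \<zeta> \<in> sym_relators"
  unfolding sym_relators_def by blast+

text \<open>
  The common shape of the two Hecke algebras. The group \<open>G\<close> whose elements are generators may be larger than
  \<open>W\<close>; it acts by operators \<open>B\<close> that extend the translations by \<open>W\<close>. The elements of \<open>D\<close> are the remaining
  generators of the commutative subalgebra, and they act on the eigenvector by \<open>\<mu>\<close>. The right-hand side of
  the cross relation for \<open>\<alpha>\<close> is \<open>m \<alpha>\<close>; its form \<open>c + d t\<^sub>g t\<^sub>h\<close> covers \<open>2k\<close> as well as \<open>k (1 + t\<^sub>p t\<^sub>q)\<close>.
\<close>

locale hecke_algebra = hecke_data W Rp Sp \<kappa> \<nu>
  for W :: "('v::euclidean_space \<Rightarrow> 'v) set" and Rp Sp \<kappa> \<nu> +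
  fixes P :: "'v hecke_gen presentation" and G D :: "('v \<Rightarrow> 'v) set" and \<mu> :: "('v \<Rightarrow> 'v) \<Rightarrow> complex"
    and B :: "('v \<Rightarrow> 'v) \<Rightarrow> (('v \<Rightarrow> 'v) \<Rightarrow> complex) \<Rightarrow> ('v \<Rightarrow> 'v) \<Rightarrow> complex"
    and m :: "'v \<Rightarrow> 'v hecke_gen ncpoly" and extra :: "'v hecke_gen ncpoly set"
  assumes P_gens: "fst P = range Vec \<union> Grp ` G"
    and P_rels: "snd P = sym_relators \<union> group_relators G \<union> extra \<union>
      {cross_relator \<alpha> (m \<alpha>) \<zeta> | \<alpha> \<zeta>. \<alpha> \<in> Sp}"
    and W_G: "W \<subseteq> G" and D_G: "D \<subseteq> G" and comp_G: "\<lbrakk>g \<in> G; h \<in> G\<rbrakk> \<Longrightarrow> g \<circ> h \<in> G"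
    and m_form: "\<alpha> \<in> Sp \<Longrightarrow> \<exists>c d g h. g \<in> G \<and> h \<in> G \<and> m \<alpha> = const c + const d * (grp_symb g * grp_symb h)"
    and extra_closed: "extra \<subseteq> carrier (free_algebra (range Vec \<union> Grp ` G))"
    and linear_B: "linear_op (B g)" and B_supported: "g \<in> G \<Longrightarrow> B g f \<in> supported W"
    and B_W: "w \<in> W \<Longrightarrow> B w f = T w f"
    and B_comp: "\<lbrakk>g \<in> G; h \<in> G; f \<in> supported W\<rbrakk> \<Longrightarrow> B g (B h f) = B (g \<circ> h) f"
    and B_m: "\<lbrakk>\<alpha> \<in> Sp; f \<in> supported W\<rbrakk> \<Longrightarrow> poly_act (case_hecke_gen YC B) (m \<alpha>) f = K \<alpha> f"
    and B_extra: "\<lbrakk>r \<in> extra; f \<in> supported W\<rbrakk> \<Longrightarrow> poly_act (case_hecke_gen YC B) r f = 0"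
    and B_D: "x \<in> D \<Longrightarrow> B x (delta id) = \<mu> x \<bullet>\<^sub>C delta id"
    and G_factor: "g \<in> G \<Longrightarrow> (\<exists>u \<in> W. g = u) \<or> (\<exists>u \<in> W. \<exists>y \<in> D. g = u \<circ> y)"
begin

abbreviation "\<rho> \<equiv> case_hecke_gen YC B"

lemma linear_rho: "linear_op (\<rho> x)"
  by (cases x) (auto simp: linear_YC linear_B)

lemmas rho_act = poly_act_add poly_act_diff poly_act_mult[OF linear_rho]

lemma id_G: "id \<in> G" using id_W W_G by auto

lemma refl_G: "\<alpha> \<in> Sp \<Longrightarrow> s \<alpha> \<in> G" using refl_W Sp_Rp W_G by blast

lemma m_closed: "\<alpha> \<in> Sp \<Longrightarrow> m \<alpha> \<in> carrier (free_algebra (range Vec \<union> Grp ` G))"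
  using m_form by fastforce

lemma relators_closed: "snd P \<subseteq> carrier (free_algebra (fst P))"
  unfolding P_rels P_gens
  by (auto simp: sym_relators_def group_relators_def cross_relator_def
      id_G comp_G refl_G m_closed subsetD[OF extra_closed] intro!: free_algebra_closed)

lemma rho_relators:
  assumes r: "r \<in> snd P" and f: "f \<in> supported W"
  shows "poly_act \<rho> r f = 0"
proof -
  consider "r \<in> sym_relators" | "r \<in> group_relators G" | "r \<in> extra"
    | \<alpha> \<zeta> where "\<alpha> \<in> Sp" "r = cross_relator \<alpha> (m \<alpha>) \<zeta>"
    using r unfolding P_rels by blast
  then show ?thesis
  proof cases
    case 1
    then consider z z' where "r = vec_symb (z + z') - (vec_symb z + vec_symb z')"
      | c z where "r = vec_symb (cscale c z) - const c * vec_symb z"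
      | z z' where "r = vec_symb z * vec_symb z' - vec_symb z' * vec_symb z"
      unfolding sym_relators_def by blast
    then show ?thesis
      using YC_commute[OF f] by cases (simp_all add: rho_act YC_add YC_cscale del: plus_fun_apply)
  next
    case 2
    then show ?thesis
      using f by (auto simp: group_relators_def rho_act B_comp B_W[OF id_W] T_id)
  next
    case 3
    then show ?thesis using B_extra f by blast
  next
    case 4
    have "s \<alpha> \<in> W" using 4 refl_W Sp_Rp by auto
    then show ?thesis
      using T_Y[OF 4(1) f] by (simp add: 4(2) cross_relator_def rho_act YC_real_vec B_W B_m[OF 4(1) f] del: plus_fun_apply)
  qed
qed

sublocale representation P \<rho> "supported W"
proof
  show "\<rho> x f \<in> supported W" if "x \<in> fst P" "f \<in> supported W" for x f
    using that by (auto simp: P_gens YC_supported B_supported)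
qed (use relators_closed linear_rho csubspace_supported rho_relators in auto)

definition \<omega> :: "'v hecke_gen \<Rightarrow> complex"
  where "\<omega> x = (case x of Vec z \<Rightarrow> \<nu> (fst z) + \<i> * \<nu> (snd z) | Grp g \<Rightarrow> \<mu> g)"

sublocale eigenvector P \<rho> "supported W" "range Vec \<union> Grp ` D" \<omega> id
  by unfold_locales
    (use D_G delta_supported[OF id_W] in \<open>auto simp: P_gens \<omega>_def YC_delta_id B_D\<close>)

lemma group_rel: "\<lbrakk>g \<in> G; h \<in> G\<rbrakk> \<Longrightarrow> cl (grp_symb g * grp_symb h) = cl (grp_symb (g \<circ> h))"
  by (rule cl_eqI) (auto simp: P_rels P_gens group_relators_def comp_G)

lemma group_one: "cl (grp_symb id) = cl 1"
  by (rule cl_eqI) (auto simp: P_rels P_gens group_relators_def id_G)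

lemma vec_real_imag: "cl (vec_symb z) = cl (vec_symb (real_vec (fst z)) + const \<i> * vec_symb (real_vec (snd z)))"
proof -
  let ?x = "real_vec (fst z)" and ?y = "real_vec (snd z)"
  have "vec_symb z - (vec_symb ?x + vec_symb (cscale \<i> ?y)) \<in> snd P"
    using sym_relators_mem(1)[of ?x "cscale \<i> ?y"] by (simp add: P_rels real_vec_def cscale_def)
  then have "cl (vec_symb z) = cl (vec_symb ?x + vec_symb (cscale \<i> ?y))"
    by (rule cl_eqI) (simp_all add: P_gens)
  also have "\<dots> = cl (vec_symb ?x) \<oplus>\<^bsub>\<H>\<^esub> cl (vec_symb (cscale \<i> ?y))"
    by (simp add: P_gens)
  also have "cl (vec_symb (cscale \<i> ?y)) = cl (const \<i> * vec_symb ?y)"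
    by (rule cl_eqI) (simp_all add: P_gens P_rels sym_relators_mem)
  finally show ?thesis by (simp add: P_gens)
qed

lemma cross_rel:
  assumes "\<alpha> \<in> Sp"
  shows "cl (vec_symb (real_vec \<zeta>) * grp_symb (s \<alpha>)) =
    cl (grp_symb (s \<alpha>) * vec_symb (real_vec (s \<alpha> \<zeta>)) - const (of_real (coroot \<alpha> \<zeta>)) * m \<alpha>)"
proof -
  have car: "m \<alpha> \<in> carrier \<F>" "grp_symb (s \<alpha>) \<in> carrier \<F>" "vec_symb z \<in> carrier \<F>" for z
    using m_closed[OF assms] refl_G[OF assms] by (auto simp: P_gens)
  have "cl (grp_symb (s \<alpha>) * vec_symb (real_vec (s \<alpha> \<zeta>))) =
    cl (vec_symb (real_vec \<zeta>) * grp_symb (s \<alpha>) + const (of_real (coroot \<alpha> \<zeta>)) * m \<alpha>)"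
  proof (rule cl_eqI)
    have "cross_relator \<alpha> (m \<alpha>) (s \<alpha> \<zeta>) \<in> snd P" using assms by (auto simp: P_rels)
    then show "grp_symb (s \<alpha>) * vec_symb (real_vec (s \<alpha> \<zeta>)) -
      (vec_symb (real_vec \<zeta>) * grp_symb (s \<alpha>) + const (of_real (coroot \<alpha> \<zeta>)) * m \<alpha>) \<in> snd P"
      by (simp add: cross_relator_def reflection_involution)
  qed (use car in auto)
  then have "cl (grp_symb (s \<alpha>) * vec_symb (real_vec (s \<alpha> \<zeta>))) \<oplus>\<^bsub>\<H>\<^esub> cl (- (const (of_real (coroot \<alpha> \<zeta>)) * m \<alpha>)) =
    cl (vec_symb (real_vec \<zeta>) * grp_symb (s \<alpha>) + const (of_real (coroot \<alpha> \<zeta>)) * m \<alpha>)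
      \<oplus>\<^bsub>\<H>\<^esub> cl (- (const (of_real (coroot \<alpha> \<zeta>)) * m \<alpha>))" by simp
  then show ?thesis using car by simp
qed

text \<open>
  Group elements permute the vectors \<open>t\<^sub>w \<otimes> 1\<close> up to the scalars by which \<open>D\<close> acts on \<open>1 \<otimes> 1\<close>. For
  \<open>\<zeta> \<in> V\<close> the claim follows by induction on \<open>w\<close> along simple reflections: the cross relation expresses \<open>\<zeta> t\<^bsub>s\<^sub>\<alpha>w\<^esub>\<close> by
  \<open>t\<^bsub>s\<^sub>\<alpha>\<^esub> s\<^sub>\<alpha>(\<zeta>) t\<^sub>w\<close> and terms without vectors.
\<close>

lemma spanned:
  assumes \<theta>: "algebra_character \<H> A \<theta>" "\<And>x. x \<in> range Vec \<union> Grp ` D \<Longrightarrow> \<theta> (cl (symb x)) = \<omega> x"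
  shows "spanned_realization P \<rho> W (range Vec \<union> Grp ` D) \<omega> id Grp \<theta>"
proof -
  interpret induced_realization P \<rho> W "range Vec \<union> Grp ` D" \<omega> id Grp \<theta>
    by unfold_locales
      (use \<theta> finite_W id_W W_G group_one in \<open>auto simp: P_gens B_W T_delta\<close>)
  let ?C = "comb ` supported W"
  let ?t = "\<lambda>w. cyc (cl (grp_symb w))"
  have tC: "?t w \<in> ?C" if "w \<in> W" for w
    using comb_delta[OF that] delta_supported[OF that] by (metis image_eqI)
  have scale: "(c \<odot>\<^bsub>\<H>\<^esub> \<one>\<^bsub>\<H>\<^esub>) \<odot>\<^bsub>M\<^esub> x \<in> ?C" if "x \<in> ?C" for c x
    using that csubspaceD(3)[OF csubspace_supported, of _ W c] by (auto simp flip: comb_scale)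
  have add: "x \<oplus>\<^bsub>M\<^esub> y \<in> ?C" if "x \<in> ?C" "y \<in> ?C" for x y
    using that csubspaceD(2)[OF csubspace_supported, of _ W] by (auto simp flip: comb_add)
  have gF: "grp_symb g \<in> carrier \<F>" if "g \<in> G" for g
    using that by (simp add: P_gens)
  have vF: "vec_symb z \<in> carrier \<F>" for z
    by (simp add: P_gens)
  have smult_cl: "cl p \<odot>\<^bsub>M\<^esub> cyc (cl q) = cyc (cl (p * q))" if "p \<in> carrier \<F>" "q \<in> carrier \<F>" for p q
    using that by (simp add: induction.smult_cyc)
  have tG: "?t g \<in> ?C" if "g \<in> G" for g
  proof -
    from G_factor[OF that] consider "g \<in> W" | u y where "u \<in> W" "y \<in> D" "g = u \<circ> y" by blast
    then show ?thesis
    proof cases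
      case 2
      then have uy: "u \<in> G" "y \<in> G" using W_G D_G by auto
      have yA: "cl (grp_symb y) \<in> A"
        unfolding generated_subalgebra_def using 2(2) by (intro generate_ring.incl) auto
      have "?t g = cyc (cl (grp_symb u) \<otimes>\<^bsub>\<H>\<^esub> cl (grp_symb y))"
        using uy by (simp add: 2(3) gF group_rel)
      also have "\<dots> = cyc (cl (grp_symb u) \<otimes>\<^bsub>\<H>\<^esub> (\<theta> (cl (grp_symb y)) \<odot>\<^bsub>\<H>\<^esub> \<one>\<^bsub>\<H>\<^esub>))"
        using uy yA by (intro induction.cyc_character) (simp_all add: gF)
      also have "\<dots> = (\<theta> (cl (grp_symb y)) \<odot>\<^bsub>\<H>\<^esub> \<one>\<^bsub>\<H>\<^esub>) \<odot>\<^bsub>M\<^esub> ?t u"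
        using uy by (simp add: cl_scalar smult_cl gF const_central[of _ "grp_symb u"])
      finally show ?thesis using scale[OF tC[OF 2(1)]] by simp
    qed (rule tC)
  qed
  have grp: "cl (grp_symb g) \<odot>\<^bsub>M\<^esub> ?t w \<in> ?C" if "g \<in> G" "w \<in> W" for g w
    using tG[OF comp_G[OF that(1) subsetD[OF W_G that(2)]]] that W_G
    by (simp add: smult_cl gF group_rel subset_iff)
  have mult_C: "cl p \<odot>\<^bsub>M\<^esub> x \<oplus>\<^bsub>M\<^esub> cl q \<odot>\<^bsub>M\<^esub> x = cl (p + q) \<odot>\<^bsub>M\<^esub> x"
    "cl p \<odot>\<^bsub>M\<^esub> (cl q \<odot>\<^bsub>M\<^esub> x) = cl (p * q) \<odot>\<^bsub>M\<^esub> x"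
    if "p \<in> carrier \<F>" "q \<in> carrier \<F>" "x \<in> carrier M" for p q x
    using that by (auto simp: induction.carrier_M induction.smult_cyc quotient_ops(1) algebra_simps
        simp flip: induction.cyc_add)
  have grpC: "cl (grp_symb g) \<odot>\<^bsub>M\<^esub> x \<in> ?C" if "g \<in> G" "x \<in> ?C" for g x
  proof -
    obtain f where "f \<in> supported W" "x = comb f" using \<open>x \<in> ?C\<close> by blast
    then show ?thesis
      using stable_comb_image[of "Grp g" f] grp that(1) by (simp add: P_gens)
  qed
  have mC: "cl (const c * m \<alpha>) \<odot>\<^bsub>M\<^esub> x \<in> ?C" if "\<alpha> \<in> Sp" "x \<in> ?C" for \<alpha> x c
  proof -
    obtain a d g h where gh: "g \<in> G" "h \<in> G" and m: "m \<alpha> = const a + const d * (grp_symb g * grp_symb h)"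
      using m_form[OF \<open>\<alpha> \<in> Sp\<close>] by blast
    have x: "x \<in> carrier M" using that(2) comb_closed by auto
    have "cl (const c * m \<alpha>) \<odot>\<^bsub>M\<^esub> x = (c \<odot>\<^bsub>\<H>\<^esub> \<one>\<^bsub>\<H>\<^esub>) \<odot>\<^bsub>M\<^esub> ((a \<odot>\<^bsub>\<H>\<^esub> \<one>\<^bsub>\<H>\<^esub>) \<odot>\<^bsub>M\<^esub> x \<oplus>\<^bsub>M\<^esub>
       (d \<odot>\<^bsub>\<H>\<^esub> \<one>\<^bsub>\<H>\<^esub>) \<odot>\<^bsub>M\<^esub> (cl (grp_symb g) \<odot>\<^bsub>M\<^esub> (cl (grp_symb h) \<odot>\<^bsub>M\<^esub> x)))"
      using gh x by (simp add: m cl_scalar mult_C gF)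
    then show ?thesis using scale add grpC gh that(2) by simp
  qed
  have vec_real: "\<forall>\<zeta>. cl (vec_symb (real_vec \<zeta>)) \<odot>\<^bsub>M\<^esub> ?t w \<in> ?C" if "w \<in> W" for w
    using that
  proof (rule simple_induct)
    show "\<forall>\<zeta>. cl (vec_symb (real_vec \<zeta>)) \<odot>\<^bsub>M\<^esub> ?t id \<in> ?C"
    proof
      fix \<zeta>
      let ?v = "cl (vec_symb (real_vec \<zeta>))"
      have vA: "?v \<in> A"
        unfolding generated_subalgebra_def by (intro generate_ring.incl) auto
      have "?v \<odot>\<^bsub>M\<^esub> ?t id = cyc (cl (grp_symb id) \<otimes>\<^bsub>\<H>\<^esub> ?v)"
        by (simp add: group_one smult_cl vF)
      also have "\<dots> = cyc (cl (grp_symb id) \<otimes>\<^bsub>\<H>\<^esub> (\<theta> ?v \<odot>\<^bsub>\<H>\<^esub> \<one>\<^bsub>\<H>\<^esub>))"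
        using vA id_G by (intro induction.cyc_character) (simp_all add: gF)
      also have "\<dots> = (\<theta> ?v \<odot>\<^bsub>\<H>\<^esub> \<one>\<^bsub>\<H>\<^esub>) \<odot>\<^bsub>M\<^esub> ?t id"
        using id_G by (simp add: cl_scalar smult_cl gF const_central[of _ "grp_symb id"])
      finally show "?v \<odot>\<^bsub>M\<^esub> ?t id \<in> ?C" using scale[OF tC[OF id_W]] by simp
    qed
  next
    fix \<alpha> w assume \<alpha>: "\<alpha> \<in> Sp" and w: "w \<in> W"
      and IH: "\<forall>\<zeta>. cl (vec_symb (real_vec \<zeta>)) \<odot>\<^bsub>M\<^esub> ?t w \<in> ?C"
    have sG: "s \<alpha> \<in> G" and wG: "w \<in> G" using refl_G[OF \<alpha>] w W_G by auto
    have mF: "m \<alpha> \<in> carrier \<F>" using m_closed[OF \<alpha>] by (simp add: P_gens)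
    have tw: "?t w \<in> carrier M" using wG by (simp add: gF)
    show "\<forall>\<zeta>. cl (vec_symb (real_vec \<zeta>)) \<odot>\<^bsub>M\<^esub> ?t (s \<alpha> \<circ> w) \<in> ?C"
    proof
      fix \<zeta>
      let ?c = "of_real (coroot \<alpha> \<zeta>) :: complex"
      have "?t (s \<alpha> \<circ> w) = cl (grp_symb (s \<alpha>)) \<odot>\<^bsub>M\<^esub> ?t w"
        using sG wG by (simp add: smult_cl gF group_rel)
      then have "cl (vec_symb (real_vec \<zeta>)) \<odot>\<^bsub>M\<^esub> ?t (s \<alpha> \<circ> w) =
          cl (vec_symb (real_vec \<zeta>) * grp_symb (s \<alpha>)) \<odot>\<^bsub>M\<^esub> ?t w"
        using sG tw by (simp only: mult_C gF vF)
      also have "\<dots> = cl (grp_symb (s \<alpha>) * vec_symb (real_vec (s \<alpha> \<zeta>)) + const (- ?c) * m \<alpha>) \<odot>\<^bsub>M\<^esub> ?t w"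
        by (simp add: cross_rel[OF \<alpha>] const_def single_uminus)
      also have "\<dots> = cl (grp_symb (s \<alpha>)) \<odot>\<^bsub>M\<^esub> (cl (vec_symb (real_vec (s \<alpha> \<zeta>))) \<odot>\<^bsub>M\<^esub> ?t w)
          \<oplus>\<^bsub>M\<^esub> cl (const (- ?c) * m \<alpha>) \<odot>\<^bsub>M\<^esub> ?t w"
        using sG tw mF by (simp add: mult_C gF vF)
      also have "\<dots> \<in> ?C"
        using IH tC[OF w] by (intro add grpC[OF sG] mC[OF \<alpha>]) auto
      finally show "cl (vec_symb (real_vec \<zeta>)) \<odot>\<^bsub>M\<^esub> ?t (s \<alpha> \<circ> w) \<in> ?C" .
    qed
  qed
  have "cl (vec_symb z) \<odot>\<^bsub>M\<^esub> ?t w \<in> ?C" if w: "w \<in> W" for w z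
  proof -
    have tw: "?t w \<in> carrier M" using w W_G by (auto simp: gF)
    have "cl (vec_symb z) \<odot>\<^bsub>M\<^esub> ?t w = cl (vec_symb (real_vec (fst z))) \<odot>\<^bsub>M\<^esub> ?t w \<oplus>\<^bsub>M\<^esub>
      (\<i> \<odot>\<^bsub>\<H>\<^esub> \<one>\<^bsub>\<H>\<^esub>) \<odot>\<^bsub>M\<^esub> (cl (vec_symb (real_vec (snd z))) \<odot>\<^bsub>M\<^esub> ?t w)"
      using tw by (simp only: vec_real_imag[of z] cl_scalar mult_C vF free_algebra_closed)
    also have "\<dots> \<in> ?C" using vec_real[OF w] by (intro add scale) auto
    finally show ?thesis .
  qed
  then show ?thesis
    by unfold_locales (use grp in \<open>auto simp: P_gens\<close>)
qed

end

section \<open>Reflection groups and block permutations\<close>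

lemma BijGroup_UNIV:
  "carrier (BijGroup UNIV) = {f. bij f}" "\<one>\<^bsub>BijGroup UNIV\<^esub> = id"
  "\<lbrakk>bij f; bij g\<rbrakk> \<Longrightarrow> f \<otimes>\<^bsub>BijGroup UNIV\<^esub> g = f \<circ> g"
  by (auto simp: BijGroup_def Bij_def compose_def fun_eq_iff)

lemma inv_BijGroup_reflection:
  "inv\<^bsub>BijGroup UNIV\<^esub> (root_reflection \<alpha>) = root_reflection \<alpha>"
proof -
  interpret group "BijGroup (UNIV :: 'a set)" by (rule group_BijGroup)
  show ?thesis
    by (rule inv_equality) (simp_all add: BijGroup_UNIV bij_reflection reflection_comp_self)
qed

lemma reflection_group_orthogonal:
  "w \<in> reflection_group R \<Longrightarrow> orthogonal_transformation w"
  unfolding reflection_group_def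
proof (induction rule: generate.induct)
  case (eng u w)
  then show ?case
    by (simp only: BijGroup_UNIV orthogonal_transformation_bij orthogonal_transformation_compose)
next
  case one
  show ?case unfolding BijGroup_UNIV by (simp add: orthogonal_transformation_def linear_id)
qed (auto simp: inv_BijGroup_reflection orthogonal_reflection)

lemma reflection_group_bij: "w \<in> reflection_group R \<Longrightarrow> bij w"
  using reflection_group_orthogonal orthogonal_transformation_bij by blast

lemma reflection_group_id: "id \<in> reflection_group R"
  unfolding reflection_group_def by (metis BijGroup_UNIV(2) generate.one)

lemma reflection_group_refl: "\<alpha> \<in> R \<Longrightarrow> root_reflection \<alpha> \<in> reflection_group R"
  unfolding reflection_group_def by (blast intro: generate.incl)

lemma reflection_group_comp:
  "\<lbrakk>u \<in> reflection_group R; w \<in> reflection_group R\<rbrakk> \<Longrightarrow> u \<circ> w \<in> reflection_group R"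
  using BijGroup_UNIV(3)[of u w] reflection_group_bij[of u R] reflection_group_bij[of w R]
    generate.eng[of u "BijGroup UNIV" "root_reflection ` R" w]
  by (simp add: reflection_group_def)

lemma reflection_group_inv:
  assumes "w \<in> reflection_group R"
  shows "inv_into UNIV w \<in> reflection_group R"
  using assms
  unfolding reflection_group_def
proof (induction rule: generate.induct)
  case one
  show ?case
    using reflection_group_id by (simp only: BijGroup_UNIV inv_id reflection_group_def)
next
  case (eng u w)
  have b: "bij u" "bij w" using eng.hyps reflection_group_bij by (auto simp: reflection_group_def)
  then show ?case
    using reflection_group_comp[of "inv_into UNIV w" R "inv_into UNIV u"] eng.IH
    by (simp only: BijGroup_UNIV b o_inv_distrib reflection_group_def)
qed (auto simp: inv_BijGroup_reflection inv_reflection intro: generate.incl)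

text \<open>
  The group closure is closed under arbitrary products, but words in the reflections suffice, because a
  reflection is its own inverse.
\<close>

lemma reflection_group_induct [consumes 1, case_names id step]:
  assumes "w \<in> reflection_group R" "Q id"
    and "\<And>\<alpha> w. \<lbrakk>\<alpha> \<in> R; w \<in> reflection_group R; Q w\<rbrakk> \<Longrightarrow> Q (root_reflection \<alpha> \<circ> w)"
  shows "Q w"
proof -
  have "\<forall>v \<in> reflection_group R. Q v \<longrightarrow> Q (w \<circ> v)"
    using assms(1) unfolding reflection_group_def
  proof (induction rule: generate.induct)
    case (eng u w)
    have b: "bij u" "bij w" "w \<in> reflection_group R"
      using eng.hyps reflection_group_bij by (auto simp: reflection_group_def)
    show ?case
    proof (intro ballI impI)
      fix v assume v: "v \<in> generate (BijGroup UNIV) (root_reflection ` R)" "Q v"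
      then have "Q (w \<circ> v)" using eng.IH by blast
      moreover have "w \<circ> v \<in> generate (BijGroup UNIV) (root_reflection ` R)"
        using reflection_group_comp[OF b(3)] v(1) by (simp add: reflection_group_def)
      ultimately have "Q (u \<circ> (w \<circ> v))" using eng.IH by blast
      then show "Q ((u \<otimes>\<^bsub>BijGroup UNIV\<^esub> w) \<circ> v)" using b by (simp add: BijGroup_UNIV o_assoc)
    qed
  qed (use assms(3) in \<open>auto simp: BijGroup_UNIV inv_BijGroup_reflection reflection_group_def simp del: o_apply id_apply\<close>)
  then have "Q (w \<circ> id)" using assms(2) reflection_group_id by blast
  then show ?thesis by simp
qed

lemma reflection_group_subset:
  assumes "\<And>\<alpha>. \<alpha> \<in> R \<Longrightarrow> root_reflection \<alpha> \<in> reflection_group R'"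
  shows "reflection_group R \<subseteq> reflection_group R'"
proof
  fix w assume "w \<in> reflection_group R"
  then show "w \<in> reflection_group R'"
    by (induction rule: reflection_group_induct) (blast intro: reflection_group_id reflection_group_comp assms)+
qed

lemma reflection_apply_conjugate:
  assumes "orthogonal_transformation w" "bij w"
  shows "root_reflection (w \<alpha>) = w \<circ> root_reflection \<alpha> \<circ> inv_into UNIV w"
proof
  fix x
  have "x = w (inv_into UNIV w x)" using assms(2) by (simp add: bij_is_surj surj_f_inv_f)
  then show "root_reflection (w \<alpha>) x = (w \<circ> root_reflection \<alpha> \<circ> inv_into UNIV w) x"
    using reflection_conjugate[OF assms(1), of \<alpha> "inv_into UNIV w x"] by simp
qed

locale orthonormal_frame =
  fixes n :: nat and \<epsilon> :: "nat \<Rightarrow> 'v::euclidean_space"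
  assumes frame: "orthonormal_basis n \<epsilon>"
begin

abbreviation "s \<equiv> root_reflection"
abbreviation "iv \<equiv> inv_into (UNIV :: 'v set)"
abbreviation "tr \<equiv> Transposition.transpose"

text \<open>
  The case \<open>i = n\<close> is the positive system of type \<open>A\<close>; in general only pairs of indices that lie on the
  same side of \<open>i\<close> are joined by a root.
\<close>

definition pos_roots :: "nat \<Rightarrow> 'v set"
  where "pos_roots i = {\<epsilon> p - \<epsilon> q | p q. 1 \<le> p \<and> p < q \<and> q \<le> n \<and> (p \<le> i \<longleftrightarrow> q \<le> i)}"

definition simple_roots :: "nat \<Rightarrow> 'v set"
  where "simple_roots i = {simple_root \<epsilon> p | p. p \<in> {1..n - 1} \<and> p \<noteq> i}"

definition block_perm :: "nat \<Rightarrow> ('v \<Rightarrow> 'v) \<Rightarrow> (nat \<Rightarrow> nat) \<Rightarrow> bool"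
  where "block_perm i w \<pi> \<longleftrightarrow> linear w \<and> bij_betw \<pi> {1..n} {1..n} \<and>
    (\<forall>p \<in> {1..n}. w (\<epsilon> p) = \<epsilon> (\<pi> p) \<and> (\<pi> p \<le> i \<longleftrightarrow> p \<le> i))"

abbreviation "WG i \<equiv> reflection_group (pos_roots i)"

lemma inner_eps [simp]: "\<lbrakk>p \<in> {1..n}; q \<in> {1..n}\<rbrakk> \<Longrightarrow> \<epsilon> p \<bullet> \<epsilon> q = (if p = q then 1 else 0)"
  using frame by (simp add: orthonormal_basis_def)

lemma eps_inj: "\<lbrakk>p \<in> {1..n}; q \<in> {1..n}; \<epsilon> p = \<epsilon> q\<rbrakk> \<Longrightarrow> p = q"
  using inner_eps[of p q] inner_eps[of p p] by (auto split: if_splits)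

lemma linear_eqI:
  assumes "linear f" "linear g" "\<And>p. p \<in> {1..n} \<Longrightarrow> f (\<epsilon> p) = g (\<epsilon> p)"
  shows "f = (g :: 'v \<Rightarrow> 'b::real_vector)"
proof
  fix x
  have "x \<in> span (\<epsilon> ` {1..n})" using frame by (simp add: orthonormal_basis_def)
  then show "f x = g x"
    by (rule linear_eq_on[OF assms(1,2)]) (use assms(3) in auto)
qed

lemma reflection_eps:
  assumes "p \<in> {1..n}" "q \<in> {1..n}" "p \<noteq> q" "r \<in> {1..n}"
  shows "s (\<epsilon> p - \<epsilon> q) (\<epsilon> r) = \<epsilon> (tr p q r)"
  using assms
  by (simp add: root_reflection_def coroot_def inner_diff_left inner_diff_right Transposition.transpose_def)

lemma pos_rootsE:
  assumes "\<alpha> \<in> pos_roots i"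
  obtains p q where "\<alpha> = \<epsilon> p - \<epsilon> q" "p \<in> {1..n}" "q \<in> {1..n}" "p < q" "p \<le> i \<longleftrightarrow> q \<le> i"
  using assms by (force simp: pos_roots_def)

lemma pos_rootsI:
  "\<lbrakk>p \<in> {1..n}; q \<in> {1..n}; p < q; p \<le> i \<longleftrightarrow> q \<le> i\<rbrakk> \<Longrightarrow> \<epsilon> p - \<epsilon> q \<in> pos_roots i"
  by (auto simp: pos_roots_def)

lemma pos_roots_diff_iff:
  assumes "p \<in> {1..n}" "q \<in> {1..n}"
  shows "\<epsilon> p - \<epsilon> q \<in> pos_roots i \<longleftrightarrow> p < q \<and> (p \<le> i \<longleftrightarrow> q \<le> i)"
proof
  assume "\<epsilon> p - \<epsilon> q \<in> pos_roots i"
  then obtain p' q' where *: "\<epsilon> p - \<epsilon> q = \<epsilon> p' - \<epsilon> q'" "p' \<in> {1..n}" "q' \<in> {1..n}" "p' < q'" "p' \<le> i \<longleftrightarrow> q' \<le> i"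
    by (rule pos_rootsE)
  have ip: "(\<epsilon> p - \<epsilon> q) \<bullet> \<epsilon> p' = 1" "(\<epsilon> p - \<epsilon> q) \<bullet> \<epsilon> q' = -1"
    using * by (simp_all only: *(1)) (simp_all add: inner_diff_left)
  have "p = p'" "q = q'"
    using ip assms *(2,3,4) by (auto simp: inner_diff_left split: if_splits)
  then show "p < q \<and> (p \<le> i \<longleftrightarrow> q \<le> i)" using * by simp
qed (use assms pos_rootsI in auto)

lemma block_perm_id: "block_perm i id id"
  by (simp add: block_perm_def linear_id)

lemma block_perm_comp:
  assumes "block_perm i u \<pi>" "block_perm i w \<tau>"
  shows "block_perm i (u \<circ> w) (\<pi> \<circ> \<tau>)"
proof -
  have "\<tau> p \<in> {1..n}" if "p \<in> {1..n}" for p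
    using assms(2) that by (auto simp: block_perm_def dest: bij_betwE)
  then show ?thesis
    using assms linear_compose bij_betw_trans by (auto simp: block_perm_def) blast+
qed

lemma bij_betw_tr: "\<lbrakk>p \<in> {1..n}; q \<in> {1..n}\<rbrakk> \<Longrightarrow> bij_betw (tr p q) {1..n} {1..n}"
  by (rule bij_betw_byWitness[where f' = "tr p q"]) (auto simp: Transposition.transpose_def)

lemma block_perm_reflection:
  assumes "p \<in> {1..n}" "q \<in> {1..n}" "p \<noteq> q" "p \<le> i \<longleftrightarrow> q \<le> i"
  shows "block_perm i (s (\<epsilon> p - \<epsilon> q)) (tr p q)"
  unfolding block_perm_def
  using bij_betw_tr[OF assms(1,2)] assms
  by (auto simp: linear_reflection reflection_eps Transposition.transpose_def)

lemma reflection_mem: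
  assumes "p \<in> {1..n}" "q \<in> {1..n}" "p \<noteq> q" "p \<le> i \<longleftrightarrow> q \<le> i"
  shows "s (\<epsilon> p - \<epsilon> q) \<in> WG i"
proof (cases "p < q")
  case False
  then have "\<epsilon> q - \<epsilon> p \<in> pos_roots i" using assms by (intro pos_rootsI) auto
  then have "s (- (\<epsilon> p - \<epsilon> q)) \<in> WG i" by (simp add: reflection_group_refl)
  then show ?thesis by (simp only: root_reflection_uminus)
next
  case True
  then show ?thesis using assms by (intro reflection_group_refl pos_rootsI)
qed

lemma WG_block_perm: "w \<in> WG i \<Longrightarrow> \<exists>\<pi>. block_perm i w \<pi>"
proof (induction rule: reflection_group_induct)
  case id
  then show ?case using block_perm_id by blast
next
  case (step \<alpha> w)
  then obtain p q \<pi> where "\<alpha> = \<epsilon> p - \<epsilon> q" "p \<in> {1..n}" "q \<in> {1..n}" "p < q" "p \<le> i \<longleftrightarrow> q \<le> i" "block_perm i w \<pi>"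
    by (metis pos_rootsE)
  then show ?case using block_perm_comp[OF block_perm_reflection] by blast
qed

text \<open>
  If \<open>w\<close> moves \<open>\<epsilon> r\<close> to \<open>\<epsilon> (\<pi> r)\<close>, then composing with the reflection that exchanges these two vectors fixes
  \<open>\<epsilon> r\<close> and every basis vector that was fixed before. This reflection belongs to the group because \<open>r\<close> and
  \<open>\<pi> r\<close> lie in the same block.
\<close>

lemma block_perm_WG: "block_perm i w \<pi> \<Longrightarrow> w \<in> WG i"
proof (induction "card {r \<in> {1..n}. w (\<epsilon> r) \<noteq> \<epsilon> r}" arbitrary: w \<pi> rule: less_induct)
  case less
  have w: "linear w" "bij_betw \<pi> {1..n} {1..n}" "\<And>p. p \<in> {1..n} \<Longrightarrow> w (\<epsilon> p) = \<epsilon> (\<pi> p)"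
    "\<And>p. p \<in> {1..n} \<Longrightarrow> \<pi> p \<le> i \<longleftrightarrow> p \<le> i"
    using less.prems by (auto simp: block_perm_def)
  have \<pi>: "\<pi> p \<in> {1..n}" if "p \<in> {1..n}" for p using w(2) that by (auto dest: bij_betwE)
  show ?case
  proof (cases "\<exists>r \<in> {1..n}. w (\<epsilon> r) \<noteq> \<epsilon> r")
    case False
    then have "w = id" by (intro linear_eqI w linear_id) auto
    then show ?thesis by (simp add: reflection_group_id)
  next
    case True
    then obtain r where r: "r \<in> {1..n}" "w (\<epsilon> r) \<noteq> \<epsilon> r" by blast
    have ne: "r \<noteq> \<pi> r" using r w(3) by auto
    let ?t = "s (\<epsilon> r - \<epsilon> (\<pi> r))"
    have t: "block_perm i ?t (tr r (\<pi> r))" "?t \<in> WG i"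
      using block_perm_reflection reflection_mem r(1) \<pi>[OF r(1)] ne w(4)[OF r(1)] by auto
    have val: "(?t \<circ> w) (\<epsilon> x) = \<epsilon> (tr r (\<pi> r) (\<pi> x))" if "x \<in> {1..n}" for x
      using reflection_eps[OF r(1) \<pi>[OF r(1)] ne \<pi>[OF that]] w(3)[OF that] by simp
    have "{x \<in> {1..n}. (?t \<circ> w) (\<epsilon> x) \<noteq> \<epsilon> x} \<subset> {x \<in> {1..n}. w (\<epsilon> x) \<noteq> \<epsilon> x}"
    proof
      show "{x \<in> {1..n}. (?t \<circ> w) (\<epsilon> x) \<noteq> \<epsilon> x} \<subseteq> {x \<in> {1..n}. w (\<epsilon> x) \<noteq> \<epsilon> x}"
      proof safe
        fix x assume x: "x \<in> {1..n}" "w (\<epsilon> x) = \<epsilon> x" "(?t \<circ> w) (\<epsilon> x) \<noteq> \<epsilon> x"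
        have px: "\<pi> x = x" using eps_inj[OF \<pi>[OF x(1)] x(1)] w(3)[OF x(1)] x(2) by simp
        have "x \<noteq> r" using px ne by auto
        moreover have "x \<noteq> \<pi> r"
        proof
          assume "x = \<pi> r"
          then have "\<pi> x = \<pi> r" using px by simp
          then show False
            using inj_onD[OF bij_betw_imp_inj_on[OF w(2)] _ x(1) r(1)] \<open>x \<noteq> r\<close> by blast
        qed
        ultimately show False using x(3) val[OF x(1)] px by (simp add: Transposition.transpose_def)
      qed
      show "{x \<in> {1..n}. (?t \<circ> w) (\<epsilon> x) \<noteq> \<epsilon> x} \<noteq> {x \<in> {1..n}. w (\<epsilon> x) \<noteq> \<epsilon> x}"
        using r val[OF r(1)] by (auto simp: Transposition.transpose_def)
    qed
    then have "card {x \<in> {1..n}. (?t \<circ> w) (\<epsilon> x) \<noteq> \<epsilon> x} < card {x \<in> {1..n}. w (\<epsilon> x) \<noteq> \<epsilon> x}"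
      by (intro psubset_card_mono) auto
    then have "?t \<circ> w \<in> WG i"
      using less.hyps block_perm_comp[OF t(1) less.prems] by blast
    then have "?t \<circ> (?t \<circ> w) \<in> WG i" by (rule reflection_group_comp[OF t(2)])
    then show ?thesis by (simp add: o_assoc reflection_comp_self)
  qed
qed

lemma WG_iff: "w \<in> WG i \<longleftrightarrow> (\<exists>\<pi>. block_perm i w \<pi>)"
  using WG_block_perm block_perm_WG by blast

text \<open>
  An element is determined by the images of the basis vectors, which are again basis vectors.
\<close>

lemma finite_WG: "finite (WG i)"
proof (rule inj_on_finite)
  show "inj_on (\<lambda>w. restrict (\<lambda>p. w (\<epsilon> p)) {1..n}) (WG i)"
  proof
    fix u w assume uw: "u \<in> WG i" "w \<in> WG i"
      "restrict (\<lambda>p. u (\<epsilon> p)) {1..n} = restrict (\<lambda>p. w (\<epsilon> p)) {1..n}"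
    then have "u (\<epsilon> p) = w (\<epsilon> p)" if "p \<in> {1..n}" for p using that by (metis restrict_apply')
    then show "u = w"
      using uw(1,2) by (intro linear_eqI) (auto simp: WG_iff block_perm_def)
  qed
  show "(\<lambda>w. restrict (\<lambda>p. w (\<epsilon> p)) {1..n}) ` WG i \<subseteq> {1..n} \<rightarrow>\<^sub>E \<epsilon> ` {1..n}"
  proof clarify
    fix w assume "w \<in> WG i"
    then obtain \<pi> where "block_perm i w \<pi>" using WG_iff by blast
    then show "restrict (\<lambda>p. w (\<epsilon> p)) {1..n} \<in> {1..n} \<rightarrow>\<^sub>E \<epsilon> ` {1..n}"
      by (auto simp: block_perm_def dest: bij_betwE)
  qed
qed (auto intro: finite_PiE)

lemma finite_pos_roots: "finite (pos_roots i)"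
proof (rule finite_subset)
  show "pos_roots i \<subseteq> (\<lambda>(p, q). \<epsilon> p - \<epsilon> q) ` ({1..n} \<times> {1..n})"
    by (auto simp: pos_roots_def intro!: image_eqI[of _ _ "(_, _)"])
qed auto

lemma pos_roots_uminus: "\<alpha> \<in> pos_roots i \<Longrightarrow> - \<alpha> \<notin> pos_roots i"
  by (erule pos_rootsE) (auto simp: pos_roots_diff_iff)

lemma WG_pos_roots:
  assumes "w \<in> WG i" "\<alpha> \<in> pos_roots i"
  shows "w \<alpha> \<in> pos_roots i \<or> - w \<alpha> \<in> pos_roots i"
proof -
  obtain p q where pq: "\<alpha> = \<epsilon> p - \<epsilon> q" "p \<in> {1..n}" "q \<in> {1..n}" "p < q" "p \<le> i \<longleftrightarrow> q \<le> i"
    using assms(2) by (rule pos_rootsE)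
  obtain \<pi> where \<pi>: "linear w" "bij_betw \<pi> {1..n} {1..n}" "\<And>p. p \<in> {1..n} \<Longrightarrow> w (\<epsilon> p) = \<epsilon> (\<pi> p)"
    "\<And>p. p \<in> {1..n} \<Longrightarrow> \<pi> p \<le> i \<longleftrightarrow> p \<le> i"
    using assms(1) by (auto simp: WG_iff block_perm_def)
  have "\<pi> p \<in> {1..n}" "\<pi> q \<in> {1..n}"
    using bij_betwE[OF \<pi>(2)] pq by blast+
  moreover have "\<pi> p \<noteq> \<pi> q"
    using inj_onD[OF bij_betw_imp_inj_on[OF \<pi>(2)], of p q] pq by blast
  ultimately show ?thesis
    using pq \<pi> by (auto simp: linear_diff pos_roots_diff_iff)
qed

lemma simple_roots_pos: "simple_roots i \<subseteq> pos_roots i"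
  by (auto simp: simple_roots_def simple_root_def intro!: pos_rootsI)

lemma simple_reflection_pos:
  assumes "\<alpha> \<in> simple_roots i" "\<beta> \<in> pos_roots i" "\<beta> \<noteq> \<alpha>"
  shows "s \<alpha> \<beta> \<in> pos_roots i"
proof -
  obtain p where p: "\<alpha> = \<epsilon> p - \<epsilon> (p + 1)" "p \<in> {1..n - 1}" "p \<noteq> i"
    using assms(1) by (auto simp: simple_roots_def simple_root_def)
  obtain a b where ab: "\<beta> = \<epsilon> a - \<epsilon> b" "a \<in> {1..n}" "b \<in> {1..n}" "a < b" "a \<le> i \<longleftrightarrow> b \<le> i"
    using assms(2) by (rule pos_rootsE)
  have p': "p \<in> {1..n}" "p + 1 \<in> {1..n}" using p by auto
  have "s \<alpha> \<beta> = \<epsilon> (tr p (p + 1) a) - \<epsilon> (tr p (p + 1) b)"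
    using ab p p' by (simp add: linear_diff[OF linear_reflection] reflection_eps)
  moreover have "\<not> (a = p \<and> b = p + 1)" using assms(3) p ab by auto
  then have "tr p (p + 1) a < tr p (p + 1) b" using ab(4) by (auto simp: Transposition.transpose_def)
  moreover have "tr p (p + 1) c \<le> i \<longleftrightarrow> c \<le> i" for c
    using p(3) by (auto simp: Transposition.transpose_def)
  moreover have "tr p (p + 1) c \<in> {1..n}" if "c \<in> {1..n}" for c
    using p' that by (auto simp: Transposition.transpose_def)
  ultimately show ?thesis
    using ab by (simp only: pos_roots_diff_iff) 
qed

text \<open>
  The reflection that exchanges \<open>p\<close> and \<open>q + 1\<close> is the conjugate of the one that exchanges \<open>p\<close> and \<open>q\<close> by the
  simple reflection exchanging \<open>q\<close> and \<open>q + 1\<close>.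
\<close>

lemma WG_simple: "WG i = reflection_group (simple_roots i)"
proof
  show "reflection_group (simple_roots i) \<subseteq> WG i"
    by (rule reflection_group_subset) (use simple_roots_pos reflection_group_refl in auto)
  let ?W = "reflection_group (simple_roots i)"
  have *: "s (\<epsilon> p - \<epsilon> (p + d + 1)) \<in> ?W" if "p \<in> {1..n}" "p + d + 1 \<in> {1..n}" "p \<le> i \<longleftrightarrow> p + d + 1 \<le> i" for p d
    using that
  proof (induction d)
    case 0
    then show ?case
      by (intro reflection_group_refl) (auto simp: simple_roots_def simple_root_def)
  next
    case (Suc d)
    let ?q = "p + d + 1"
    let ?t = "s (\<epsilon> ?q - \<epsilon> (?q + 1))"
    have q: "?q \<in> {1..n}" "?q + 1 \<in> {1..n}" using Suc.prems by auto
    have "?t \<in> ?W"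
      using Suc.prems by (intro reflection_group_refl) (auto simp: simple_roots_def simple_root_def)
    moreover have "s (\<epsilon> p - \<epsilon> ?q) \<in> ?W" using Suc by auto
    moreover have "?t (\<epsilon> p - \<epsilon> ?q) = \<epsilon> p - \<epsilon> (p + Suc d + 1)"
      using q Suc.prems by (simp add: linear_diff[OF linear_reflection] reflection_eps Transposition.transpose_def)
    then have "s (\<epsilon> p - \<epsilon> (p + Suc d + 1)) = ?t \<circ> s (\<epsilon> p - \<epsilon> ?q) \<circ> ?t"
      using reflection_apply_conjugate[OF orthogonal_reflection bij_reflection]
      by (metis inv_reflection)
    ultimately show ?case by (simp only: reflection_group_comp)
  qed
  show "WG i \<subseteq> ?W"
  proof (rule reflection_group_subset)
    fix \<alpha> assume "\<alpha> \<in> pos_roots i"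
    then obtain p q where "\<alpha> = \<epsilon> p - \<epsilon> q" "p \<in> {1..n}" "q \<in> {1..n}" "p < q" "p \<le> i \<longleftrightarrow> q \<le> i"
      by (rule pos_rootsE)
    then show "s \<alpha> \<in> ?W" using *[of p "q - p - 1"] by simp
  qed
qed

end

lemma (in orthonormal_frame) weyl_A_eq: "weyl_A n \<epsilon> = WG n"
proof
  show "weyl_A n \<epsilon> \<subseteq> WG n"
    unfolding weyl_A_def by (rule reflection_group_subset) (auto simp: roots_A_def intro!: reflection_mem)
  show "WG n \<subseteq> weyl_A n \<epsilon>"
    unfolding weyl_A_def
  proof (rule reflection_group_subset, rule reflection_group_refl)
    fix \<alpha> assume "\<alpha> \<in> pos_roots n"
    then obtain p q where "\<alpha> = \<epsilon> p - \<epsilon> q" "p \<in> {1..n}" "q \<in> {1..n}" "p < q" by (rule pos_rootsE)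
    then show "\<alpha> \<in> roots_A n \<epsilon>" unfolding roots_A_def by blast
  qed
qed

lemma (in orthonormal_frame) roots_split_eq:
  assumes "i \<le> n"
  shows "reflection_group (roots_split n i \<epsilon>) = WG i"
proof
  show "reflection_group (roots_split n i \<epsilon>) \<subseteq> WG i"
  proof (rule reflection_group_subset)
    fix \<alpha> assume "\<alpha> \<in> roots_split n i \<epsilon>"
    then obtain a p q where a: "a \<in> {1, -1 :: real}" "\<alpha> = a *\<^sub>R (\<epsilon> p - \<epsilon> q)"
      and pq: "1 \<le> p \<and> p < q \<and> q \<le> i \<or> i < p \<and> p < q \<and> q \<le> n"
      unfolding roots_split_def by blast
    have "s (\<epsilon> p - \<epsilon> q) \<in> WG i" using pq assms by (intro reflection_mem) auto
    moreover have "s \<alpha> = s (\<epsilon> p - \<epsilon> q)" 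
      using a root_reflection_uminus[of "\<epsilon> p - \<epsilon> q"] by auto
    ultimately show "s \<alpha> \<in> WG i" by simp
  qed
  show "WG i \<subseteq> reflection_group (roots_split n i \<epsilon>)"
  proof (rule reflection_group_subset, rule reflection_group_refl)
    fix \<alpha> assume "\<alpha> \<in> pos_roots i"
    then obtain p q where "\<alpha> = \<epsilon> p - \<epsilon> q" "p \<in> {1..n}" "q \<in> {1..n}" "p < q" "p \<le> i \<longleftrightarrow> q \<le> i"
      by (rule pos_rootsE)
    then show "\<alpha> \<in> roots_split n i \<epsilon>"
      unfolding roots_split_def using assms
      by (intro CollectI exI[of _ 1] exI[of _ p] exI[of _ q]) auto
  qed
qed

lemma (in orthonormal_frame) WG_simple_induct:
  assumes "w \<in> WG i" "Q id"
    "\<And>\<alpha> w. \<lbrakk>\<alpha> \<in> simple_roots i; w \<in> WG i; Q w\<rbrakk> \<Longrightarrow> Q (s \<alpha> \<circ> w)"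
  shows "Q w"
  using assms(1) unfolding WG_simple
proof (induction rule: reflection_group_induct)
  case (step \<alpha> w)
  then show ?case by (intro assms(3)) (simp_all only: WG_simple)
qed (rule assms(2))

lemma (in orthonormal_frame) hecke_data_blocks:
  assumes "\<And>\<alpha>. \<kappa> (- \<alpha>) = \<kappa> \<alpha>" "linear \<nu>"
    and "\<And>\<alpha> \<beta>. \<lbrakk>\<alpha> \<in> pos_roots i; \<beta> \<in> pos_roots i; \<kappa> \<beta> \<noteq> 0\<rbrakk> \<Longrightarrow> \<kappa> (s \<beta> \<alpha>) = \<kappa> \<alpha>"
  shows "hecke_data (WG i) (pos_roots i) (simple_roots i) \<kappa> \<nu>"
proof (rule hecke_data.intro)
  show "u \<circ> w \<in> WG i" if "u \<in> WG i" "w \<in> WG i" for u w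
    using that by (rule reflection_group_comp)
  show "w \<alpha> \<in> pos_roots i \<or> - w \<alpha> \<in> pos_roots i" if "w \<in> WG i" "\<alpha> \<in> pos_roots i" for w \<alpha>
    using that by (rule WG_pos_roots)
  show "\<kappa> (s \<beta> \<alpha>) = \<kappa> \<alpha>" if "\<alpha> \<in> pos_roots i" "\<beta> \<in> pos_roots i" "\<kappa> \<beta> \<noteq> 0" for \<alpha> \<beta>
    using that by (rule assms(3))
  show "s \<alpha> \<beta> \<in> pos_roots i" if "\<alpha> \<in> simple_roots i" "\<beta> \<in> pos_roots i" "\<beta> \<noteq> \<alpha>" for \<alpha> \<beta>
    using that by (rule simple_reflection_pos)
  show "iv w \<in> WG i" "orthogonal_transformation w" if "w \<in> WG i" for w
    using that by (rule reflection_group_inv, rule reflection_group_orthogonal)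
  show "- \<alpha> \<notin> pos_roots i" "s \<alpha> \<in> WG i" if "\<alpha> \<in> pos_roots i" for \<alpha>
    using that by (rule pos_roots_uminus, rule reflection_group_refl)
  show "finite (WG i)" by (rule finite_WG)
  show "finite (pos_roots i)" by (rule finite_pos_roots)
  show "simple_roots i \<subseteq> pos_roots i" by (rule simple_roots_pos)
  show "id \<in> WG i" by (rule reflection_group_id)
  show "\<kappa> (- \<alpha>) = \<kappa> \<alpha>" for \<alpha> by (rule assms(1))
  show "linear \<nu>" by (rule assms(2))
qed (erule WG_simple_induct, assumption, blast)

section \<open>The Weyl group of type B as a semidirect product\<close>

locale type_B = orthonormal_frame n \<epsilon> for n and \<epsilon> :: "nat \<Rightarrow> 'v::euclidean_space" +
  fixes k :: complex and \<gamma> :: "'v cpx \<Rightarrow> complex" and \<mu> :: "('v \<Rightarrow> 'v) \<Rightarrow> complex"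
  assumes sign_char: "sign_character n \<epsilon> \<mu>" and functional: "complex_functional \<gamma>"
begin

abbreviation "TT \<equiv> sign_group n \<epsilon>"
abbreviation "WA \<equiv> WG n"
abbreviation "WB \<equiv> weyl_B n \<epsilon>"
abbreviation "\<mu>t p \<equiv> \<mu> (s (\<epsilon> p))"

lemma mu_id: "\<mu> id = 1" and mu_comp: "\<lbrakk>x \<in> TT; y \<in> TT\<rbrakk> \<Longrightarrow> \<mu> (x \<circ> y) = \<mu> x * \<mu> y"
  using sign_char by (auto simp: sign_character_def)

lemmas TT_refl = reflection_group_refl[where R = "\<epsilon> ` {1..n}", folded sign_group_def]
lemmas TT_id = reflection_group_id[where R = "\<epsilon> ` {1..n}", folded sign_group_def]
lemmas TT_comp = reflection_group_comp[where R = "\<epsilon> ` {1..n}", folded sign_group_def]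
lemmas TT_inv = reflection_group_inv[where R = "\<epsilon> ` {1..n}", folded sign_group_def]
lemmas TT_bij = reflection_group_bij[where R = "\<epsilon> ` {1..n}", folded sign_group_def]
lemmas TT_induct = reflection_group_induct[where R = "\<epsilon> ` {1..n}", folded sign_group_def, consumes 1, case_names id step]

lemma t_mem: "p \<in> {1..n} \<Longrightarrow> s (\<epsilon> p) \<in> TT"
  by (intro TT_refl) auto

lemma mu_t: "p \<in> {1..n} \<Longrightarrow> \<mu>t p = 1 \<or> \<mu>t p = -1"
  using mu_comp[OF t_mem t_mem, of p p] by (simp only: reflection_comp_self mu_id) (simp add: square_eq_1_iff)

lemma t_eps: "\<lbrakk>p \<in> {1..n}; r \<in> {1..n}\<rbrakk> \<Longrightarrow> s (\<epsilon> p) (\<epsilon> r) = (if r = p then - \<epsilon> p else \<epsilon> r)"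
  by (simp add: root_reflection_def coroot_def scaleR_2)

lemma TT_diag: "x \<in> TT \<Longrightarrow> \<forall>p \<in> {1..n}. x (\<epsilon> p) = \<epsilon> p \<or> x (\<epsilon> p) = - \<epsilon> p"
proof (induction rule: TT_induct)
  case (step \<alpha> w)
  then obtain l where l: "\<alpha> = \<epsilon> l" "l \<in> {1..n}" by blast
  show ?case
  proof
    fix p assume p: "p \<in> {1..n}"
    then have "w (\<epsilon> p) = \<epsilon> p \<or> w (\<epsilon> p) = - \<epsilon> p" using step.IH by blast
    then show "(s \<alpha> \<circ> w) (\<epsilon> p) = \<epsilon> p \<or> (s \<alpha> \<circ> w) (\<epsilon> p) = - \<epsilon> p"
      using t_eps[OF l(2) p] by (auto simp: l(1) linear_neg[OF linear_reflection])
  qed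
qed simp

lemma WAE:
  assumes "w \<in> WA"
  obtains \<pi> where "linear w" "bij_betw \<pi> {1..n} {1..n}" "\<And>p. p \<in> {1..n} \<Longrightarrow> \<pi> p \<in> {1..n}"
    "\<And>p. p \<in> {1..n} \<Longrightarrow> w (\<epsilon> p) = \<epsilon> (\<pi> p)"
proof -
  from assms obtain \<pi> where "block_perm n w \<pi>" using WG_iff by blast
  then show thesis
    by (intro that[of \<pi>]) (auto simp: block_perm_def dest: bij_betwE)
qed

text \<open>
  An element of the sign group multiplies each basis vector by a sign, and an element of \<open>W\<^sub>A\<close> permutes
  the basis vectors.
\<close>

lemma TT_WA: "\<lbrakk>x \<in> TT; x \<in> WA\<rbrakk> \<Longrightarrow> x = id"
proof -
  assume x: "x \<in> TT" "x \<in> WA"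
  from x(2) obtain \<pi> where \<pi>: "linear x" "\<And>p. p \<in> {1..n} \<Longrightarrow> \<pi> p \<in> {1..n}"
    "\<And>p. p \<in> {1..n} \<Longrightarrow> x (\<epsilon> p) = \<epsilon> (\<pi> p)" by (rule WAE) blast
  show "x = id"
  proof (rule linear_eqI[OF \<pi>(1) linear_id])
    fix p assume p: "p \<in> {1..n}"
    have "\<epsilon> (\<pi> p) \<noteq> - \<epsilon> p"
    proof
      assume "\<epsilon> (\<pi> p) = - \<epsilon> p"
      then have "\<epsilon> (\<pi> p) \<bullet> \<epsilon> p = -1" using p by simp
      then show False using p \<pi>(2)[OF p] by (simp split: if_splits)
    qed
    then show "x (\<epsilon> p) = id (\<epsilon> p)" using TT_diag[OF x(1)] p \<pi>(3) by auto
  qed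
qed

lemma conj_t:
  assumes "w \<in> WA" "p \<in> {1..n}" "q \<in> {1..n}" "w (\<epsilon> p) = \<epsilon> q"
  shows "w \<circ> s (\<epsilon> p) \<circ> iv w = s (\<epsilon> q)" "iv w \<circ> s (\<epsilon> q) \<circ> w = s (\<epsilon> p)"
proof -
  have w: "orthogonal_transformation w" "bij w" "orthogonal_transformation (iv w)" "bij (iv w)"
    using assms(1) reflection_group_inv reflection_group_orthogonal reflection_group_bij by blast+
  show "w \<circ> s (\<epsilon> p) \<circ> iv w = s (\<epsilon> q)"
    using reflection_apply_conjugate[OF w(1,2), of "\<epsilon> p"] assms(4) by simp
  have "iv w (\<epsilon> q) = \<epsilon> p" using assms(4) w(2) by (metis bij_inv_eq_iff)
  then show "iv w \<circ> s (\<epsilon> q) \<circ> w = s (\<epsilon> p)"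
    using reflection_apply_conjugate[OF w(3,4), of "\<epsilon> q"] w(2) by (simp only: inv_inv_eq)
qed

lemma conj_comp: "bij w \<Longrightarrow> w \<circ> (x \<circ> y) \<circ> iv w = (w \<circ> x \<circ> iv w) \<circ> (w \<circ> y \<circ> iv w)"
  by (auto simp: fun_eq_iff bij_is_inj inv_f_f)

lemma conj_TT:
  assumes w: "w \<in> WA" and "x \<in> TT"
  shows "w \<circ> x \<circ> iv w \<in> TT"
  using assms(2)
proof (induction rule: TT_induct)
  case id
  have "w \<circ> id \<circ> iv w = id" using surj_iff[THEN iffD1, OF bij_is_surj[OF reflection_group_bij[OF w]]] by (simp only: comp_id)
  then show ?case using TT_id by (simp only:)
next
  case (step \<alpha> x)
  then obtain p where p: "\<alpha> = \<epsilon> p" "p \<in> {1..n}" by blast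
  obtain \<pi> where \<pi>: "\<And>p. p \<in> {1..n} \<Longrightarrow> \<pi> p \<in> {1..n}" "\<And>p. p \<in> {1..n} \<Longrightarrow> w (\<epsilon> p) = \<epsilon> (\<pi> p)"
    using w by (rule WAE) blast
  have "w \<circ> s \<alpha> \<circ> iv w \<in> TT"
    using conj_t(1)[OF w p(2) \<pi>(1)[OF p(2)] \<pi>(2)[OF p(2)]] t_mem[OF \<pi>(1)[OF p(2)]] p by simp
  then show ?case
    unfolding conj_comp[OF reflection_group_bij[OF w]] using step.IH by (rule TT_comp)
qed

lemma conj_TT': 
  assumes "w \<in> WA" "x \<in> TT"
  shows "iv w \<circ> x \<circ> w \<in> TT"
  using conj_TT[OF reflection_group_inv[OF assms(1)] assms(2)] reflection_group_bij[OF assms(1)]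
  by (simp only: inv_inv_eq)

lemma WA_WB: "WA \<subseteq> WB"
  unfolding weyl_B_def
proof (rule reflection_group_subset, rule reflection_group_refl)
  fix \<alpha> assume "\<alpha> \<in> pos_roots n"
  then obtain p q where "\<alpha> = \<epsilon> p - \<epsilon> q" "p \<in> {1..n}" "q \<in> {1..n}" "p < q" by (rule pos_rootsE)
  then have "\<alpha> = 1 *\<^sub>R \<epsilon> p + (-1) *\<^sub>R \<epsilon> q" "1 \<le> p" "p < q" "q \<le> n" by auto
  then show "\<alpha> \<in> roots_B n \<epsilon>" unfolding roots_B_def by blast
qed

lemma TT_WB: "TT \<subseteq> WB"
  unfolding weyl_B_def sign_group_def
proof (rule reflection_group_subset, rule reflection_group_refl)
  fix \<alpha> assume "\<alpha> \<in> \<epsilon> ` {1..n}"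
  then obtain l where "\<alpha> = 1 *\<^sub>R \<epsilon> l" "l \<in> {1..n}" by auto
  then show "\<alpha> \<in> roots_B n \<epsilon>" unfolding roots_B_def by blast
qed

lemma WA_step: "\<lbrakk>v \<in> WA; x \<in> TT; u \<in> WA\<rbrakk> \<Longrightarrow> \<exists>x' \<in> TT. \<exists>u' \<in> WA. v \<circ> (x \<circ> u) = x' \<circ> u'"
proof (intro bexI)
  assume *: "v \<in> WA" "x \<in> TT" "u \<in> WA"
  show "v \<circ> (x \<circ> u) = (v \<circ> x \<circ> iv v) \<circ> (v \<circ> u)"
    using reflection_group_bij[OF *(1)] by (auto simp: fun_eq_iff bij_is_inj inv_f_f)
qed (auto intro: conj_TT reflection_group_comp simp del: o_apply)

lemma TT_step: "\<lbrakk>y \<in> TT; \<exists>x \<in> TT. \<exists>u \<in> WA. g = x \<circ> u\<rbrakk> \<Longrightarrow> \<exists>x' \<in> TT. \<exists>u' \<in> WA. y \<circ> g = x' \<circ> u'"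
  by (metis TT_comp o_assoc)

text \<open>
  The sign group is normalized by \<open>W\<^sub>A\<close>, so products \<open>x \<circ> u\<close> are stable under left multiplication by both
  groups. The reflection in \<open>\<epsilon> p + \<epsilon> q\<close> is conjugate to the one in \<open>\<epsilon> p - \<epsilon> q\<close> by the sign change at \<open>q\<close>.
\<close>

lemma WB_factor:
  assumes "g \<in> WB"
  shows "\<exists>x \<in> TT. \<exists>u \<in> WA. g = x \<circ> u"
  using assms unfolding weyl_B_def
proof (induction rule: reflection_group_induct)
  case id
  have "id = id \<circ> (id :: 'v \<Rightarrow> 'v)" by simp
  then show ?case using TT_id reflection_group_id by blast
next
  case (step \<beta> g)
  then obtain x u where xu: "x \<in> TT" "u \<in> WA" "g = x \<circ> u" by blast
  from step.hyps(1) consider a l where "a \<in> {1, -1 :: real}" "\<beta> = a *\<^sub>R \<epsilon> l" "l \<in> {1..n}"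
    | a b p q where "a \<in> {1, -1 :: real}" "b \<in> {1, -1 :: real}" "\<beta> = a *\<^sub>R \<epsilon> p + b *\<^sub>R \<epsilon> q" "1 \<le> p" "p < q" "q \<le> n"
    unfolding roots_B_def by blast
  then show ?case
  proof cases
    case 1
    then have "s \<beta> = s (\<epsilon> l)" using root_reflection_uminus[of "\<epsilon> l"] by auto
    then show ?thesis using TT_step[OF t_mem[OF 1(3)] step.IH] by (simp only:)
  next
    case 2
    then have pq: "p \<in> {1..n}" "q \<in> {1..n}" "p \<noteq> q" by auto
    have sA: "s (\<epsilon> p - \<epsilon> q) \<in> WA" using pq by (intro reflection_mem) auto
    show ?thesis
    proof (cases "a = b")
      case False
      then have "\<beta> = \<epsilon> p - \<epsilon> q \<or> \<beta> = - (\<epsilon> p - \<epsilon> q)" using 2 by auto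
      then have "s \<beta> = s (\<epsilon> p - \<epsilon> q)" using root_reflection_uminus[of "\<epsilon> p - \<epsilon> q"] by auto
      then show ?thesis using WA_step[OF sA xu(1,2)] xu(3) by (simp only:)
    next
      case True
      then have "\<beta> = \<epsilon> p + \<epsilon> q \<or> \<beta> = - (\<epsilon> p + \<epsilon> q)" using 2 by auto
      then have "s \<beta> = s (\<epsilon> p + \<epsilon> q)" using root_reflection_uminus[of "\<epsilon> p + \<epsilon> q"] by auto
      also have "\<epsilon> p + \<epsilon> q = s (\<epsilon> q) (\<epsilon> p - \<epsilon> q)"
        using pq by (simp add: linear_diff[OF linear_reflection] t_eps)
      also have "s \<dots> = s (\<epsilon> q) \<circ> s (\<epsilon> p - \<epsilon> q) \<circ> s (\<epsilon> q)"
        by (simp only: reflection_apply_conjugate[OF orthogonal_reflection bij_reflection] inv_reflection)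
      finally have "s \<beta> \<circ> g = s (\<epsilon> q) \<circ> (s (\<epsilon> p - \<epsilon> q) \<circ> ((s (\<epsilon> q) \<circ> x) \<circ> u))"
        by (simp only: xu(3) o_assoc)
      then show ?thesis
        using TT_step[OF t_mem[OF pq(2)] WA_step[OF sA TT_comp[OF t_mem[OF pq(2)] xu(1)] xu(2)]] by (simp only:)
    qed
  qed
qed

text \<open>
  The two factors of \<open>g = sgB g \<circ> absB g\<close> in the semidirect product \<open>W\<^sub>B = T \<rtimes> W\<^sub>A\<close>.
\<close>

definition absB :: "('v \<Rightarrow> 'v) \<Rightarrow> 'v \<Rightarrow> 'v"
  where "absB g = (THE u. u \<in> WA \<and> (\<exists>x \<in> TT. g = x \<circ> u))"

definition sgB :: "('v \<Rightarrow> 'v) \<Rightarrow> 'v \<Rightarrow> 'v"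
  where "sgB g = g \<circ> iv (absB g)"

lemma factor_unique:
  assumes "x \<in> TT" "x' \<in> TT" "u \<in> WA" "u' \<in> WA" "x \<circ> u = x' \<circ> u'"
  shows "u = u'"
proof -
  have b: "bij x" "bij x'" "bij u" "bij u'" using assms TT_bij reflection_group_bij by auto
  have "iv x' \<circ> x = iv x' \<circ> (x \<circ> u) \<circ> iv u" using b by (auto simp: fun_eq_iff bij_is_surj surj_f_inv_f)
  also have "\<dots> = u' \<circ> iv u" unfolding assms(5) using b by (auto simp: fun_eq_iff bij_is_inj inv_f_f)
  finally have eq: "iv x' \<circ> x = u' \<circ> iv u" .
  have "u' \<circ> iv u \<in> WA" using assms by (intro reflection_group_comp reflection_group_inv)
  moreover have "iv x' \<circ> x \<in> TT" using assms by (intro TT_comp TT_inv)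
  ultimately have "u' \<circ> iv u = id" using TT_WA eq by simp
  then have "u' \<circ> iv u \<circ> u = u" by simp
  then show "u = u'" using b by (auto simp: fun_eq_iff bij_is_inj inv_f_f)
qed

lemma absB_eq: "\<lbrakk>x \<in> TT; u \<in> WA\<rbrakk> \<Longrightarrow> absB (x \<circ> u) = u"
  unfolding absB_def by (rule the_equality) (use factor_unique in blast)+

lemma sgB_eq: "\<lbrakk>x \<in> TT; u \<in> WA\<rbrakk> \<Longrightarrow> sgB (x \<circ> u) = x"
  unfolding sgB_def using reflection_group_bij[of u]
  by (simp only: absB_eq) (auto simp: fun_eq_iff bij_is_surj surj_f_inv_f)

lemma absB_WA: "u \<in> WA \<Longrightarrow> absB u = u \<and> sgB u = id"
  using absB_eq[OF TT_id, of u] sgB_eq[OF TT_id, of u] by simp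

lemma absB_TT: "x \<in> TT \<Longrightarrow> absB x = id \<and> sgB x = x"
  using absB_eq[OF _ reflection_group_id, of x] sgB_eq[OF _ reflection_group_id, of x] by simp

lemma absB_mem: "g \<in> WB \<Longrightarrow> absB g \<in> WA \<and> sgB g \<in> TT \<and> g = sgB g \<circ> absB g"
  using WB_factor[of g] absB_eq sgB_eq by force

lemma absB_comp:
  assumes "g \<in> WB" "h \<in> WB"
  shows "absB (g \<circ> h) = absB g \<circ> absB h"
    "sgB (g \<circ> h) = sgB g \<circ> (absB g \<circ> sgB h \<circ> iv (absB g))"
proof -
  let ?u = "absB g" and ?x = "sgB g" and ?v = "absB h" and ?y = "sgB h"
  have m: "?u \<in> WA" "?x \<in> TT" "?v \<in> WA" "?y \<in> TT" and gh: "g = ?x \<circ> ?u" "h = ?y \<circ> ?v"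
    using absB_mem assms by auto
  have "g \<circ> h = (?x \<circ> (?u \<circ> ?y \<circ> iv ?u)) \<circ> (?u \<circ> ?v)"
    by (subst gh(1), subst gh(2)) (use reflection_group_bij[OF m(1)] in \<open>auto simp: fun_eq_iff bij_is_inj inv_f_f\<close>)
  moreover have "?x \<circ> (?u \<circ> ?y \<circ> iv ?u) \<in> TT" "?u \<circ> ?v \<in> WA"
    using m by (blast intro: TT_comp conj_TT reflection_group_comp)+
  ultimately show "absB (g \<circ> h) = ?u \<circ> ?v" "sgB (g \<circ> h) = ?x \<circ> (?u \<circ> ?y \<circ> iv ?u)"
    using absB_eq sgB_eq by metis+
qed

text \<open>
  For \<open>\<beta> = \<epsilon> a - \<epsilon> b\<close> the product runs over \<open>a\<close> and \<open>b\<close>. This is the value of \<open>k (1 + t\<^sub>a t\<^sub>b)\<close> under \<open>\<mu>\<close>,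
  written as a function of the root.
\<close>

definition kB :: "'v \<Rightarrow> complex"
  where "kB \<beta> = k * (1 + (\<Prod>p \<in> {p \<in> {1..n}. \<beta> \<bullet> \<epsilon> p \<noteq> 0}. \<mu>t p))"

lemma kB_root:
  assumes "a \<in> {1..n}" "b \<in> {1..n}" "a \<noteq> b"
  shows "kB (\<epsilon> a - \<epsilon> b) = k * (1 + \<mu>t a * \<mu>t b)"
proof -
  have "{p \<in> {1..n}. (\<epsilon> a - \<epsilon> b) \<bullet> \<epsilon> p \<noteq> 0} = {a, b}"
    using assms by (auto simp: inner_diff_left split: if_splits)
  then show ?thesis using assms by (simp add: kB_def)
qed

lemma kB_uminus: "kB (- \<alpha>) = kB \<alpha>"
  by (simp add: kB_def)

lemma kB_nonzero: "\<lbrakk>a \<in> {1..n}; b \<in> {1..n}; a \<noteq> b; kB (\<epsilon> a - \<epsilon> b) \<noteq> 0\<rbrakk> \<Longrightarrow> \<mu>t a = \<mu>t b"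
  using mu_t[of a] mu_t[of b] kB_root[of a b] by auto

lemma kB_reflection:
  assumes "\<alpha> \<in> pos_roots n" "\<beta> \<in> pos_roots n" "kB \<beta> \<noteq> 0"
  shows "kB (s \<beta> \<alpha>) = kB \<alpha>"
proof -
  obtain a b where ab: "\<beta> = \<epsilon> a - \<epsilon> b" "a \<in> {1..n}" "b \<in> {1..n}" "a < b" using assms(2) by (rule pos_rootsE)
  obtain c d where cd: "\<alpha> = \<epsilon> c - \<epsilon> d" "c \<in> {1..n}" "d \<in> {1..n}" "c < d" using assms(1) by (rule pos_rootsE)
  have eq: "\<mu>t (tr a b x) = \<mu>t x" for x
    using kB_nonzero[of a b] assms(3) ab by (simp add: Transposition.transpose_def)
  have "s \<beta> \<alpha> = \<epsilon> (tr a b c) - \<epsilon> (tr a b d)"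
    using ab cd by (simp add: linear_diff[OF linear_reflection] reflection_eps)
  moreover have "tr a b c \<in> {1..n}" "tr a b d \<in> {1..n}" "tr a b c \<noteq> tr a b d"
    using ab cd by (auto simp: Transposition.transpose_def)
  ultimately show ?thesis using cd by (simp add: kB_root eq)
qed

definition \<nu> :: "'v \<Rightarrow> complex"
  where "\<nu> v = \<gamma> (real_vec v)"

lemma linear_restriction: "linear \<nu>"
proof (rule linearI)
  show "\<nu> (u + v) = \<nu> u + \<nu> v" for u v
  proof -
    have "real_vec (u + v) = real_vec u + real_vec v" by (simp add: real_vec_def)
    then show ?thesis using functional by (simp only: \<nu>_def complex_functional_def)
  qed
  show "\<nu> (r *\<^sub>R v) = r *\<^sub>R \<nu> v" for r v
  proof -
    have "real_vec (r *\<^sub>R v) = cscale (of_real r) (real_vec v)" by (simp add: real_vec_def cscale_def)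
    then show ?thesis
      using functional by (simp only: \<nu>_def complex_functional_def scaleR_conv_of_real)
  qed
qed

sublocale B: hecke_data WA "pos_roots n" "simple_roots n" kB \<nu>
  by (rule hecke_data_blocks) (auto simp: kB_uminus linear_restriction kB_reflection)

text \<open>
  In the induced module \<open>g t\<^sub>u \<otimes> v = \<mu>(w\<inverse> x w) t\<^sub>w \<otimes> v\<close> for \<open>g = x \<circ> absB g\<close> and \<open>w = absB g \<circ> u\<close>.
\<close>

definition Bop :: "('v \<Rightarrow> 'v) \<Rightarrow> (('v \<Rightarrow> 'v) \<Rightarrow> complex) \<Rightarrow> ('v \<Rightarrow> 'v) \<Rightarrow> complex"
  where "Bop g f = (\<lambda>w. if w \<in> WA then \<mu> (iv w \<circ> sgB g \<circ> w) * f (iv (absB g) \<circ> w) else 0)"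

lemma inv_comp_self: "w \<in> WA \<Longrightarrow> iv w \<circ> w = id"
  by (rule inv_o_cancel[OF bij_is_inj[OF reflection_group_bij]])

lemma Bop_WA:
  assumes "u \<in> WA"
  shows "Bop u f = B.T u f"
proof
  fix w
  show "Bop u f w = B.T u f w"
    using absB_WA[OF assms] mu_id by (simp add: Bop_def B.T_def inv_comp_self del: o_apply id_apply)
qed

lemma Bop_TT:
  assumes "x \<in> TT"
  shows "Bop x f = (\<lambda>w. if w \<in> WA then \<mu> (iv w \<circ> x \<circ> w) * f w else 0)"
proof
  fix w
  show "Bop x f w = (if w \<in> WA then \<mu> (iv w \<circ> x \<circ> w) * f w else 0)"
    using absB_TT[OF assms] by (simp add: Bop_def inv_id del: o_apply id_apply)
qed

lemma Bop_comp:
  assumes "g \<in> WB" "h \<in> WB"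
  shows "Bop g (Bop h f) = Bop (g \<circ> h) f"
proof
  fix w
  show "Bop g (Bop h f) w = Bop (g \<circ> h) f w"
  proof (cases "w \<in> WA")
    case w: True
    let ?u = "absB g" and ?x = "sgB g" and ?v = "absB h" and ?y = "sgB h"
    have m: "?u \<in> WA" "?x \<in> TT" "?v \<in> WA" "?y \<in> TT" using absB_mem assms by auto
    have bij: "bij ?u" "bij ?v" "bij w" using m w reflection_group_bij by auto
    have u: "iv ?u \<circ> w \<in> WA" using m w by (intro reflection_group_comp reflection_group_inv)
    have inv: "iv (iv ?u \<circ> w) = iv w \<circ> ?u" using bij by (simp add: o_inv_distrib bij_imp_bij_inv inv_inv_eq)
    have "iv w \<circ> (?x \<circ> (?u \<circ> ?y \<circ> iv ?u)) \<circ> w = (iv w \<circ> ?x \<circ> w) \<circ> (iv w \<circ> ?u \<circ> ?y \<circ> (iv ?u \<circ> w))"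
      using bij by (auto simp: fun_eq_iff bij_is_surj surj_f_inv_f)
    then have "\<mu> (iv w \<circ> (?x \<circ> (?u \<circ> ?y \<circ> iv ?u)) \<circ> w) = \<mu> (iv w \<circ> ?x \<circ> w) * \<mu> (iv w \<circ> ?u \<circ> ?y \<circ> (iv ?u \<circ> w))"
      using mu_comp[OF conj_TT'[OF w m(2)] conj_TT'[OF u m(4)]] by (simp only: inv)
    moreover have "iv (?u \<circ> ?v) \<circ> w = iv ?v \<circ> (iv ?u \<circ> w)"
      using bij by (simp only: o_inv_distrib o_assoc)
    ultimately show ?thesis
      using w u by (simp add: Bop_def absB_comp[OF assms] inv del: o_apply)
  qed (simp add: Bop_def)
qed

end

section \<open>The two Hecke algebras\<close>

context type_B
begin

text \<open>
  A root of nonzero weight joins indices at which \<open>\<mu>\<close> has the same sign, so exchanging them does not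
  affect \<open>\<mu>\<close>.
\<close>

lemma mu_conj:
  assumes "\<beta> \<in> pos_roots n" "kB \<beta> \<noteq> 0" "y \<in> TT"
  shows "\<mu> (s \<beta> \<circ> y \<circ> s \<beta>) = \<mu> y"
proof -
  obtain a b where ab: "\<beta> = \<epsilon> a - \<epsilon> b" "a \<in> {1..n}" "b \<in> {1..n}" "a < b" using assms(1) by (rule pos_rootsE)
  have \<beta>: "s \<beta> \<in> WA" using assms(1) by (rule reflection_group_refl)
  have eq: "\<mu>t (tr a b x) = \<mu>t x" for x
    using kB_nonzero[of a b] assms(2) ab by (simp add: Transposition.transpose_def)
  from assms(3) show ?thesis
  proof (induction rule: TT_induct)
    case id
    show ?case by (simp only: comp_id reflection_comp_self)
  next
    case (step \<alpha> x)
    then obtain p where p: "\<alpha> = \<epsilon> p" "p \<in> {1..n}" by blast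
    have tp: "tr a b p \<in> {1..n}" using ab p by (auto simp: Transposition.transpose_def)
    have "s \<beta> (\<epsilon> p) = \<epsilon> (tr a b p)" using ab p by (simp add: reflection_eps)
    then have t: "s \<beta> \<circ> s \<alpha> \<circ> s \<beta> = s (\<epsilon> (tr a b p))"
      using conj_t(1)[OF \<beta> p(2) tp] by (simp only: p(1) inv_reflection)
    have x: "s \<beta> \<circ> x \<circ> s \<beta> \<in> TT"
      using conj_TT[OF \<beta> step.hyps(2)] by (simp only: inv_reflection)
    have "s \<beta> \<circ> (s \<alpha> \<circ> x) \<circ> s \<beta> = (s \<beta> \<circ> s \<alpha> \<circ> s \<beta>) \<circ> (s \<beta> \<circ> x \<circ> s \<beta>)"
      using conj_comp[OF reflection_group_bij[OF \<beta>], of "s \<alpha>" x] by (simp only: inv_reflection)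
    then have "\<mu> (s \<beta> \<circ> (s \<alpha> \<circ> x) \<circ> s \<beta>) = \<mu>t (tr a b p) * \<mu> x"
      using mu_comp[OF t_mem[OF tp] x] step.IH by (simp only: t)
    also have "\<dots> = \<mu> (s \<alpha> \<circ> x)"
      using mu_comp[OF t_mem[OF p(2)] step.hyps(2)] by (simp only: eq p(1))
    finally show ?case .
  qed
qed

lemma root_comp:
  assumes "w \<in> WA"
  shows "s \<alpha> \<circ> w = w \<circ> s (iv w \<alpha>)"
proof -
  have "iv w \<in> WA" by (rule reflection_group_inv[OF assms])
  then have "s (iv w \<alpha>) = iv w \<circ> s \<alpha> \<circ> w"
    using reflection_apply_conjugate[of "iv w" \<alpha>] reflection_group_orthogonal reflection_group_bij
      inv_inv_eq[OF reflection_group_bij[OF assms]] by metis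
  then show ?thesis
    using reflection_group_bij[OF assms] by (auto simp: fun_eq_iff bij_is_surj surj_f_inv_f)
qed

text \<open>
  Replacing \<open>w\<close> by \<open>s\<^sub>\<alpha>w\<close> conjugates \<open>w\<inverse>xw\<close> by the reflection in \<open>w\<inverse>\<alpha>\<close>. By the preceding lemma this
  changes \<open>\<mu>(w\<inverse>xw)\<close> only in terms of \<open>Y\<close> whose weight is zero.
\<close>

lemma Bop_Y:
  assumes x: "x \<in> TT"
  shows "Bop x (B.Y v f) = B.Y v (Bop x f)"
proof
  fix w
  show "Bop x (B.Y v f) w = B.Y v (Bop x f) w"
  proof (cases "w \<in> WA")
    case w: True
    have key: "\<mu> (iv w \<circ> x \<circ> w) * (kB (iv w \<alpha>) * c * F) = kB (iv w \<alpha>) * c * Bop x f (s \<alpha> \<circ> w)"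
      if \<alpha>: "\<alpha> \<in> pos_roots n" "iv w \<alpha> \<in> pos_roots n" and F: "F = f (s \<alpha> \<circ> w)" for \<alpha> c F
    proof (cases "kB (iv w \<alpha>) = 0")
      case False
      let ?\<beta> = "iv w \<alpha>"
      have sw: "s \<alpha> \<circ> w \<in> WA" using reflection_group_comp[OF reflection_group_refl[OF \<alpha>(1)] w] .
      have "iv (s \<alpha> \<circ> w) = s ?\<beta> \<circ> iv w"
        unfolding root_comp[OF w]
        by (simp only: o_inv_distrib[OF reflection_group_bij[OF w] bij_reflection] inv_reflection)
      then have "iv (s \<alpha> \<circ> w) \<circ> x \<circ> (s \<alpha> \<circ> w) = s ?\<beta> \<circ> (iv w \<circ> x \<circ> w) \<circ> s ?\<beta>"
        unfolding root_comp[OF w] by (simp only: o_assoc)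
      then have "\<mu> (iv (s \<alpha> \<circ> w) \<circ> x \<circ> (s \<alpha> \<circ> w)) = \<mu> (iv w \<circ> x \<circ> w)"
        using mu_conj[OF \<alpha>(2) False conj_TT'[OF w x]] by simp
      then show ?thesis using sw by (simp add: Bop_TT[OF x] F del: o_apply)
    qed simp
    let ?S = "{\<alpha> \<in> pos_roots n. iv w \<alpha> \<in> pos_roots n}" and ?m = "\<mu> (iv w \<circ> x \<circ> w)"
    have "Bop x (B.Y v f) w = ?m * (\<nu> (iv w v) * f w -
        (\<Sum>\<alpha>\<in>?S. kB (iv w \<alpha>) * of_real (coroot \<alpha> v) * f (s \<alpha> \<circ> w)))"
      using w by (simp only: Bop_TT[OF x] B.Y_def if_True)
    also have "\<dots> = \<nu> (iv w v) * (?m * f w) -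
        (\<Sum>\<alpha>\<in>?S. ?m * (kB (iv w \<alpha>) * of_real (coroot \<alpha> v) * f (s \<alpha> \<circ> w)))"
      by (simp only: right_diff_distrib sum_distrib_left mult.left_commute)
    also have "(\<Sum>\<alpha>\<in>?S. ?m * (kB (iv w \<alpha>) * of_real (coroot \<alpha> v) * f (s \<alpha> \<circ> w))) =
        (\<Sum>\<alpha>\<in>?S. kB (iv w \<alpha>) * of_real (coroot \<alpha> v) * Bop x f (s \<alpha> \<circ> w))"
      by (rule sum.cong[OF refl], rule key) auto
    also have "?m * f w = Bop x f w" using w by (simp only: Bop_TT[OF x] if_True)
    finally show ?thesis using w by (simp only: B.Y_def if_True)
  qed (simp add: Bop_TT[OF x] B.Y_def)
qed

text \<open>
  A simple root determines its index \<open>p\<close>, so the parameter may be regarded as a function of the root.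
\<close>

definition mB :: "'v \<Rightarrow> 'v hecke_gen ncpoly"
  where "mB \<alpha> = (let p = THE p. p \<in> {1..n - 1} \<and> \<alpha> = simple_root \<epsilon> p in k_tilde \<epsilon> k p (p + 1))"

lemma mB_simple: "p \<in> {1..n - 1} \<Longrightarrow> mB (simple_root \<epsilon> p) = k_tilde \<epsilon> k p (p + 1)"
proof -
  assume p: "p \<in> {1..n - 1}"
  have "q = p" if "q \<in> {1..n - 1}" "simple_root \<epsilon> p = simple_root \<epsilon> q" for q
  proof -
    have p': "p \<in> {1..n}" "p + 1 \<in> {1..n}" "q \<in> {1..n}" "q + 1 \<in> {1..n}" using p that(1) by auto
    have eq: "\<epsilon> p - \<epsilon> (p + 1) = \<epsilon> q - \<epsilon> (q + 1)" using that(2) by (simp only: simple_root_def)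
    have "(\<epsilon> p - \<epsilon> (p + 1)) \<bullet> \<epsilon> p = (if p = p then 1 else 0) - (if p + 1 = p then 1 else 0)"
      by (simp only: inner_diff_left inner_eps[OF p'(1,1)] inner_eps[OF p'(2,1)])
    moreover have "(\<epsilon> q - \<epsilon> (q + 1)) \<bullet> \<epsilon> p = (if q = p then 1 else 0) - (if q + 1 = p then 1 else 0)"
      by (simp only: inner_diff_left inner_eps[OF p'(3,1)] inner_eps[OF p'(4,1)])
    ultimately show ?thesis unfolding eq by (auto split: if_splits)
  qed
  then have "(THE q. q \<in> {1..n - 1} \<and> simple_root \<epsilon> p = simple_root \<epsilon> q) = p"
    using p by (intro the_equality conjI refl) blast+
  then show ?thesis by (simp add: mB_def)
qed

lemma simple_rootsE:
  assumes "\<alpha> \<in> simple_roots i"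
  obtains p where "\<alpha> = simple_root \<epsilon> p" "p \<in> {1..n - 1}" "p \<noteq> i" "p \<in> {1..n}" "p + 1 \<in> {1..n}"
  using assms by (force simp: simple_roots_def)

lemma linear_Bop: "linear_op (Bop g)"
  by (auto simp: linear_op_def Bop_def fun_eq_iff fscale_apply algebra_simps)

lemma Bop_m:
  assumes "\<alpha> \<in> simple_roots n" "f \<in> supported WA"
  shows "poly_act (case_hecke_gen B.YC Bop) (mB \<alpha>) f = B.K \<alpha> f"
proof -
  obtain p where p: "\<alpha> = simple_root \<epsilon> p" "p \<in> {1..n - 1}" "p \<in> {1..n}" "p + 1 \<in> {1..n}"
    using assms(1) by (rule simple_rootsE) blast
  let ?q = "p + 1"
  have lin: "linear_op (case_hecke_gen B.YC Bop x)" for x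
    by (cases x) (auto simp: B.linear_YC linear_Bop)
  have "poly_act (case_hecke_gen B.YC Bop) (mB \<alpha>) f = k \<bullet>\<^sub>C (f + Bop (s (\<epsilon> p)) (Bop (s (\<epsilon> ?q)) f))"
    using p by (simp only: p(1) mB_simple k_tilde_def poly_act_mult[OF lin] poly_act_add poly_act_basic hecke_gen.case)
  also have "\<dots> = B.K \<alpha> f"
  proof
    fix w
    show "(k \<bullet>\<^sub>C (f + Bop (s (\<epsilon> p)) (Bop (s (\<epsilon> ?q)) f))) w = B.K \<alpha> f w"
    proof (cases "w \<in> WA")
      case w: True
      have iw: "iv w \<in> WA" by (rule reflection_group_inv[OF w])
      obtain \<pi> where \<pi>: "linear (iv w)" "bij_betw \<pi> {1..n} {1..n}" "\<And>p. p \<in> {1..n} \<Longrightarrow> \<pi> p \<in> {1..n}"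
        "\<And>p. p \<in> {1..n} \<Longrightarrow> iv w (\<epsilon> p) = \<epsilon> (\<pi> p)" using iw by (rule WAE) blast
      have t: "iv w \<circ> s (\<epsilon> r) \<circ> w = s (\<epsilon> (\<pi> r))" if "r \<in> {1..n}" for r
        using conj_t(1)[OF iw that \<pi>(3)[OF that] \<pi>(4)[OF that]] inv_inv_eq[OF reflection_group_bij[OF w]]
        by (simp only:)
      have ne: "\<pi> p \<noteq> \<pi> ?q"
        using inj_onD[OF bij_betw_imp_inj_on[OF \<pi>(2)] _ p(3,4)] by auto
      have "iv w \<alpha> = \<epsilon> (\<pi> p) - \<epsilon> (\<pi> ?q)"
        using p \<pi>(4) by (simp add: simple_root_def linear_diff[OF \<pi>(1)])
      then have "kB (iv w \<alpha>) = k * (1 + \<mu>t (\<pi> p) * \<mu>t (\<pi> ?q))"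
        using kB_root[OF \<pi>(3)[OF p(3)] \<pi>(3)[OF p(4)] ne] by simp
      then have K: "B.K \<alpha> f w = k * (1 + \<mu>t (\<pi> p) * \<mu>t (\<pi> ?q)) * f w"
        by (simp only: B.K_def)
      have Bt: "Bop (s (\<epsilon> r)) h w = \<mu>t (\<pi> r) * h w" if "r \<in> {1..n}" for r h
        using w t[OF that] by (simp only: Bop_TT[OF t_mem[OF that]] if_True)
      show ?thesis
        unfolding K fscale_apply plus_fun_apply Bt[OF p(3)] Bt[OF p(4)] by (simp only: algebra_simps mult_1)
    next
      case False
      then show ?thesis
        using assms(2) by (simp add: fscale_apply B.K_def Bop_def supported_def)
    qed
  qed
  finally show ?thesis .
qed

definition extraB :: "'v hecke_gen ncpoly set"
  where "extraB = {grp_symb x * vec_symb (real_vec \<zeta>) - vec_symb (real_vec \<zeta>) * grp_symb x | x \<zeta>. x \<in> TT}"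

lemma cross_relators_B:
  "{cross_relator (simple_root \<epsilon> p) (k_tilde \<epsilon> k p (p + 1)) \<zeta> | p \<zeta>. p \<in> {1..n - 1}} =
   {cross_relator \<alpha> (mB \<alpha>) \<zeta> | \<alpha> \<zeta>. \<alpha> \<in> simple_roots n}"
proof (intro equalityI subsetI)
  fix r assume "r \<in> {cross_relator (simple_root \<epsilon> p) (k_tilde \<epsilon> k p (p + 1)) \<zeta> | p \<zeta>. p \<in> {1..n - 1}}"
  then obtain p \<zeta> where "r = cross_relator (simple_root \<epsilon> p) (mB (simple_root \<epsilon> p)) \<zeta>" and p: "p \<in> {1..n - 1}"
    using mB_simple by auto
  moreover have "simple_root \<epsilon> p \<in> simple_roots n" using p by (auto simp: simple_roots_def)
  ultimately show "r \<in> {cross_relator \<alpha> (mB \<alpha>) \<zeta> | \<alpha> \<zeta>. \<alpha> \<in> simple_roots n}" by blast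
next
  fix r assume "r \<in> {cross_relator \<alpha> (mB \<alpha>) \<zeta> | \<alpha> \<zeta>. \<alpha> \<in> simple_roots n}"
  then obtain \<alpha> \<zeta> where r: "r = cross_relator \<alpha> (mB \<alpha>) \<zeta>" "\<alpha> \<in> simple_roots n" by blast
  from r(2) obtain p where "\<alpha> = simple_root \<epsilon> p" "p \<in> {1..n - 1}" by (rule simple_rootsE)
  then have "r = cross_relator (simple_root \<epsilon> p) (k_tilde \<epsilon> k p (p + 1)) \<zeta>" "p \<in> {1..n - 1}"
    using r(1) mB_simple by auto
  then show "r \<in> {cross_relator (simple_root \<epsilon> p) (k_tilde \<epsilon> k p (p + 1)) \<zeta> | p \<zeta>. p \<in> {1..n - 1}}"
    by blast
qed

sublocale HB: hecke_algebra WA "pos_roots n" "simple_roots n" kB \<nu> "H_B_pres n \<epsilon> k" WB TT \<mu> Bop mB extraB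
proof
  have lin: "linear_op (case_hecke_gen B.YC Bop x)" for x
    by (cases x) (auto simp: B.linear_YC linear_Bop)
  show "fst (H_B_pres n \<epsilon> k) = range Vec \<union> Grp ` WB" by (simp add: H_B_pres_def)
  show "snd (H_B_pres n \<epsilon> k) = sym_relators \<union> group_relators WB \<union> extraB \<union>
      {cross_relator \<alpha> (mB \<alpha>) \<zeta> | \<alpha> \<zeta>. \<alpha> \<in> simple_roots n}"
    by (simp only: H_B_pres_def snd_conv extraB_def cross_relators_B)
  show "WA \<subseteq> WB" by (rule WA_WB)
  show "TT \<subseteq> WB" by (rule TT_WB)
  show "g \<circ> h \<in> WB" if "g \<in> WB" "h \<in> WB" for g h
    using that unfolding weyl_B_def by (rule reflection_group_comp)
  show "\<exists>c d g h. g \<in> WB \<and> h \<in> WB \<and> mB \<alpha> = const c + const d * (grp_symb g * grp_symb h)"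
    if "\<alpha> \<in> simple_roots n" for \<alpha>
  proof -
    obtain p where p: "\<alpha> = simple_root \<epsilon> p" "p \<in> {1..n - 1}" "p \<in> {1..n}" "p + 1 \<in> {1..n}"
      using \<open>\<alpha> \<in> simple_roots n\<close> by (rule simple_rootsE)
    then have "mB \<alpha> = const k + const k * (grp_symb (s (\<epsilon> p)) * grp_symb (s (\<epsilon> (p + 1))))"
      using mB_simple by (simp add: k_tilde_def distrib_left)
    moreover have "s (\<epsilon> p) \<in> WB" "s (\<epsilon> (p + 1)) \<in> WB" using p t_mem TT_WB by blast+
    ultimately show ?thesis by blast
  qed
  show "extraB \<subseteq> carrier (free_algebra (range Vec \<union> Grp ` WB))"
    using TT_WB by (auto simp: extraB_def subset_iff)
  show "linear_op (Bop g)" for g by (rule linear_Bop)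
  show "Bop g f \<in> supported WA" for g f by (simp add: Bop_def supported_def)
  show "Bop w f = B.T w f" if "w \<in> WA" for w f using that by (rule Bop_WA)
  show "Bop g (Bop h f) = Bop (g \<circ> h) f" if "g \<in> WB" "h \<in> WB" for g h f
    using that by (rule Bop_comp)
  show "poly_act (case_hecke_gen B.YC Bop) (mB \<alpha>) f = B.K \<alpha> f"
    if "\<alpha> \<in> simple_roots n" "f \<in> supported WA" for \<alpha> f using that by (rule Bop_m)
  show "poly_act (case_hecke_gen B.YC Bop) r f = 0" if "r \<in> extraB" for r f
  proof -
    from \<open>r \<in> extraB\<close> obtain x \<zeta> where "x \<in> TT" "r = grp_symb x * vec_symb (real_vec \<zeta>) - vec_symb (real_vec \<zeta>) * grp_symb x"
      unfolding extraB_def by blast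
    then show ?thesis
      by (simp add: poly_act_diff poly_act_mult[OF lin] B.YC_real_vec Bop_Y)
  qed
  show "Bop x (delta id) = \<mu> x \<bullet>\<^sub>C delta id" if x: "x \<in> TT" for x
  proof
    fix w
    show "Bop x (delta id) w = (\<mu> x \<bullet>\<^sub>C delta id) w"
      using reflection_group_id[of "pos_roots n"]
      by (simp add: Bop_TT[OF x] fscale_apply delta_def inv_id del: id_apply)
  qed
  show "(\<exists>u \<in> WA. g = u) \<or> (\<exists>u \<in> WA. \<exists>y \<in> TT. g = u \<circ> y)" if "g \<in> WB" for g
  proof -
    obtain x u where xu: "x \<in> TT" "u \<in> WA" "g = x \<circ> u" using WB_factor[OF \<open>g \<in> WB\<close>] by blast
    have "g = u \<circ> (iv u \<circ> x \<circ> u)"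
      using reflection_group_bij[OF xu(2)] by (auto simp: xu(3) fun_eq_iff bij_is_surj surj_f_inv_f)
    then show ?thesis using conj_TT'[OF xu(2,1)] xu(2) by blast
  qed
qed

end

locale graded_type_A = orthonormal_frame n \<epsilon> for n and \<epsilon> :: "nat \<Rightarrow> 'v::euclidean_space" +
  fixes k :: complex and i :: nat and \<nu>' :: "'v \<Rightarrow> complex"
  assumes i_le: "i \<le> n" and linear_nu': "linear \<nu>'"
begin

sublocale gr: hecke_data "WG i" "pos_roots i" "simple_roots i" "\<lambda>_. 2 * k" \<nu>'
  by (rule hecke_data_blocks) (auto simp: linear_nu')

sublocale Hgr: hecke_algebra "WG i" "pos_roots i" "simple_roots i" "\<lambda>_. 2 * k" \<nu>' "H_gr_pres n i \<epsilon> k"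
    "WG i" "{}" "\<lambda>_. 1" gr.T "\<lambda>_. const (2 * k)" "{}"
proof
  show "fst (H_gr_pres n i \<epsilon> k) = range Vec \<union> Grp ` WG i"
    by (simp add: H_gr_pres_def roots_split_eq[OF i_le])
  show "snd (H_gr_pres n i \<epsilon> k) = sym_relators \<union> group_relators (WG i) \<union> {} \<union>
      {cross_relator \<alpha> (const (2 * k)) \<zeta> | \<alpha> \<zeta>. \<alpha> \<in> simple_roots i}"
    unfolding H_gr_pres_def roots_split_eq[OF i_le] snd_conv Un_empty_right simple_roots_def by blast
  show "g \<circ> h \<in> WG i" if "g \<in> WG i" "h \<in> WG i" for g h
    using that by (rule reflection_group_comp)
  show "\<exists>c d g h. g \<in> WG i \<and> h \<in> WG i \<and> const (2 * k) = const c + const d * (grp_symb g * grp_symb h)"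
    by (intro exI[of _ "2 * k"] exI[of _ 0] exI[of _ id]) (simp add: reflection_group_id const_def)
  show "poly_act (case_hecke_gen gr.YC gr.T) (const (2 * k)) f = gr.K \<alpha> f" for \<alpha> f
    by (simp only: poly_act_basic) (simp add: gr.K_def fun_eq_iff fscale_apply)
  show "linear_op (gr.T g)" for g by (rule gr.linear_T)
  show "gr.T g f \<in> supported (WG i)" for g f by (rule gr.T_supported)
  show "gr.T g (gr.T h f) = gr.T (g \<circ> h) f" if "g \<in> WG i" "h \<in> WG i" for g h f
    using that by (rule gr.T_comp)
qed auto

end

section \<open>Transfer of submodule lattices\<close>

text \<open>
  A bijection of the carriers that respects the property of being a submodule transports chains of
  submodules and the two trivial submodules in both directions.
\<close>

lemma submodules_transfer:
  assumes bij: "bij_betw f (carrier M) (carrier N)" and zero: "f \<zero>\<^bsub>M\<^esub> = \<zero>\<^bsub>N\<^esub>" "\<zero>\<^bsub>M\<^esub> \<in> carrier M"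
    and sub: "\<And>Y. Y \<in> submodules R M \<Longrightarrow> Y \<subseteq> carrier M" "\<And>Y. Y \<in> submodules S N \<Longrightarrow> Y \<subseteq> carrier N"
    and iff: "\<And>Y. Y \<subseteq> carrier M \<Longrightarrow> Y \<in> submodules R M \<longleftrightarrow> f ` Y \<in> submodules S N"
  shows "bij_betw (\<lambda>Y. f ` Y) (submodules R M) (submodules S N)"
    and "Y \<subseteq> carrier M \<Longrightarrow> Z \<subseteq> carrier M \<Longrightarrow> Y \<subseteq> Z \<longleftrightarrow> f ` Y \<subseteq> f ` Z"
    and "module_length R M = module_length S N"
    and "simple_module R M \<longleftrightarrow> simple_module S N"
proof -
  let ?g = "inv_into (carrier M) f"
  have inj: "inj_on f (carrier M)" and im: "f ` carrier M = carrier N"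
    using bij by (auto simp: bij_betw_def)
  have gf: "?g ` f ` Y = Y" if "Y \<subseteq> carrier M" for Y
    using inv_into_image_cancel[OF inj that] .
  have fg: "f ` ?g ` Z = Z" if "Z \<subseteq> carrier N" for Z
    using image_inv_into_cancel[OF im that] .
  have g_sub: "?g ` Z \<subseteq> carrier M" if "Z \<subseteq> carrier N" for Z
  proof clarify
    fix x assume "x \<in> Z"
    then have "x \<in> f ` carrier M" using that im by blast
    then show "?g x \<in> carrier M" by (rule inv_into_into)
  qed
  have pull: "?g ` Z \<in> submodules R M" if "Z \<in> submodules S N" for Z
    using iff[OF g_sub[OF sub(2)[OF that]]] fg[OF sub(2)[OF that]] that by simp
  have push: "f ` Y \<in> submodules S N" if "Y \<in> submodules R M" for Y
    using iff[OF sub(1)[OF that]] that by simp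
  show "bij_betw (\<lambda>Y. f ` Y) (submodules R M) (submodules S N)"
    by (rule bij_betw_byWitness[where f' = "\<lambda>Z. ?g ` Z"]) (auto simp: gf fg sub pull push)
  show mono: "Y \<subseteq> Z \<longleftrightarrow> f ` Y \<subseteq> f ` Z" if "Y \<subseteq> carrier M" "Z \<subseteq> carrier M" for Y Z
    using inj_on_image_subset_iff[OF inj that] by simp
  have "(\<exists>C. (\<forall>p \<le> l. C p \<in> submodules R M) \<and> (\<forall>p < l. C p \<subset> C (Suc p))) \<longleftrightarrow>
    (\<exists>C. (\<forall>p \<le> l. C p \<in> submodules S N) \<and> (\<forall>p < l. C p \<subset> C (Suc p)))" for l :: nat
  proof
    assume "\<exists>C. (\<forall>p \<le> l. C p \<in> submodules R M) \<and> (\<forall>p < l. C p \<subset> C (Suc p))"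
    then obtain C where C: "\<And>p. p \<le> l \<Longrightarrow> C p \<in> submodules R M" "\<And>p. p < l \<Longrightarrow> C p \<subset> C (Suc p)" by blast
    have "f ` C p \<subset> f ` C (Suc p)" if "p < l" for p
    proof -
      have s: "C p \<subseteq> carrier M" "C (Suc p) \<subseteq> carrier M" using that by (auto intro!: sub(1) C(1))
      show ?thesis unfolding less_le_not_le using C(2)[OF that] mono[OF s] mono[OF s(2,1)] by auto
    qed
    then show "\<exists>C. (\<forall>p \<le> l. C p \<in> submodules S N) \<and> (\<forall>p < l. C p \<subset> C (Suc p))"
      using push C(1) by (intro exI[of _ "\<lambda>p. f ` C p"]) blast
  next
    assume "\<exists>C. (\<forall>p \<le> l. C p \<in> submodules S N) \<and> (\<forall>p < l. C p \<subset> C (Suc p))"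
    then obtain C where C: "\<And>p. p \<le> l \<Longrightarrow> C p \<in> submodules S N" "\<And>p. p < l \<Longrightarrow> C p \<subset> C (Suc p)" by blast
    have "?g ` C p \<subset> ?g ` C (Suc p)" if "p < l" for p
    proof -
      have c: "C p \<subseteq> carrier N" "C (Suc p) \<subseteq> carrier N" using that by (auto intro!: sub(2) C(1))
      have s: "?g ` C p \<subseteq> carrier M" "?g ` C (Suc p) \<subseteq> carrier M" using c by (auto intro!: g_sub)
      show ?thesis
        unfolding less_le_not_le using C(2)[OF that] mono[OF s] mono[OF s(2,1)] fg c by auto
    qed
    then show "\<exists>C. (\<forall>p \<le> l. C p \<in> submodules R M) \<and> (\<forall>p < l. C p \<subset> C (Suc p))"
      using pull C(1) by (intro exI[of _ "\<lambda>p. ?g ` C p"]) blast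
  qed
  then show "module_length R M = module_length S N"
    by (simp only: module_length_def)
  have z: "f ` {\<zero>\<^bsub>M\<^esub>} = {\<zero>\<^bsub>N\<^esub>}" using zero by simp
  have eq0: "Y = {\<zero>\<^bsub>M\<^esub>} \<longleftrightarrow> f ` Y = {\<zero>\<^bsub>N\<^esub>}" if "Y \<subseteq> carrier M" for Y
    using inj_on_image_eq_iff[OF inj that, of "{\<zero>\<^bsub>M\<^esub>}"] zero(2) z by auto
  have eqM: "Y = carrier M \<longleftrightarrow> f ` Y = carrier N" if "Y \<subseteq> carrier M" for Y
    using inj_on_image_eq_iff[OF inj that order_refl] im by auto
  have "(\<forall>Y \<in> submodules R M. Y = {\<zero>\<^bsub>M\<^esub>} \<or> Y = carrier M) \<longleftrightarrow>
    (\<forall>Z \<in> submodules S N. Z = {\<zero>\<^bsub>N\<^esub>} \<or> Z = carrier N)"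
  proof
    assume *: "\<forall>Y \<in> submodules R M. Y = {\<zero>\<^bsub>M\<^esub>} \<or> Y = carrier M"
    show "\<forall>Z \<in> submodules S N. Z = {\<zero>\<^bsub>N\<^esub>} \<or> Z = carrier N"
    proof
      fix Z assume Z: "Z \<in> submodules S N"
      have "?g ` Z = {\<zero>\<^bsub>M\<^esub>} \<or> ?g ` Z = carrier M" by (rule bspec[OF * pull[OF Z]])
      then have "f ` ?g ` Z = {\<zero>\<^bsub>N\<^esub>} \<or> f ` ?g ` Z = carrier N"
        by (elim disjE) (simp_all only: z im simp_thms)
      then show "Z = {\<zero>\<^bsub>N\<^esub>} \<or> Z = carrier N"
        by (simp only: fg[OF sub(2)[OF Z]])
    qed
  next
    assume *: "\<forall>Z \<in> submodules S N. Z = {\<zero>\<^bsub>N\<^esub>} \<or> Z = carrier N"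
    show "\<forall>Y \<in> submodules R M. Y = {\<zero>\<^bsub>M\<^esub>} \<or> Y = carrier M"
    proof
      fix Y assume Y: "Y \<in> submodules R M"
      show "Y = {\<zero>\<^bsub>M\<^esub>} \<or> Y = carrier M"
        unfolding eq0[OF sub(1)[OF Y]] eqM[OF sub(1)[OF Y]] by (rule bspec[OF * push[OF Y]])
    qed
  qed
  then show "simple_module R M \<longleftrightarrow> simple_module S N"
    unfolding simple_module_def using eq0[OF order_refl] im by simp
qed

section \<open>The block structure attached to a sign character\<close>

locale attached_frame = type_B n \<epsilon> k \<gamma> \<mu>
  for n and \<epsilon> :: "nat \<Rightarrow> 'v::euclidean_space" and k \<gamma> \<mu> +
  fixes i :: nat and j :: "nat \<Rightarrow> nat" and \<sigma> :: "'v \<Rightarrow> 'v"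
  assumes attached: "attached_data n \<epsilon> \<mu> i j \<sigma>"
begin

abbreviation "stab \<equiv> stabilizer_A n \<epsilon> \<mu>"

definition j' :: "nat \<Rightarrow> nat" where "j' = inv_into {1..n} j"

lemma i_le_n: "i \<le> n"
proof -
  have "i = card {q \<in> {1..n}. \<mu>t q = 1}" using attached by (simp add: attached_data_def)
  also have "\<dots> \<le> card {1..n}" by (rule card_mono) auto
  finally show ?thesis by simp
qed

lemma sigma_WA: "\<sigma> \<in> WA"
  using attached by (simp add: attached_data_def weyl_A_eq)

lemma sigma_j: "p \<in> {1..n} \<Longrightarrow> \<sigma> (\<epsilon> (j p)) = \<epsilon> p"
  using attached by (simp add: attached_data_def)

lemma j_image: "j ` {1..i} = {q \<in> {1..n}. \<mu>t q = 1}" "j ` {i + 1..n} = {q \<in> {1..n}. \<mu>t q = -1}"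
  and j_mono: "strict_mono_on {1..i} j" "strict_mono_on {i + 1..n} j"
  using attached unfolding attached_data_def by blast+

lemma mu_j:
  assumes "p \<in> {1..n}"
  shows "j p \<in> {1..n}" "\<mu>t (j p) = (if p \<le> i then 1 else -1)"
proof -
  have "p \<in> {1..i} \<and> p \<le> i \<or> p \<in> {i + 1..n} \<and> \<not> p \<le> i" using assms by auto
  then have "j p \<in> {q \<in> {1..n}. \<mu>t q = 1} \<and> p \<le> i \<or> j p \<in> {q \<in> {1..n}. \<mu>t q = -1} \<and> \<not> p \<le> i"
    using j_image by blast
  then show "j p \<in> {1..n}" "\<mu>t (j p) = (if p \<le> i then 1 else -1)" by auto
qed

lemma j_bij: "bij_betw j {1..n} {1..n}"
proof -
  have "inj_on j {1..n}"
  proof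
    fix p q assume pq: "p \<in> {1..n}" "q \<in> {1..n}" "j p = j q"
    then show "p = q" using sigma_j[OF pq(1)] sigma_j[OF pq(2)] eps_inj[OF pq(1,2)] by simp
  qed
  moreover have "j ` {1..n} \<subseteq> {1..n}" using mu_j(1) by auto
  ultimately show ?thesis by (simp add: endo_inj_surj bij_betw_def)
qed

lemma j'_simps:
  "p \<in> {1..n} \<Longrightarrow> j' (j p) = p" "q \<in> {1..n} \<Longrightarrow> j (j' q) = q" "q \<in> {1..n} \<Longrightarrow> j' q \<in> {1..n}"
  using j_bij bij_betw_inv_into_left[OF j_bij] bij_betw_inv_into_right[OF j_bij] bij_betwE[OF bij_betw_inv_into[OF j_bij]]
  by (auto simp: j'_def)

lemma sigma_eps: "q \<in> {1..n} \<Longrightarrow> \<sigma> (\<epsilon> q) = \<epsilon> (j' q)"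
  using sigma_j[of "j' q"] j'_simps by simp

lemma mu_j': "q \<in> {1..n} \<Longrightarrow> \<mu>t q = 1 \<longleftrightarrow> j' q \<le> i"
  using mu_j(2)[OF j'_simps(3)[of q]] j'_simps(2)[of q] by (auto split: if_splits)

lemma j'_less:
  assumes "a \<in> {1..n}" "b \<in> {1..n}" "\<mu>t a = \<mu>t b"
  shows "j' a < j' b \<longleftrightarrow> a < b"
proof -
  have *: "p < q \<longrightarrow> j p < j q" if "p \<in> {1..n}" "q \<in> {1..n}" "p \<le> i \<longleftrightarrow> q \<le> i" for p q
    using that j_mono strict_mono_onD[of "{1..i}" j p q] strict_mono_onD[of "{i + 1..n}" j p q]
    by (cases "p \<le> i") auto
  have ab: "j' a \<in> {1..n}" "j' b \<in> {1..n}" "j' a \<le> i \<longleftrightarrow> j' b \<le> i"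
    using j'_simps(3)[OF assms(1)] j'_simps(3)[OF assms(2)] mu_j'[OF assms(1)] mu_j'[OF assms(2)] assms(3)
    by simp_all
  have "j' a < j' b \<longrightarrow> a < b" "j' b < j' a \<longrightarrow> b < a"
    using *[OF ab] *[OF ab(2,1)] ab(3) j'_simps(2) assms by auto
  moreover have "j' a = j' b \<longrightarrow> a = b" using j'_simps(2) assms by metis
  ultimately show ?thesis by (metis less_asym linorder_neqE_nat)
qed

lemma sigma_facts: "bij \<sigma>" "orthogonal_transformation \<sigma>" "linear \<sigma>" "iv \<sigma> \<in> WA"
  using sigma_WA reflection_group_bij reflection_group_orthogonal orthogonal_transformation_linear
    reflection_group_inv by blast+

lemma sigma_cancel [simp]: "iv \<sigma> (\<sigma> x) = x" "\<sigma> (iv \<sigma> x) = x"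
  using sigma_facts(1) by (auto simp: bij_is_inj inv_f_f bij_is_surj surj_f_inv_f)

text \<open>
  The roots that contribute to \<open>Y\<close> on functions supported on the stabilizer.
\<close>

definition same_sign :: "'v \<Rightarrow> bool"
  where "same_sign \<alpha> \<longleftrightarrow> (\<exists>a \<in> {1..n}. \<exists>b \<in> {1..n}. a \<noteq> b \<and> \<alpha> = \<epsilon> a - \<epsilon> b \<and> \<mu>t a = \<mu>t b)"

text \<open>
  Here the monotonicity of \<open>j\<close> on each of the two blocks enters.
\<close>

lemma same_sign_sigma: "same_sign \<alpha> \<Longrightarrow> \<sigma> \<alpha> \<in> pos_roots i \<longleftrightarrow> \<alpha> \<in> pos_roots n"
proof -
  assume "same_sign \<alpha>"
  then obtain a b where ab: "a \<in> {1..n}" "b \<in> {1..n}" "a \<noteq> b" "\<alpha> = \<epsilon> a - \<epsilon> b" "\<mu>t a = \<mu>t b"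
    by (auto simp: same_sign_def)
  have "\<sigma> \<alpha> = \<epsilon> (j' a) - \<epsilon> (j' b)"
    using ab by (simp add: linear_diff[OF sigma_facts(3)] sigma_eps)
  moreover have "j' a \<le> i \<longleftrightarrow> j' b \<le> i" using ab mu_j'[of a] mu_j'[of b] by simp
  ultimately show ?thesis
    using pos_roots_diff_iff[OF j'_simps(3)[OF ab(1)] j'_simps(3)[OF ab(2)]] pos_roots_diff_iff[OF ab(1,2)]
      j'_less[OF ab(1,2,5)] ab by auto
qed

lemma same_sign_inv_sigma: "\<beta> \<in> pos_roots i \<Longrightarrow> same_sign (iv \<sigma> \<beta>)"
proof -
  assume "\<beta> \<in> pos_roots i"
  then obtain p q where pq: "\<beta> = \<epsilon> p - \<epsilon> q" "p \<in> {1..n}" "q \<in> {1..n}" "p < q" "p \<le> i \<longleftrightarrow> q \<le> i"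
    by (rule pos_rootsE)
  have "\<beta> = \<sigma> (\<epsilon> (j p) - \<epsilon> (j q))"
    using pq by (simp add: linear_diff[OF sigma_facts(3)] sigma_j)
  then have "iv \<sigma> \<beta> = \<epsilon> (j p) - \<epsilon> (j q)" by simp
  moreover have "j p \<noteq> j q" using j'_simps(1)[OF pq(2)] j'_simps(1)[OF pq(3)] pq(4) by auto
  ultimately show ?thesis
    unfolding same_sign_def using mu_j[OF pq(2)] mu_j[OF pq(3)] pq(5)
    by (intro bexI[of _ "j p"] bexI[of _ "j q"]) auto
qed

lemma kB_same_sign: "same_sign \<alpha> \<Longrightarrow> kB \<alpha> = 2 * k"
proof -
  assume "same_sign \<alpha>"
  then obtain a b where ab: "a \<in> {1..n}" "b \<in> {1..n}" "a \<noteq> b" "\<alpha> = \<epsilon> a - \<epsilon> b" "\<mu>t a = \<mu>t b"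
    by (auto simp: same_sign_def)
  then show ?thesis using mu_t[OF ab(1)] by (auto simp: kB_root)
qed

lemma kB_nonzero_same_sign: "\<lbrakk>\<alpha> \<in> pos_roots n; kB \<alpha> \<noteq> 0\<rbrakk> \<Longrightarrow> same_sign \<alpha>"
proof -
  assume *: "\<alpha> \<in> pos_roots n" "kB \<alpha> \<noteq> 0"
  then obtain a b where ab: "\<alpha> = \<epsilon> a - \<epsilon> b" "a \<in> {1..n}" "b \<in> {1..n}" "a < b" by (metis pos_rootsE)
  then have "\<mu>t a = \<mu>t b" using kB_nonzero[OF ab(2,3)] * by auto
  then show ?thesis
    unfolding same_sign_def using ab by (intro bexI[of _ a] bexI[of _ b] conjI) auto
qed

lemma stab_WA: "stab \<subseteq> WA"
  by (auto simp: stabilizer_A_def weyl_A_eq)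

lemma stab_mu: "\<lbrakk>w \<in> stab; x \<in> TT\<rbrakk> \<Longrightarrow> \<mu> (iv w \<circ> x \<circ> w) = \<mu> x"
  by (simp add: stabilizer_A_def twist_sign_character_def)

text \<open>
  Evaluating \<open>\<mu>\<close> on the sign changes shows that the stabilizer consists of the permutations of the indices
  that preserve the sign of \<open>\<mu>\<close>.
\<close>

lemma stab_iff:
  assumes w: "w \<in> WA" and \<pi>: "\<And>p. p \<in> {1..n} \<Longrightarrow> \<pi> p \<in> {1..n}" "\<And>p. p \<in> {1..n} \<Longrightarrow> w (\<epsilon> p) = \<epsilon> (\<pi> p)"
    "\<pi> ` {1..n} = {1..n}"
  shows "w \<in> stab \<longleftrightarrow> (\<forall>p \<in> {1..n}. \<mu>t (\<pi> p) = \<mu>t p)"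
proof
  have t: "iv w \<circ> s (\<epsilon> (\<pi> p)) \<circ> w = s (\<epsilon> p)" if "p \<in> {1..n}" for p
    using conj_t(2)[OF w that \<pi>(1)[OF that] \<pi>(2)[OF that]] .
  show "\<forall>p \<in> {1..n}. \<mu>t (\<pi> p) = \<mu>t p" if "w \<in> stab"
    using stab_mu[OF that t_mem[OF \<pi>(1)]] t by metis
  assume eq: "\<forall>p \<in> {1..n}. \<mu>t (\<pi> p) = \<mu>t p"
  have bij: "bij w" "bij (iv w)" using w reflection_group_bij bij_imp_bij_inv by blast+
  have "\<mu> (iv w \<circ> x \<circ> w) = \<mu> x" if "x \<in> TT" for x
    using that
  proof (induction rule: TT_induct)
    case id
    show ?case by (simp only: comp_id inv_comp_self[OF w])
  next
    case (step \<alpha> x)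
    then obtain q where q: "\<alpha> = \<epsilon> q" "q \<in> {1..n}" by blast
    then obtain p where p: "p \<in> {1..n}" "q = \<pi> p" using \<pi>(3) by blast
    have "iv w \<circ> (s \<alpha> \<circ> x) \<circ> w = (iv w \<circ> s \<alpha> \<circ> w) \<circ> (iv w \<circ> x \<circ> w)"
      using conj_comp[OF bij(2), of "s \<alpha>" x] inv_inv_eq[OF bij(1)] by (simp only:)
    then have "\<mu> (iv w \<circ> (s \<alpha> \<circ> x) \<circ> w) = \<mu>t p * \<mu> x"
      using mu_comp[OF t_mem[OF p(1)] conj_TT'[OF w step.hyps(2)]] t[OF p(1)] step.IH q(1) p(2) by (simp only:)
    also have "\<dots> = \<mu> (s \<alpha> \<circ> x)"
      using mu_comp[OF t_mem[OF q(2)] step.hyps(2)] eq p q(1) by simp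
    finally show ?case .
  qed
  then show "w \<in> stab" using w by (simp add: stabilizer_A_def twist_sign_character_def weyl_A_eq)
qed

lemma WG_subset_WA: "WG i \<subseteq> WA"
proof (rule reflection_group_subset)
  fix \<alpha> assume "\<alpha> \<in> pos_roots i"
  then obtain p q where "\<alpha> = \<epsilon> p - \<epsilon> q" "p \<in> {1..n}" "q \<in> {1..n}" "p < q" by (rule pos_rootsE)
  then show "s \<alpha> \<in> WA" using reflection_mem[of p q n] by auto
qed

text \<open>
  The permutation \<open>\<sigma>\<close> numbers the indices of positive sign by \<open>1, \<dots>, i\<close> and the others by \<open>i + 1, \<dots>, n\<close>, so
  preserving the sign of \<open>\<mu>\<close> becomes preserving the two blocks.
\<close>

lemma stab_conj:
  assumes w: "w \<in> WA"
  shows "w \<in> stab \<longleftrightarrow> \<sigma> \<circ> w \<circ> iv \<sigma> \<in> WG i"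
proof -
  obtain \<pi> where \<pi>: "linear w" "bij_betw \<pi> {1..n} {1..n}" "\<And>p. p \<in> {1..n} \<Longrightarrow> \<pi> p \<in> {1..n}"
    "\<And>p. p \<in> {1..n} \<Longrightarrow> w (\<epsilon> p) = \<epsilon> (\<pi> p)" using w by (rule WAE) blast
  let ?w = "\<sigma> \<circ> w \<circ> iv \<sigma>" and ?\<tau> = "j' \<circ> \<pi> \<circ> j"
  have "iv \<sigma> (\<epsilon> p) = \<epsilon> (j p)" if "p \<in> {1..n}" for p
    using sigma_j[OF that] sigma_cancel(1)[of "\<epsilon> (j p)"] by simp
  then have val: "?w (\<epsilon> p) = \<epsilon> (?\<tau> p)" if "p \<in> {1..n}" for p
    using that by (simp only: o_apply \<pi>(3,4) mu_j(1) sigma_eps)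
  have lin: "linear ?w"
    using linear_compose[OF linear_compose[OF orthogonal_transformation_linear[OF reflection_group_orthogonal[OF sigma_facts(4)]] \<pi>(1)] sigma_facts(3)]
    by (simp only: o_assoc)
  have bj: "bij_betw ?\<tau> {1..n} {1..n}"
    using bij_betw_trans[OF bij_betw_trans[OF j_bij \<pi>(2)] bij_betw_inv_into[OF j_bij]] by (simp only: j'_def o_assoc)
  have blk: "?\<tau> p \<le> i \<longleftrightarrow> \<mu>t (\<pi> (j p)) = 1" "p \<le> i \<longleftrightarrow> \<mu>t (j p) = 1" if "p \<in> {1..n}" for p
    using mu_j'[OF \<pi>(3)[OF mu_j(1)[OF that]]] mu_j(2)[OF that] by (auto split: if_splits)
  have "w \<in> stab \<longleftrightarrow> (\<forall>p \<in> {1..n}. \<mu>t (\<pi> p) = \<mu>t p)"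
    using \<pi> by (intro stab_iff[OF w]) (auto simp: bij_betw_def)
  also have "\<dots> \<longleftrightarrow> (\<forall>p \<in> j ` {1..n}. \<mu>t (\<pi> p) = \<mu>t p)"
    by (simp only: bij_betw_imp_surj_on[OF j_bij])
  also have "\<dots> \<longleftrightarrow> (\<forall>p \<in> {1..n}. \<mu>t (\<pi> (j p)) = \<mu>t (j p))"
    by blast
  also have "\<dots> \<longleftrightarrow> (\<forall>p \<in> {1..n}. ?\<tau> p \<le> i \<longleftrightarrow> p \<le> i)"
  proof (rule ball_cong[OF refl])
    fix p assume p: "p \<in> {1..n}"
    show "\<mu>t (\<pi> (j p)) = \<mu>t (j p) \<longleftrightarrow> (?\<tau> p \<le> i \<longleftrightarrow> p \<le> i)"
      unfolding blk[OF p] using mu_t[OF \<pi>(3)[OF mu_j(1)[OF p]]] mu_t[OF mu_j(1)[OF p]] by auto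
  qed
  also have "\<dots> \<longleftrightarrow> ?w \<in> WG i"
  proof
    assume "\<forall>p \<in> {1..n}. ?\<tau> p \<le> i \<longleftrightarrow> p \<le> i"
    then have "block_perm i ?w ?\<tau>" unfolding block_perm_def using lin bj val by blast
    then show "?w \<in> WG i" by (rule block_perm_WG)
  next
    assume "?w \<in> WG i"
    then obtain \<tau> where \<tau>: "block_perm i ?w \<tau>" using WG_block_perm by blast
    have "\<tau> p = ?\<tau> p" if p: "p \<in> {1..n}" for p
    proof (rule eps_inj)
      show "\<tau> p \<in> {1..n}" using \<tau> p by (auto simp: block_perm_def dest: bij_betwE)
      show "?\<tau> p \<in> {1..n}" using bij_betwE[OF bj] p by blast
      show "\<epsilon> (\<tau> p) = \<epsilon> (?\<tau> p)" using \<tau> val[OF p] p by (simp add: block_perm_def)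
    qed
    then show "\<forall>p \<in> {1..n}. ?\<tau> p \<le> i \<longleftrightarrow> p \<le> i" using \<tau> by (simp add: block_perm_def)
  qed
  finally show ?thesis .
qed

lemma conj_stab: "w' \<in> WG i \<Longrightarrow> iv \<sigma> \<circ> w' \<circ> \<sigma> \<in> stab"
proof -
  assume w': "w' \<in> WG i"
  then have WA: "iv \<sigma> \<circ> w' \<circ> \<sigma> \<in> WA"
    using WG_subset_WA sigma_WA sigma_facts(4) by (blast intro: reflection_group_comp)
  have "\<sigma> \<circ> (iv \<sigma> \<circ> w' \<circ> \<sigma>) \<circ> iv \<sigma> = w'" by (simp add: fun_eq_iff)
  then show ?thesis using stab_conj[OF WA] w' by simp
qed

lemma stab_same_sign: "\<lbrakk>w \<in> stab; same_sign \<alpha>\<rbrakk> \<Longrightarrow> same_sign (w \<alpha>)"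
proof -
  assume w: "w \<in> stab" and "same_sign \<alpha>"
  then obtain a b where ab: "a \<in> {1..n}" "b \<in> {1..n}" "a \<noteq> b" "\<alpha> = \<epsilon> a - \<epsilon> b" "\<mu>t a = \<mu>t b"
    by (auto simp: same_sign_def)
  have wA: "w \<in> WA" using w stab_WA by blast
  obtain \<pi> where \<pi>: "linear w" "bij_betw \<pi> {1..n} {1..n}" "\<And>p. p \<in> {1..n} \<Longrightarrow> \<pi> p \<in> {1..n}"
    "\<And>p. p \<in> {1..n} \<Longrightarrow> w (\<epsilon> p) = \<epsilon> (\<pi> p)" using wA by (rule WAE) blast
  have "\<forall>p \<in> {1..n}. \<mu>t (\<pi> p) = \<mu>t p"
    using stab_iff[OF wA, of \<pi>] \<pi> w by (auto simp: bij_betw_def)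
  moreover have "w \<alpha> = \<epsilon> (\<pi> a) - \<epsilon> (\<pi> b)" using ab \<pi> by (simp add: linear_diff)
  moreover have "\<pi> a \<noteq> \<pi> b" using inj_onD[OF bij_betw_imp_inj_on[OF \<pi>(2)] _ ab(1,2)] ab(3) by blast
  ultimately show ?thesis
    unfolding same_sign_def using ab \<pi>(3) by (intro bexI[of _ "\<pi> a"] bexI[of _ "\<pi> b"]) auto
qed

lemma stab_comp: "\<lbrakk>u \<in> stab; w \<in> stab\<rbrakk> \<Longrightarrow> u \<circ> w \<in> stab"
  and stab_inv: "w \<in> stab \<Longrightarrow> iv w \<in> stab"
proof -
  assume w: "w \<in> stab"
  have wA: "w \<in> WA" using w stab_WA by blast
  have bij: "bij w" "bij \<sigma>" "bij (iv \<sigma>)" using wA reflection_group_bij sigma_facts by blast+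
  have "\<sigma> \<circ> iv w \<circ> iv \<sigma> = iv (\<sigma> \<circ> w \<circ> iv \<sigma>)"
    using bij by (simp only: o_inv_distrib bij_comp inv_inv_eq o_assoc)
  then show "iv w \<in> stab"
    using stab_conj[OF reflection_group_inv[OF wA]] stab_conj[OF wA] w reflection_group_inv by auto
  assume u: "u \<in> stab"
  have uA: "u \<in> WA" using u stab_WA by blast
  have "\<sigma> \<circ> (u \<circ> w) \<circ> iv \<sigma> = (\<sigma> \<circ> u \<circ> iv \<sigma>) \<circ> (\<sigma> \<circ> w \<circ> iv \<sigma>)" by (simp add: fun_eq_iff)
  then show "u \<circ> w \<in> stab"
    using stab_conj[OF reflection_group_comp[OF uA wA]] stab_conj[OF uA] stab_conj[OF wA] u w
      reflection_group_comp by metis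
qed

lemma stab_reflection: "same_sign \<alpha> \<Longrightarrow> s \<alpha> \<in> stab"
proof -
  assume "same_sign \<alpha>"
  then obtain a b where ab: "a \<in> {1..n}" "b \<in> {1..n}" "a \<noteq> b" "\<alpha> = \<epsilon> a - \<epsilon> b" "\<mu>t a = \<mu>t b"
    by (auto simp: same_sign_def)
  have sA: "s \<alpha> \<in> WA" unfolding ab(4) using ab by (intro reflection_mem) auto
  have "\<sigma> \<circ> s \<alpha> \<circ> iv \<sigma> = s (\<sigma> \<alpha>)" using reflection_apply_conjugate[OF sigma_facts(2,1)] by simp
  also have "\<sigma> \<alpha> = \<epsilon> (j' a) - \<epsilon> (j' b)" using ab by (simp add: linear_diff[OF sigma_facts(3)] sigma_eps)
  also have "s \<dots> \<in> WG i"
    using ab j'_simps mu_j' by (intro reflection_mem) (metis, metis, metis, metis)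
  finally show ?thesis using stab_conj[OF sA] by (simp only:)
qed

end

section \<open>Comparison of the two induced modules\<close>

context attached_frame
begin

text \<open>
  The restriction of \<open>\<^sup>\<sigma>\<gamma>\<close> to \<open>V\<close>.
\<close>

definition \<nu>' :: "'v \<Rightarrow> complex"
  where "\<nu>' v = \<nu> (iv \<sigma> v)"

lemma linear_nu': "linear \<nu>'"
  using linear_compose[OF orthogonal_transformation_linear[OF reflection_group_orthogonal[OF sigma_facts(4)]] linear_restriction]
  by (simp add: \<nu>'_def[abs_def] o_def)

sublocale G: graded_type_A n \<epsilon> k i \<nu>'
  by (intro graded_type_A.intro orthonormal_frame_axioms graded_type_A_axioms.intro i_le_n linear_nu')

lemma gamma_split: "\<gamma> z = \<nu> (fst z) + \<i> * \<nu> (snd z)"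
proof -
  have "z = real_vec (fst z) + cscale \<i> (real_vec (snd z))"
    by (cases z) (simp add: real_vec_def cscale_def)
  then show ?thesis
    using functional unfolding complex_functional_def \<nu>_def by metis
qed

lemma twist_gamma_split: "twist_functional \<sigma> \<gamma> z = \<nu>' (fst z) + \<i> * \<nu>' (snd z)"
  by (simp add: twist_functional_def gamma_split \<nu>'_def)

abbreviation "\<theta>B \<equiv> tensor_character n \<epsilon> k \<gamma> \<mu>"
abbreviation "\<theta>G \<equiv> symmetric_character n i \<epsilon> k (twist_functional \<sigma> \<gamma>)"

lemma commutative_part_eq: "commutative_part n \<epsilon> k = HB.A"
proof -
  have "vec_elems (H_B_pres n \<epsilon> k) \<union> grp_elems (H_B_pres n \<epsilon> k) TT = HB.cl ` symb ` (range Vec \<union> Grp ` TT)"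
    unfolding vec_elems_def grp_elems_def by blast
  then show ?thesis by (simp only: commutative_part_def)
qed

lemma symmetric_part_eq: "symmetric_part n i \<epsilon> k = G.Hgr.A"
proof -
  have "vec_elems (H_gr_pres n i \<epsilon> k) = G.Hgr.cl ` symb ` (range Vec \<union> Grp ` {})"
    unfolding vec_elems_def by blast
  then show ?thesis by (simp only: symmetric_part_def)
qed

lemma thetaB:
  "algebra_character HB.\<H> HB.A \<theta>B \<and> (\<forall>x \<in> range Vec \<union> Grp ` TT. \<theta>B (HB.cl (symb x)) = HB.\<omega> x)"
proof -
  have iff: "(\<forall>\<zeta>. \<theta> (HB.cl (vec_symb \<zeta>)) = \<gamma> \<zeta>) \<and> (\<forall>x \<in> TT. \<theta> (HB.cl (grp_symb x)) = \<mu> x) \<longleftrightarrow>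
      (\<forall>x \<in> range Vec \<union> Grp ` TT. \<theta> (HB.cl (symb x)) = HB.\<omega> x)" for \<theta> :: "'v hecke_gen ncpoly set \<Rightarrow> complex"
    unfolding HB.\<omega>_def ball_Un by (simp add: gamma_split)
  show ?thesis
    unfolding tensor_character_def commutative_part_eq iff
    by (rule someI_ex[OF HB.character_exists])
qed

lemma thetaG:
  "algebra_character G.Hgr.\<H> G.Hgr.A \<theta>G \<and>
   (\<forall>x \<in> range Vec \<union> Grp ` {}. \<theta>G (G.Hgr.cl (symb x)) = G.Hgr.\<omega> x)"
proof -
  have iff: "(\<forall>\<zeta>. \<theta> (G.Hgr.cl (vec_symb \<zeta>)) = twist_functional \<sigma> \<gamma> \<zeta>) \<longleftrightarrow>
      (\<forall>x \<in> range Vec \<union> Grp ` {}. \<theta> (G.Hgr.cl (symb x)) = G.Hgr.\<omega> x)"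
    for \<theta> :: "'v hecke_gen ncpoly set \<Rightarrow> complex"
    unfolding G.Hgr.\<omega>_def ball_Un by (simp add: twist_gamma_split)
  show ?thesis
    unfolding symmetric_character_def symmetric_part_eq iff
    by (rule someI_ex[OF G.Hgr.character_exists])
qed

sublocale SB: spanned_realization "H_B_pres n \<epsilon> k" HB.\<rho> WA "range Vec \<union> Grp ` TT" HB.\<omega> id Grp \<theta>B
  by (rule HB.spanned) (use thetaB in blast)+

sublocale SG: spanned_realization "H_gr_pres n i \<epsilon> k" G.Hgr.\<rho> "WG i" "range Vec \<union> Grp ` {}" G.Hgr.\<omega> id Grp \<theta>G
  by (rule G.Hgr.spanned) (use thetaG in blast)+

text \<open>
  The substitution \<open>w \<mapsto> \<sigma>w\<sigma>\<inverse>\<close>, which sends the point mass at \<open>w\<close> to the one at \<open>\<sigma>w\<sigma>\<inverse>\<close>.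
\<close>

definition \<Phi> :: "(('v \<Rightarrow> 'v) \<Rightarrow> complex) \<Rightarrow> ('v \<Rightarrow> 'v) \<Rightarrow> complex"
  where "\<Phi> f = (\<lambda>w. if w \<in> WG i then f (iv \<sigma> \<circ> w \<circ> \<sigma>) else 0)"

lemma linear_Phi: "linear_op \<Phi>"
  by (auto simp: linear_op_def \<Phi>_def fun_eq_iff fscale_apply)

lemma Phi_bij: "bij_betw \<Phi> (supported stab) (supported (WG i))"
proof (rule bij_betw_byWitness[where f' = "\<lambda>h w. if w \<in> stab then h (\<sigma> \<circ> w \<circ> iv \<sigma>) else 0"])
  have c: "iv \<sigma> \<circ> (\<sigma> \<circ> w \<circ> iv \<sigma>) \<circ> \<sigma> = w" "\<sigma> \<circ> (iv \<sigma> \<circ> w \<circ> \<sigma>) \<circ> iv \<sigma> = w" for w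
    by (simp_all add: fun_eq_iff)
  have m: "\<sigma> \<circ> w \<circ> iv \<sigma> \<in> WG i" if "w \<in> stab" for w
    using stab_conj that stab_WA by blast
  show "\<forall>f \<in> supported stab. (\<lambda>w. if w \<in> stab then \<Phi> f (\<sigma> \<circ> w \<circ> iv \<sigma>) else 0) = f"
  proof
    fix f assume "f \<in> supported stab"
    then have f0: "f w = 0" if "w \<notin> stab" for w using that by (simp add: supported_def)
    show "(\<lambda>w. if w \<in> stab then \<Phi> f (\<sigma> \<circ> w \<circ> iv \<sigma>) else 0) = f"
    proof
      fix w show "(if w \<in> stab then \<Phi> f (\<sigma> \<circ> w \<circ> iv \<sigma>) else 0) = f w"
        by (cases "w \<in> stab") (simp_all only: \<Phi>_def m c if_True if_False f0 not_False_eq_True)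
    qed
  qed
  show "\<forall>h \<in> supported (WG i). \<Phi> (\<lambda>w. if w \<in> stab then h (\<sigma> \<circ> w \<circ> iv \<sigma>) else 0) = h"
  proof
    fix h :: "('v \<Rightarrow> 'v) \<Rightarrow> complex" assume "h \<in> supported (WG i)"
    then have h0: "h w = 0" if "w \<notin> WG i" for w using that by (simp add: supported_def)
    show "\<Phi> (\<lambda>w. if w \<in> stab then h (\<sigma> \<circ> w \<circ> iv \<sigma>) else 0) = h"
    proof
      fix w show "\<Phi> (\<lambda>w. if w \<in> stab then h (\<sigma> \<circ> w \<circ> iv \<sigma>) else 0) w = h w"
        by (cases "w \<in> WG i") (simp_all only: \<Phi>_def conj_stab c if_True if_False h0 not_False_eq_True)
    qed
  qed
qed (auto simp: \<Phi>_def supported_def)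

text \<open>
  A term of nonzero weight moves \<open>w\<close> to \<open>s\<^sub>\<alpha>w = w s\<^sub>\<beta>\<close> with \<open>\<beta> = w\<inverse>\<alpha>\<close> and \<open>s\<^sub>\<beta>\<close> in the stabilizer, so it does not
  leave the coset of the stabilizer.
\<close>

lemma Y_stab:
  assumes f: "f \<in> supported stab"
  shows "B.Y v f \<in> supported stab"
  unfolding supported_def
proof (intro CollectI allI impI)
  fix w assume w: "w \<notin> stab"
  show "B.Y v f w = 0"
  proof (cases "w \<in> WA")
    case wA: True
    have "kB (iv w \<alpha>) * of_real (coroot \<alpha> v) * f (s \<alpha> \<circ> w) = 0"
      if \<alpha>: "\<alpha> \<in> pos_roots n" "iv w \<alpha> \<in> pos_roots n" for \<alpha>
    proof (cases "kB (iv w \<alpha>) = 0")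
      case False
      have st: "s (iv w \<alpha>) \<in> stab" by (rule stab_reflection[OF kB_nonzero_same_sign[OF \<alpha>(2) False]])
      have "s \<alpha> \<circ> w \<notin> stab"
      proof
        assume "s \<alpha> \<circ> w \<in> stab"
        then have "(w \<circ> s (iv w \<alpha>)) \<circ> s (iv w \<alpha>) \<in> stab"
          unfolding root_comp[OF wA] using st by (rule stab_comp)
        then show False using w by (simp only: comp_assoc reflection_comp_self comp_id)
      qed
      then show ?thesis using f by (simp only: supported_def mem_Collect_eq) simp
    qed simp
    then have "(\<Sum>\<alpha> \<in> {\<alpha> \<in> pos_roots n. iv w \<alpha> \<in> pos_roots n}. kB (iv w \<alpha>) * of_real (coroot \<alpha> v) * f (s \<alpha> \<circ> w)) = 0"
      by (intro sum.neutral) blast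
    moreover have "f w = 0" using f w by (simp add: supported_def)
    ultimately show ?thesis using wA by (simp only: B.Y_def if_True) simp
  qed (simp add: B.Y_def)
qed

lemma T_stab: 
  assumes u: "u \<in> stab" and f: "f \<in> supported stab"
  shows "Bop u f \<in> supported stab"
  unfolding supported_def
proof (intro CollectI allI impI)
  fix w assume w: "w \<notin> stab"
  have uA: "u \<in> WA" using u stab_WA by blast
  have "iv u \<circ> w \<notin> stab"
  proof
    assume "iv u \<circ> w \<in> stab"
    then have "u \<circ> (iv u \<circ> w) \<in> stab" by (rule stab_comp[OF u])
    moreover have "u \<circ> (iv u \<circ> w) = w"
      using reflection_group_bij[OF uA] by (auto simp: fun_eq_iff bij_is_surj surj_f_inv_f)
    ultimately show False using w by simp
  qed
  then show "Bop u f w = 0"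
    using f by (simp only: Bop_WA[OF uA] B.T_def supported_def mem_Collect_eq) simp
qed

lemma sign_stab:
  assumes x: "x \<in> TT" and f: "f \<in> supported stab"
  shows "Bop x f = \<mu> x \<bullet>\<^sub>C f"
proof
  fix w
  show "Bop x f w = (\<mu> x \<bullet>\<^sub>C f) w"
  proof (cases "w \<in> stab")
    case True
    then have "w \<in> WA" using stab_WA by blast
    then show ?thesis by (simp only: Bop_TT[OF x] stab_mu[OF True x] fscale_apply if_True)
  next
    case False
    then have "f w = 0" using f by (simp add: supported_def)
    then show ?thesis by (simp add: Bop_TT[OF x] fscale_apply)
  qed
qed

lemma Phi_T:
  assumes u: "u \<in> stab"
  shows "\<Phi> (Bop u f) = G.gr.T (\<sigma> \<circ> u \<circ> iv \<sigma>) (\<Phi> f)"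
proof
  fix w
  have uA: "u \<in> WA" using u stab_WA by blast
  have su: "\<sigma> \<circ> u \<circ> iv \<sigma> \<in> WG i" using stab_conj[OF uA] u by blast
  show "\<Phi> (Bop u f) w = G.gr.T (\<sigma> \<circ> u \<circ> iv \<sigma>) (\<Phi> f) w"
  proof (cases "w \<in> WG i")
    case w: True
    have cw: "iv \<sigma> \<circ> w \<circ> \<sigma> \<in> WA" using conj_stab[OF w] stab_WA by blast
    have m: "iv (\<sigma> \<circ> u \<circ> iv \<sigma>) \<circ> w \<in> WG i"
      by (rule reflection_group_comp[OF reflection_group_inv[OF su] w])
    have bij: "bij u" "bij \<sigma>" "bij (iv \<sigma>)" using uA reflection_group_bij sigma_facts by blast+
    have "iv (\<sigma> \<circ> u \<circ> iv \<sigma>) = \<sigma> \<circ> iv u \<circ> iv \<sigma>"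
      using bij by (simp only: o_inv_distrib bij_comp inv_inv_eq o_assoc)
    then have "iv \<sigma> \<circ> (iv (\<sigma> \<circ> u \<circ> iv \<sigma>) \<circ> w) \<circ> \<sigma> = iv u \<circ> (iv \<sigma> \<circ> w \<circ> \<sigma>)"
      by (simp add: fun_eq_iff)
    then show ?thesis
      using w cw m by (simp only: \<Phi>_def Bop_WA[OF uA] B.T_def G.gr.T_def if_True)
  qed (simp add: \<Phi>_def G.gr.T_def)
qed

text \<open>
  The terms whose root joins indices of different signs have weight zero. On the other terms \<open>\<sigma>\<close> is a
  bijection onto the terms of the operator for \<open>R\<^sub>i\<close>.
\<close>

lemma Phi_Y:
  assumes f: "f \<in> supported stab"
  shows "\<Phi> (B.Y v f) = G.gr.Y (\<sigma> v) (\<Phi> f)"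
proof
  fix w'
  show "\<Phi> (B.Y v f) w' = G.gr.Y (\<sigma> v) (\<Phi> f) w'"
  proof (cases "w' \<in> WG i")
    case w': True
    define w where "w = iv \<sigma> \<circ> w' \<circ> \<sigma>"
    have w: "w \<in> stab" unfolding w_def by (rule conj_stab[OF w'])
    then have wA: "w \<in> WA" using stab_WA by blast
    have iw: "iv w \<in> stab" by (rule stab_inv[OF w])
    have w'_eq: "w' = \<sigma> \<circ> w \<circ> iv \<sigma>" by (simp add: w_def fun_eq_iff)
    have bij: "bij w" "bij \<sigma>" "bij (iv \<sigma>)" using wA reflection_group_bij sigma_facts by blast+
    have "iv w' = \<sigma> \<circ> iv w \<circ> iv \<sigma>"
      unfolding w'_eq using bij by (simp only: o_inv_distrib bij_comp inv_inv_eq o_assoc)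
    then have iw': "iv w' (\<sigma> x) = \<sigma> (iv w x)" for x by simp
    let ?A = "{\<alpha> \<in> pos_roots n. iv w \<alpha> \<in> pos_roots n}"
    let ?A' = "{\<alpha> \<in> ?A. same_sign \<alpha>}"
    let ?D = "{\<beta> \<in> pos_roots i. iv w' \<beta> \<in> pos_roots i}"
    let ?a = "\<lambda>\<alpha>. kB (iv w \<alpha>) * of_real (coroot \<alpha> v) * f (s \<alpha> \<circ> w)"
    let ?d = "\<lambda>\<beta>. 2 * k * of_real (coroot \<beta> (\<sigma> v)) * \<Phi> f (s \<beta> \<circ> w')"
    have sgn: "same_sign (iv w \<alpha>)" if "same_sign \<alpha>" for \<alpha>
      using that by (rule stab_same_sign[OF iw])
    have "sum ?a ?A = sum ?a ?A'"
    proof (rule sum.mono_neutral_right)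
      show "\<forall>\<alpha> \<in> ?A - ?A'. ?a \<alpha> = 0"
      proof
        fix \<alpha> assume \<alpha>: "\<alpha> \<in> ?A - ?A'"
        have "\<not> same_sign (iv w \<alpha>)"
        proof
          assume "same_sign (iv w \<alpha>)"
          then have "same_sign (w (iv w \<alpha>))" by (rule stab_same_sign[OF w])
          then show False using \<alpha> bij(1) by (auto simp: bij_is_surj surj_f_inv_f)
        qed
        then have "kB (iv w \<alpha>) = 0" using kB_nonzero_same_sign[of "iv w \<alpha>"] \<alpha> by blast
        then show "?a \<alpha> = 0" by simp
      qed
    qed (auto intro: finite_subset[OF _ finite_pos_roots])
    also have "\<dots> = sum ?d ?D"
    proof (rule sum.reindex_bij_witness[where i = "iv \<sigma>" and j = \<sigma>])
      fix \<alpha> assume "\<alpha> \<in> ?A'"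
      then have \<alpha>: "\<alpha> \<in> pos_roots n" "iv w \<alpha> \<in> pos_roots n" "same_sign \<alpha>" by blast+
      show "iv \<sigma> (\<sigma> \<alpha>) = \<alpha>" by simp
      have s\<alpha>: "\<sigma> \<alpha> \<in> pos_roots i" using same_sign_sigma[OF \<alpha>(3)] \<alpha>(1) by simp
      moreover have "iv w' (\<sigma> \<alpha>) \<in> pos_roots i"
        unfolding iw' using same_sign_sigma[OF sgn[OF \<alpha>(3)]] \<alpha>(2) by simp
      ultimately show "\<sigma> \<alpha> \<in> ?D" by blast
      have "s (\<sigma> \<alpha>) = \<sigma> \<circ> s \<alpha> \<circ> iv \<sigma>"
        by (rule reflection_apply_conjugate[OF sigma_facts(2,1)])
      then have "iv \<sigma> \<circ> (s (\<sigma> \<alpha>) \<circ> w') \<circ> \<sigma> = s \<alpha> \<circ> w"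
        by (simp add: w_def fun_eq_iff)
      moreover have "s (\<sigma> \<alpha>) \<circ> w' \<in> WG i"
        by (rule reflection_group_comp[OF reflection_group_refl[OF s\<alpha>] w'])
      ultimately have "\<Phi> f (s (\<sigma> \<alpha>) \<circ> w') = f (s \<alpha> \<circ> w)" by (simp only: \<Phi>_def if_True)
      then show "?d (\<sigma> \<alpha>) = ?a \<alpha>"
        by (simp only: kB_same_sign[OF sgn[OF \<alpha>(3)]] coroot_conjugate[OF sigma_facts(2)])
    next
      fix \<beta> assume "\<beta> \<in> ?D"
      then have \<beta>: "\<beta> \<in> pos_roots i" "iv w' \<beta> \<in> pos_roots i" by blast+
      show "\<sigma> (iv \<sigma> \<beta>) = \<beta>" by simp
      have ss: "same_sign (iv \<sigma> \<beta>)" by (rule same_sign_inv_sigma[OF \<beta>(1)])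
      have "iv \<sigma> \<beta> \<in> pos_roots n" using same_sign_sigma[OF ss] \<beta>(1) by simp
      moreover have "iv w (iv \<sigma> \<beta>) \<in> pos_roots n"
        using same_sign_sigma[OF sgn[OF ss]] \<beta>(2) iw'[of "iv \<sigma> \<beta>"] by simp
      ultimately show "iv \<sigma> \<beta> \<in> ?A'" using ss by blast
    qed
    finally have sums: "sum ?a ?A = sum ?d ?D" .
    have "\<Phi> (B.Y v f) w' = \<nu> (iv w v) * f w - sum ?a ?A"
      using w' wA by (simp only: \<Phi>_def B.Y_def if_True flip: w_def)
    also have "\<dots> = \<nu>' (iv w' (\<sigma> v)) * \<Phi> f w' - sum ?d ?D"
      using w' by (simp only: sums iw' \<nu>'_def sigma_cancel \<Phi>_def if_True flip: w_def)
    also have "\<dots> = G.gr.Y (\<sigma> v) (\<Phi> f) w'" using w' by (simp only: G.gr.Y_def if_True)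
    finally show ?thesis .
  qed (simp add: \<Phi>_def G.gr.Y_def)
qed

text \<open>
  The generators of \<open>H\<^sub>B(\<mu>)\<close>.
\<close>

definition sub_gens :: "'v hecke_gen set"
  where "sub_gens = range (\<lambda>\<zeta>. Vec (real_vec \<zeta>)) \<union> Grp ` stab \<union> Grp ` TT"

text \<open>
  The subspace is automatically stable under the sign group, which acts by scalars on functions supported
  on the stabilizer.
\<close>

lemma stable_transfer:
  assumes S: "S \<subseteq> supported stab"
  shows "csubspace S \<and> (\<forall>x \<in> sub_gens. \<forall>f \<in> S. HB.\<rho> x f \<in> S) \<longleftrightarrow>
    csubspace (\<Phi> ` S) \<and> (\<forall>x \<in> fst (H_gr_pres n i \<epsilon> k). \<forall>h \<in> \<Phi> ` S. G.Hgr.\<rho> x h \<in> \<Phi> ` S)"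
proof -
  note sup = csubspaceD[OF csubspace_supported[of stab]]
  have mem: "\<Phi> f \<in> \<Phi> ` S \<longleftrightarrow> f \<in> S" if "f \<in> supported stab" for f
    using inj_on_image_mem_iff[OF bij_betw_imp_inj_on[OF Phi_bij] that S] .
  have lin: "\<Phi> 0 = 0" "\<Phi> (f + g) = \<Phi> f + \<Phi> g" "\<Phi> (c \<bullet>\<^sub>C f) = c \<bullet>\<^sub>C \<Phi> f" for f g c
    using linear_opD[OF linear_Phi] by blast+
  have Y: "B.Y v f \<in> S \<longleftrightarrow> G.gr.Y (\<sigma> v) (\<Phi> f) \<in> \<Phi> ` S" if "f \<in> S" for v f
  proof -
    have f: "f \<in> supported stab" using that S by blast
    show ?thesis using mem[OF Y_stab[OF f], of v] by (simp only: Phi_Y[OF f])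
  qed
  have T: "Bop u f \<in> S \<longleftrightarrow> G.gr.T (\<sigma> \<circ> u \<circ> iv \<sigma>) (\<Phi> f) \<in> \<Phi> ` S" if "u \<in> stab" "f \<in> S" for u f
  proof -
    have f: "f \<in> supported stab" using that S by blast
    show ?thesis using mem[OF T_stab[OF that(1) f]] by (simp only: Phi_T[OF that(1)])
  qed
  have "csubspace S \<longleftrightarrow> csubspace (\<Phi> ` S)"
  proof -
    have "0 \<in> S \<longleftrightarrow> 0 \<in> \<Phi> ` S" using mem[OF sup(1)] lin(1) by simp
    moreover have "f + g \<in> S \<longleftrightarrow> \<Phi> f + \<Phi> g \<in> \<Phi> ` S" if "f \<in> S" "g \<in> S" for f g
    proof -
      have "f + g \<in> supported stab" using that S by (intro sup(2)) blast+
      from mem[OF this] show ?thesis by (simp only: lin(2))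
    qed
    moreover have "c \<bullet>\<^sub>C f \<in> S \<longleftrightarrow> c \<bullet>\<^sub>C \<Phi> f \<in> \<Phi> ` S" if "f \<in> S" for f c
    proof -
      have "c \<bullet>\<^sub>C f \<in> supported stab" using that S by (intro sup(3)) blast
      from mem[OF this] show ?thesis by (simp only: lin(3))
    qed
    ultimately show ?thesis unfolding csubspace_def by (simp add: ball_simps(9))
  qed
  moreover have "(\<forall>x \<in> sub_gens. \<forall>f \<in> S. HB.\<rho> x f \<in> S) \<longleftrightarrow>
      (\<forall>x \<in> fst (H_gr_pres n i \<epsilon> k). \<forall>h \<in> \<Phi> ` S. G.Hgr.\<rho> x h \<in> \<Phi> ` S)" if cs: "csubspace S"
  proof
    have csP: "csubspace (\<Phi> ` S)" using cs \<open>csubspace S \<longleftrightarrow> csubspace (\<Phi> ` S)\<close> by blast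
    assume L: "\<forall>x \<in> sub_gens. \<forall>f \<in> S. HB.\<rho> x f \<in> S"
    have GY: "G.gr.Y v (\<Phi> f) \<in> \<Phi> ` S" if "f \<in> S" for v f
    proof -
      have "Vec (real_vec (iv \<sigma> v)) \<in> sub_gens" unfolding sub_gens_def by blast
      then have "HB.\<rho> (Vec (real_vec (iv \<sigma> v))) f \<in> S" using L that by blast
      then have "B.Y (iv \<sigma> v) f \<in> S" by (simp add: B.YC_real_vec)
      then show ?thesis using Y[OF that, of "iv \<sigma> v"] by simp
    qed
    show "\<forall>x \<in> fst (H_gr_pres n i \<epsilon> k). \<forall>h \<in> \<Phi> ` S. G.Hgr.\<rho> x h \<in> \<Phi> ` S"
    proof (intro ballI)
      fix x h assume x: "x \<in> fst (H_gr_pres n i \<epsilon> k)" and "h \<in> \<Phi> ` S"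
      then obtain f where f: "f \<in> S" "h = \<Phi> f" by blast
      from x consider z where "x = Vec z" | u where "x = Grp u" "u \<in> WG i"
        unfolding G.Hgr.P_gens by blast
      then show "G.Hgr.\<rho> x h \<in> \<Phi> ` S"
      proof cases
        case 1
        then show ?thesis
          using csubspaceD(2,3)[OF csP] GY[OF f(1)] by (simp add: f(2) G.gr.YC_def del: plus_fun_apply)
      next
        case 2
        let ?u = "iv \<sigma> \<circ> u \<circ> \<sigma>"
        have u: "?u \<in> stab" by (rule conj_stab[OF 2(2)])
        have eq: "\<sigma> \<circ> ?u \<circ> iv \<sigma> = u" by (simp add: fun_eq_iff)
        have "HB.\<rho> (Grp ?u) f \<in> S" using L f(1) u by (simp only: sub_gens_def) blast
        then have "Bop ?u f \<in> S" by (simp only: hecke_gen.case)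
        then show ?thesis using T[OF u f(1)] by (simp only: 2(1) f(2) hecke_gen.case eq)
      qed
    qed
  next
    assume R: "\<forall>x \<in> fst (H_gr_pres n i \<epsilon> k). \<forall>h \<in> \<Phi> ` S. G.Hgr.\<rho> x h \<in> \<Phi> ` S"
    show "\<forall>x \<in> sub_gens. \<forall>f \<in> S. HB.\<rho> x f \<in> S"
    proof (intro ballI)
      fix x f assume x: "x \<in> sub_gens" and f: "f \<in> S"
      from x consider \<zeta> where "x = Vec (real_vec \<zeta>)" | u where "x = Grp u" "u \<in> stab" | y where "x = Grp y" "y \<in> TT"
        unfolding sub_gens_def by blast
      then show "HB.\<rho> x f \<in> S"
      proof cases
        case 1
        have "G.Hgr.\<rho> (Vec (real_vec (\<sigma> \<zeta>))) (\<Phi> f) \<in> \<Phi> ` S"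
          using R f unfolding G.Hgr.P_gens by blast
        then have "G.gr.Y (\<sigma> \<zeta>) (\<Phi> f) \<in> \<Phi> ` S" by (simp add: G.gr.YC_real_vec)
        then show ?thesis using Y[OF f] by (simp add: 1 B.YC_real_vec)
      next
        case 2
        have "\<sigma> \<circ> u \<circ> iv \<sigma> \<in> WG i" using stab_conj 2(2) stab_WA by blast
        then have "G.Hgr.\<rho> (Grp (\<sigma> \<circ> u \<circ> iv \<sigma>)) (\<Phi> f) \<in> \<Phi> ` S"
          using R f unfolding G.Hgr.P_gens by blast
        then have "G.gr.T (\<sigma> \<circ> u \<circ> iv \<sigma>) (\<Phi> f) \<in> \<Phi> ` S" by (simp only: hecke_gen.case)
        then show ?thesis using T[OF 2(2) f] by (simp only: 2(1) hecke_gen.case)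
      next
        case 3
        have "Bop y f = \<mu> y \<bullet>\<^sub>C f" using f S by (intro sign_stab[OF 3(2)]) blast
        then show ?thesis using csubspaceD(3)[OF cs f] by (simp add: 3(1))
      qed
    qed
  qed
  ultimately show ?thesis by blast
qed

abbreviation "E \<equiv> E_one n \<epsilon> k \<gamma> \<mu>"
abbreviation "MG \<equiv> principal_gr n i \<epsilon> k (twist_functional \<sigma> \<gamma>)"
abbreviation "EC \<equiv> {x \<in> carrier SB.M. SB.\<psi> x \<in> supported stab}"

lemma E_eq: "E = SB.M\<lparr>carrier := EC\<rparr>"
  using SB.complex_span_eq[OF stab_WA]
  by (simp only: E_one_def principal_B_def commutative_part_eq SB.induction.cyc_def)

lemma MG_eq: "MG = SG.M"
  by (simp only: principal_gr_def symmetric_part_eq)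

lemma H_sub_eq: "H_B_sub n \<epsilon> k \<mu> = HB.\<H>\<lparr>carrier := generated_subalgebra HB.\<H> (HB.cl ` symb ` sub_gens)\<rparr>"
proof -
  have "{residue_class (H_B_pres n \<epsilon> k) (vec_symb (real_vec \<zeta>)) | \<zeta>. True} \<union>
       grp_elems (H_B_pres n \<epsilon> k) stab \<union> grp_elems (H_B_pres n \<epsilon> k) TT = HB.cl ` symb ` sub_gens"
    unfolding sub_gens_def grp_elems_def by blast
  then show ?thesis by (simp only: H_B_sub_def)
qed

lemma submodules_E:
  "N \<in> submodules (H_B_sub n \<epsilon> k \<mu>) E \<longleftrightarrow>
    N \<subseteq> EC \<and> csubspace (SB.\<psi> ` N) \<and> (\<forall>x \<in> sub_gens. \<forall>f \<in> SB.\<psi> ` N. HB.\<rho> x f \<in> SB.\<psi> ` N)"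
proof -
  have "sub_gens \<subseteq> fst (H_B_pres n \<epsilon> k)"
    unfolding sub_gens_def HB.P_gens using stab_WA WA_WB TT_WB by blast
  then show ?thesis
    unfolding submodules_def E_eq H_sub_eq mem_Collect_eq
    by (rule SB.submodule_iff_generators) (simp_all only: csubspace_supported)
qed

lemma submodules_MG:
  "N \<in> submodules (H_gr n i \<epsilon> k) MG \<longleftrightarrow>
    N \<subseteq> carrier SG.M \<and> csubspace (SG.\<psi> ` N) \<and>
    (\<forall>x \<in> fst (H_gr_pres n i \<epsilon> k). \<forall>f \<in> SG.\<psi> ` N. G.Hgr.\<rho> x f \<in> SG.\<psi> ` N)"
proof -
  have "carrier SG.M = {x \<in> carrier SG.M. SG.\<psi> x \<in> supported (WG i)}"
    using SG.psi_closed by blast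
  from SG.submodule_iff_generators[OF order_refl csubspace_supported this, of N] show ?thesis
    by (simp only: submodules_def MG_eq mem_Collect_eq G.Hgr.generators_generate[symmetric]) simp
qed

text \<open>
  The isomorphism from \<open>E\<^sub>1\<close> to \<open>M\<^sub>i(\<^sup>\<sigma>\<gamma>)\<close>, read through the realizations of the two modules on functions.
\<close>

definition F :: "('v hecke_gen ncpoly set \<times> complex \<Rightarrow>\<^sub>0 int) set \<Rightarrow> ('v hecke_gen ncpoly set \<times> complex \<Rightarrow>\<^sub>0 int) set"
  where "F x = inv_into (carrier SG.M) SG.\<psi> (\<Phi> (SB.\<psi> x))"

lemma F_mem: "x \<in> EC \<Longrightarrow> F x \<in> carrier SG.M"
  and psi_F: "x \<in> EC \<Longrightarrow> SG.\<psi> (F x) = \<Phi> (SB.\<psi> x)"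
proof -
  assume "x \<in> EC"
  then have "\<Phi> (SB.\<psi> x) \<in> SG.\<psi> ` carrier SG.M"
    using bij_betwE[OF Phi_bij] SG.psi_bij unfolding bij_betw_def by blast
  then show "F x \<in> carrier SG.M" "SG.\<psi> (F x) = \<Phi> (SB.\<psi> x)"
    unfolding F_def by (rule inv_into_into, rule f_inv_into_f)
qed

lemma F_bij: "bij_betw F (carrier E) (carrier MG)"
proof -
  have "supported stab \<subseteq> supported WA" using stab_WA by (auto simp: supported_def)
  then have "SB.\<psi> ` EC = supported stab" using SB.psi_surj by blast
  then have "bij_betw SB.\<psi> EC (supported stab)"
    using SB.psi_bij by (auto simp: bij_betw_def intro: inj_on_subset)
  from bij_betw_trans[OF bij_betw_trans[OF this Phi_bij] bij_betw_inv_into[OF SG.psi_bij]]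
  have "bij_betw F EC (carrier SG.M)"
    by (rule bij_betw_cong[THEN iffD1, rotated]) (simp add: F_def)
  then show ?thesis by (simp add: E_eq MG_eq)
qed

lemma F_add:
  assumes "x \<in> EC" "y \<in> EC"
  shows "F (x \<oplus>\<^bsub>SB.M\<^esub> y) = F x \<oplus>\<^bsub>SG.M\<^esub> F y"
proof (rule SG.psi_inj)
  have xy: "x \<oplus>\<^bsub>SB.M\<^esub> y \<in> EC"
    using assms csubspaceD(2)[OF csubspace_supported] by (auto simp: SB.psi_add)
  show "F (x \<oplus>\<^bsub>SB.M\<^esub> y) \<in> carrier SG.M" by (rule F_mem[OF xy])
  show "F x \<oplus>\<^bsub>SG.M\<^esub> F y \<in> carrier SG.M"
    by (rule SG.induction.M.a_closed[OF F_mem[OF assms(1)] F_mem[OF assms(2)]])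
  have "SG.\<psi> (F (x \<oplus>\<^bsub>SB.M\<^esub> y)) = \<Phi> (SB.\<psi> x + SB.\<psi> y)"
    using SB.psi_add[of x y] assms by (simp only: psi_F[OF xy] mem_Collect_eq)
  also have "\<dots> = SG.\<psi> (F x) + SG.\<psi> (F y)"
    by (simp only: linear_opD(1)[OF linear_Phi] psi_F[OF assms(1)] psi_F[OF assms(2)])
  also have "\<dots> = SG.\<psi> (F x \<oplus>\<^bsub>SG.M\<^esub> F y)"
    by (rule SG.psi_add[OF F_mem[OF assms(1)] F_mem[OF assms(2)], symmetric])
  finally show "SG.\<psi> (F (x \<oplus>\<^bsub>SB.M\<^esub> y)) = SG.\<psi> (F x \<oplus>\<^bsub>SG.M\<^esub> F y)" .
qed

lemma F_scale:
  assumes x: "x \<in> EC"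
  shows "F ((c \<odot>\<^bsub>HB.\<H>\<^esub> \<one>\<^bsub>HB.\<H>\<^esub>) \<odot>\<^bsub>SB.M\<^esub> x) = (c \<odot>\<^bsub>G.Hgr.\<H>\<^esub> \<one>\<^bsub>G.Hgr.\<H>\<^esub>) \<odot>\<^bsub>SG.M\<^esub> F x"
proof (rule SG.psi_inj)
  have cB: "c \<odot>\<^bsub>HB.\<H>\<^esub> \<one>\<^bsub>HB.\<H>\<^esub> \<in> carrier HB.\<H>" by (simp add: HB.cl_scalar)
  have cG: "c \<odot>\<^bsub>G.Hgr.\<H>\<^esub> \<one>\<^bsub>G.Hgr.\<H>\<^esub> \<in> carrier G.Hgr.\<H>" by (simp add: G.Hgr.cl_scalar)
  let ?x = "(c \<odot>\<^bsub>HB.\<H>\<^esub> \<one>\<^bsub>HB.\<H>\<^esub>) \<odot>\<^bsub>SB.M\<^esub> x"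
  have psi: "SB.\<psi> ?x = c \<bullet>\<^sub>C SB.\<psi> x"
    using SB.psi_smult[OF cB, of x] HB.act_scalar[OF SB.psi_closed, of x c] x
    by (simp only: mem_Collect_eq)
  have x': "?x \<in> EC"
    using SB.smult_closed[OF cB] x psi csubspaceD(3)[OF csubspace_supported] by auto
  have Fx: "F x \<in> carrier SG.M" by (rule F_mem[OF x])
  show "F ?x \<in> carrier SG.M" by (rule F_mem[OF x'])
  show "(c \<odot>\<^bsub>G.Hgr.\<H>\<^esub> \<one>\<^bsub>G.Hgr.\<H>\<^esub>) \<odot>\<^bsub>SG.M\<^esub> F x \<in> carrier SG.M" by (rule SG.smult_closed[OF cG Fx])
  have "SG.\<psi> (F ?x) = c \<bullet>\<^sub>C \<Phi> (SB.\<psi> x)"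
    by (simp only: psi_F[OF x'] psi linear_opD(2)[OF linear_Phi])
  also have "\<dots> = SG.\<psi> ((c \<odot>\<^bsub>G.Hgr.\<H>\<^esub> \<one>\<^bsub>G.Hgr.\<H>\<^esub>) \<odot>\<^bsub>SG.M\<^esub> F x)"
    using G.Hgr.act_scalar[OF SG.psi_closed[OF Fx], of c] by (simp only: SG.psi_smult[OF cG Fx] psi_F[OF x])
  finally show "SG.\<psi> (F ?x) = SG.\<psi> ((c \<odot>\<^bsub>G.Hgr.\<H>\<^esub> \<one>\<^bsub>G.Hgr.\<H>\<^esub>) \<odot>\<^bsub>SG.M\<^esub> F x)" .
qed

lemma submodules_F:
  assumes "N \<subseteq> carrier E"
  shows "N \<in> submodules (H_B_sub n \<epsilon> k \<mu>) E \<longleftrightarrow> F ` N \<in> submodules (H_gr n i \<epsilon> k) MG"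
proof -
  have N: "N \<subseteq> EC" using assms by (simp add: E_eq)
  have im: "SG.\<psi> ` F ` N = \<Phi> ` SB.\<psi> ` N"
    unfolding image_image by (rule image_cong[OF refl]) (use psi_F N in blast)
  have FN: "F ` N \<subseteq> carrier SG.M" using F_mem N by blast
  have "SB.\<psi> ` N \<subseteq> supported stab" using N by blast
  from stable_transfer[OF this] show ?thesis
    by (simp only: submodules_E submodules_MG im N FN simp_thms)
qed

lemma lattice_isomorphism:
  "submodule_lattices_iso (H_B_sub n \<epsilon> k \<mu>) E (H_gr n i \<epsilon> k) MG
   \<and> module_length (H_B_sub n \<epsilon> k \<mu>) E = module_length (H_gr n i \<epsilon> k) MG
   \<and> (simple_module (H_B_sub n \<epsilon> k \<mu>) E \<longleftrightarrow> simple_module (H_gr n i \<epsilon> k) MG)"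
proof -
  have zE: "\<zero>\<^bsub>SB.M\<^esub> \<in> EC"
    using SB.psi_zero csubspaceD(1)[OF csubspace_supported] by auto
  have "F \<zero>\<^bsub>SB.M\<^esub> = \<zero>\<^bsub>SG.M\<^esub>"
    by (rule SG.psi_inj[OF F_mem[OF zE] SG.induction.M.zero_closed])
      (simp only: psi_F[OF zE] SB.psi_zero SG.psi_zero linear_opD(3)[OF linear_Phi])
  then have zero: "F \<zero>\<^bsub>E\<^esub> = \<zero>\<^bsub>MG\<^esub>" "\<zero>\<^bsub>E\<^esub> \<in> carrier E" using zE by (simp_all add: E_eq MG_eq)
  have sub: "Y \<in> submodules (H_B_sub n \<epsilon> k \<mu>) E \<Longrightarrow> Y \<subseteq> carrier E"
    "Z \<in> submodules (H_gr n i \<epsilon> k) MG \<Longrightarrow> Z \<subseteq> carrier MG" for Y Z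
    unfolding submodules_E submodules_MG by (simp_all add: E_eq MG_eq)
  note transfer = submodules_transfer[OF F_bij zero sub submodules_F]
  have add: "F (x \<oplus>\<^bsub>E\<^esub> y) = F x \<oplus>\<^bsub>MG\<^esub> F y" if "x \<in> carrier E" "y \<in> carrier E" for x y
    using F_add that by (simp add: E_eq MG_eq)
  have scale: "F (scalar_act (H_B_sub n \<epsilon> k \<mu>) E c x) = scalar_act (H_gr n i \<epsilon> k) MG c (F x)"
    if "x \<in> carrier E" for c x
    using F_scale that by (simp add: E_eq MG_eq H_sub_eq scalar_act_def)
  have "submodule_lattices_iso (H_B_sub n \<epsilon> k \<mu>) E (H_gr n i \<epsilon> k) MG"
    unfolding submodule_lattices_iso_def
  proof (intro exI[of _ F] conjI ballI allI)
    show "Y \<subseteq> Z \<longleftrightarrow> F ` Y \<subseteq> F ` Z"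
      if "Y \<in> submodules (H_B_sub n \<epsilon> k \<mu>) E" "Z \<in> submodules (H_B_sub n \<epsilon> k \<mu>) E" for Y Z
      by (rule transfer(2)) (rule sub(1)[OF that(1)] | rule sub(1)[OF that(2)] | assumption)+
    show "bij_betw (\<lambda>Y. F ` Y) (submodules (H_B_sub n \<epsilon> k \<mu>) E) (submodules (H_gr n i \<epsilon> k) MG)"
      by (rule transfer(1))
  qed (rule F_bij add scale; assumption)+
  moreover have "module_length (H_B_sub n \<epsilon> k \<mu>) E = module_length (H_gr n i \<epsilon> k) MG"
    by (rule transfer(3))
  moreover have "simple_module (H_B_sub n \<epsilon> k \<mu>) E \<longleftrightarrow> simple_module (H_gr n i \<epsilon> k) MG"
    by (rule transfer(4))
  ultimately show ?thesis by blast
qed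

end

theorem proposition3p8:
  fixes \<epsilon> :: "nat \<Rightarrow> 'v::euclidean_space" and n i :: nat and k :: complex
    and \<gamma> :: "'v cpx \<Rightarrow> complex" and \<mu> :: "('v \<Rightarrow> 'v) \<Rightarrow> complex"
    and j :: "nat \<Rightarrow> nat" and \<sigma> :: "'v \<Rightarrow> 'v"
  assumes "n \<ge> 2"
    and "orthonormal_basis n \<epsilon>"
    and "k \<noteq> 0"
    and "complex_functional \<gamma>"
    and "sign_character n \<epsilon> \<mu>"
    and "attached_data n \<epsilon> \<mu> i j \<sigma>"
  shows "submodule_lattices_iso (H_B_sub n \<epsilon> k \<mu>) (E_one n \<epsilon> k \<gamma> \<mu>)
           (H_gr n i \<epsilon> k) (principal_gr n i \<epsilon> k (twist_functional \<sigma> \<gamma>))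
       \<and> module_length (H_B_sub n \<epsilon> k \<mu>) (E_one n \<epsilon> k \<gamma> \<mu>)
         = module_length (H_gr n i \<epsilon> k) (principal_gr n i \<epsilon> k (twist_functional \<sigma> \<gamma>))
       \<and> (simple_module (H_B_sub n \<epsilon> k \<mu>) (E_one n \<epsilon> k \<gamma> \<mu>)
          \<longleftrightarrow> simple_module (H_gr n i \<epsilon> k) (principal_gr n i \<epsilon> k (twist_functional \<sigma> \<gamma>)))"
proof -
  interpret attached_frame n \<epsilon> k \<gamma> \<mu> i j \<sigma>
    by unfold_locales (use assms in auto)
  show ?thesis by (rule lattice_isomorphism)
qed

end
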